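(* Let $d\ge 2$ and $\gamma>\frac12$ be fixed. Let $(X_{N(t)})_{t}$ be a sequence of well-separated spherical $t$-designs on $\mathbb{S}^d$, where $X_{N(t)}$ has $N=N(t)$ points and $N(t)\asymp t^d$. Then there exist positive constants $C^{(1)}_{d,\gamma}$ and $C^{(2)}_{d,\gamma}$ such that, writing $N=N(t)$, $$C^{(1)}_{d,\gamma}\,N^{-\frac12}(\ln N)^{-\gamma+\frac12}\;\le\;\mathrm{wce}\big(Q[X_N];\mathbb{H}^{(\frac d2,\gamma)}(\mathbb{S}^d)\big)\;\le\; C^{(2)}_{d,\gamma}\,N^{-\frac12}(\ln N)^{-\gamma+\frac12}.$$ The constants $C^{(1)}_{d,\gamma}$ and $C^{(2)}_{d,\gamma}$ depend only on $d$, $\gamma$ and on the constants $c_1,c_2$ from property (R) and $c_3$ from the well-separation condition.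
   Context: $\mathbb{S}^d\subset\mathbb{R}^{d+1}$ is the unit sphere, $\sigma_d$ its normalised surface measure ($\sigma_d(\mathbb{S}^d)=1$), $\mathrm{I}(f)=\int_{\mathbb{S}^d}f\,d\sigma_d$. For a finite set $X_N=\{\mathbf{x}_1,\dots,\mathbf{x}_N\}\subset\mathbb{S}^d$ let $Q[X_N](f)=\frac1N\sum_{i=1}^N f(\mathbf{x}_i)$. For a Banach space $B$ of continuous functions on $\mathbb{S}^d$, $\mathrm{wce}(Q;B)=\sup_{f\in B,\ \|f\|_B\le1}|Q(f)-\mathrm{I}(f)|$. Let $\{Y^{(d)}_{\ell,k}:k=1,\dots,Z(d,\ell)\}$ be an $L_2(\mathbb{S}^d,\sigma_d)$-orthonormal basis of the real spherical harmonics of degree $\ell$ ($Z(d,\ell)$ is the dimension of that space), $\hat f_{\ell,k}=\int_{\mathbb{S}^d}fY^{(d)}_{\ell,k}\,d\sigma_d$, and $\lambda_\ell=\ell(\ell+d-1)$. For $\gamma>\frac12$, $\mathbb{H}^{(\frac d2,\gamma)}(\mathbb{S}^d)$ is the space of all $f\in L_2(\mathbb{S}^d)$ with $$\|f\|^2_{\mathbb{H}^{(\frac d2,\gamma)}}=\sum_{\ell=0}^\infty w_\ell(d,\gamma)\sum_{k=1}^{Z(d,\ell)}|\hat f_{\ell,k}|^2<\infty,\qquad w_\ell(d,\gamma)=(1+\lambda_\ell)^{\frac d2}\big(\ln(3+\lambda_\ell)\big)^{2\gamma}.$$ It embeds into $C(\mathbb{S}^d)$ (functions are identified with their continuous representatives).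 A spherical $t$-design is a finite set $X_N\subset\mathbb{S}^d$ with $Q[X_N](p)=\mathrm{I}(p)$ for all polynomials $p$ of degree $\le t$. A sequence of $N$-point sets $X_N=\{\mathbf{x}_1,\dots,\mathbf{x}_N\}$ is well-separated if there is a constant $c_3>0$, the same for all members of the sequence, with $\min_{i\ne j}|\mathbf{x}_i-\mathbf{x}_j|>c_3N^{-1/d}$. Property (R), for a sequence of equal weight rules $Q[X_{N(t)}]$ exact for polynomials of degree $\le t$: there are positive constants $c_1\le\pi/2$ and $c_2$, independent of $t$, such that for all $t\ge1$ and all $\mathbf{x}\in\mathbb{S}^d$, $\frac{1}{N(t)}\#\{j:\mathbf{x}_j\in S(\mathbf{x};\frac{c_1}{t})\}\le c_2\,\sigma_d(S(\mathbf{x};\frac{c_1}{t}))$, where $S(\mathbf{x};\varphi)=\{\mathbf{y}\in\mathbb{S}^d:\langle\mathbf{x},\mathbf{y}\rangle\ge\cos\varphi\}$. (Every sequence of spherical $t$-designs has this property with $c_1,c_2$ depending only on $d$.) $a_n\asymp b_n$ means there are positive constants $C_1,C_2$ independent of $n$ with $C_1a_n\le b_n\le C_2a_n$ for all $n$.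
   Formalization: The upper constant C^(2) may also depend on the implied constants in N(t) ≍ t^d; without this the claim fails (many points in two small antipodal caps at t = 1). The lower constant C^(1) depends only on the data listed. *)

theory Defs
  imports "HOL-Probability.Probability"
begin

text \<open>
  The ambient space of the sphere is \<open>real ^ 'n\<close> with \<open>CARD('n) = d + 1\<close>. Functions on the sphere
  are functions on \<open>real ^ 'n\<close> of which only the values on \<open>sphere 0 1\<close> matter.
\<close>

text \<open>
  The normalised surface measure, by polar coordinates: the measure of a set \<open>A\<close> of unit vectors is
  the volume of the cone \<open>{r *\<^sub>R x | r x. 0 < r \<and> r < 1 \<and> x \<in> A}\<close> divided by the volume of the
  unit ball. The function \<open>sgn\<close> is the radial projection \<open>x \<mapsto> x /\<^sub>R norm x\<close>.
\<close>

definition sphere_measure :: "(real ^ 'n) measure" where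
  "sphere_measure = restrict_space (distr (uniform_measure lborel (ball 0 1)) borel sgn) (sphere 0 1)"

lemma prob_space_sphere_measure: "prob_space (sphere_measure :: (real ^ 'n) measure)"
proof -
  let ?U = "uniform_measure lborel (ball 0 1) :: (real ^ 'n) measure"
  have U: "prob_space ?U"
  proof (rule prob_space_uniform_measure)
    have "measure lborel (ball (0 :: real ^ 'n) 1) > 0"
      by (simp add: content_ball_pos)
    then show "emeasure lborel (ball (0 :: real ^ 'n) 1) \<noteq> 0"
      by (auto simp: measure_def)
    show "emeasure lborel (ball (0 :: real ^ 'n) 1) \<noteq> \<infinity>"
      using emeasure_lborel_ball_finite[of "0 :: real ^ 'n" 1] by simp
  qed
  have m: "sgn \<in> measurable ?U (borel :: (real ^ 'n) measure)"
    by (simp add: sgn_div_norm[abs_def])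
  interpret D: prob_space "distr ?U borel sgn"
    using prob_space.prob_space_distr[OF U m] .
  have "AE x in lborel. x \<noteq> (0 :: real ^ 'n)"
    by (rule AE_lborel_singleton)
  then have "AE x in ?U. sgn x \<in> sphere (0 :: real ^ 'n) 1"
    by (intro AE_uniform_measureI) (auto simp: norm_sgn elim!: eventually_mono)
  then have "AE x in distr ?U borel sgn. x \<in> sphere (0 :: real ^ 'n) 1"
    by (subst AE_distr_iff[OF m]) (auto simp del: mem_sphere_0 mem_sphere)
  then have "emeasure (distr ?U borel sgn) (sphere 0 1) = 1"
    by (intro D.emeasure_eq_1_AE) auto
  then show ?thesis
    unfolding sphere_measure_def
    by (intro prob_spaceI) (simp add: emeasure_restrict_space space_restrict_space)
qed

definition sphere_integral :: "(real ^ 'n \<Rightarrow> real) \<Rightarrow> real" where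
  "sphere_integral f = (LINT x|sphere_measure. f x)"

definition sphere_L2 :: "(real ^ 'n \<Rightarrow> real) set" where
  "sphere_L2 = {f. f \<in> borel_measurable sphere_measure \<and> integrable sphere_measure (\<lambda>x. (f x)\<^sup>2)}"

definition equal_weight_rule :: "(real ^ 'n) set \<Rightarrow> (real ^ 'n \<Rightarrow> real) \<Rightarrow> real" where
  "equal_weight_rule X f = (\<Sum>x\<in>X. f x) / real (card X)"

definition spherical_cap :: "real ^ 'n \<Rightarrow> real \<Rightarrow> (real ^ 'n) set" where
  "spherical_cap x \<phi> = {y \<in> sphere 0 1. x \<bullet> y \<ge> cos \<phi>}"

definition monomial :: "('n \<Rightarrow> nat) \<Rightarrow> real ^ 'n \<Rightarrow> real" where
  "monomial \<alpha> x = (\<Prod>i\<in>UNIV. x $ i ^ \<alpha> i)"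

lemma finite_multi_indices: "finite {\<alpha> :: 'n :: finite \<Rightarrow> nat. sum \<alpha> UNIV \<le> t}"
proof (rule finite_subset)
  show "{\<alpha> :: 'n \<Rightarrow> nat. sum \<alpha> UNIV \<le> t} \<subseteq> PiE UNIV (\<lambda>_. {..t})"
    proof
    fix \<alpha> :: "'n \<Rightarrow> nat" assume "\<alpha> \<in> {\<alpha>. sum \<alpha> UNIV \<le> t}"
    then have "\<alpha> i \<le> t" for i
      using member_le_sum[of i UNIV \<alpha>] by simp
    then show "\<alpha> \<in> PiE UNIV (\<lambda>_. {..t})" by (auto simp: PiE_def)
  qed
qed (simp add: finite_PiE)

definition polys_upto :: "nat \<Rightarrow> (real ^ 'n \<Rightarrow> real) set" where
  "polys_upto t = {p. \<exists>c. p = (\<lambda>x. \<Sum>\<alpha> | sum \<alpha> UNIV \<le> t. c \<alpha> * monomial \<alpha> x)}"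

definition homogeneous_polys :: "nat \<Rightarrow> (real ^ 'n \<Rightarrow> real) set" where
  "homogeneous_polys l = {p. \<exists>c. p = (\<lambda>x. \<Sum>\<alpha> | sum \<alpha> UNIV = l. c \<alpha> * monomial \<alpha> x)}"

definition laplacian :: "(real ^ 'n \<Rightarrow> real) \<Rightarrow> real ^ 'n \<Rightarrow> real" where
  "laplacian p x = (\<Sum>i\<in>UNIV. deriv (deriv (\<lambda>s. p (x + s *\<^sub>R axis i 1))) 0)"

definition spherical_harmonics :: "nat \<Rightarrow> (real ^ 'n \<Rightarrow> real) set" where
  "spherical_harmonics l =
     {f. \<exists>p \<in> homogeneous_polys l. (\<forall>x. laplacian p x = 0) \<and> (\<forall>x \<in> sphere 0 1. f x = p x)}"

text \<open>
  \<open>Y l 1, \<dots>, Y l (Z l)\<close> is an orthonormal basis of the space of spherical harmonics of degree \<open>l\<close>,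
  for every \<open>l\<close>. In particular \<open>Z l\<close> is the dimension of that space.
\<close>

definition harmonic_bases :: "(nat \<Rightarrow> nat) \<Rightarrow> (nat \<Rightarrow> nat \<Rightarrow> real ^ 'n \<Rightarrow> real) \<Rightarrow> bool" where
  "harmonic_bases Z Y \<longleftrightarrow>
     (\<forall>l. (\<forall>k \<in> {1..Z l}. Y l k \<in> spherical_harmonics l) \<and>
          (\<forall>j \<in> {1..Z l}. \<forall>k \<in> {1..Z l}.
             sphere_integral (\<lambda>x. Y l j x * Y l k x) = (if j = k then 1 else 0)) \<and>
          (\<forall>f \<in> spherical_harmonics l. \<exists>c. \<forall>x \<in> sphere 0 1. f x = (\<Sum>k = 1..Z l. c k * Y l k x)))"

definition laplace_eigenvalue :: "nat \<Rightarrow> nat \<Rightarrow> real" where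
  "laplace_eigenvalue d l = real l * (real l + real d - 1)"

definition sobolev_weight :: "nat \<Rightarrow> real \<Rightarrow> nat \<Rightarrow> real" where
  "sobolev_weight d \<gamma> l =
     (1 + laplace_eigenvalue d l) powr (real d / 2) * ln (3 + laplace_eigenvalue d l) powr (2 * \<gamma>)"

definition sobolev_term ::
  "nat \<Rightarrow> real \<Rightarrow> (nat \<Rightarrow> nat) \<Rightarrow> (nat \<Rightarrow> nat \<Rightarrow> real ^ 'n \<Rightarrow> real) \<Rightarrow> (real ^ 'n \<Rightarrow> real) \<Rightarrow> nat \<Rightarrow> real"
where
  "sobolev_term d \<gamma> Z Y f l =
     sobolev_weight d \<gamma> l * (\<Sum>k = 1..Z l. (sphere_integral (\<lambda>x. f x * Y l k x))\<^sup>2)"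

text \<open>The elements are the continuous representatives of the \<open>L\<^sub>2\<close> classes of finite norm.\<close>

definition sobolev_space ::
  "nat \<Rightarrow> real \<Rightarrow> (nat \<Rightarrow> nat) \<Rightarrow> (nat \<Rightarrow> nat \<Rightarrow> real ^ 'n \<Rightarrow> real) \<Rightarrow> (real ^ 'n \<Rightarrow> real) set"
where
  "sobolev_space d \<gamma> Z Y =
     {f \<in> sphere_L2. continuous_on (sphere 0 1) f \<and> summable (sobolev_term d \<gamma> Z Y f)}"

definition sobolev_norm ::
  "nat \<Rightarrow> real \<Rightarrow> (nat \<Rightarrow> nat) \<Rightarrow> (nat \<Rightarrow> nat \<Rightarrow> real ^ 'n \<Rightarrow> real) \<Rightarrow> (real ^ 'n \<Rightarrow> real) \<Rightarrow> real"
where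
  "sobolev_norm d \<gamma> Z Y f = sqrt (\<Sum>l. sobolev_term d \<gamma> Z Y f l)"

text \<open>Taken in \<open>ereal\<close>, so that the supremum is meaningful without knowing that it is finite.\<close>

definition worst_case_error ::
  "(real ^ 'n) set \<Rightarrow> (real ^ 'n \<Rightarrow> real) set \<Rightarrow> ((real ^ 'n \<Rightarrow> real) \<Rightarrow> real) \<Rightarrow> ereal"
where
  "worst_case_error X B nrm =
     (SUP f \<in> {f \<in> B. nrm f \<le> 1}. ereal \<bar>equal_weight_rule X f - sphere_integral f\<bar>)"

definition sobolev_wce ::
  "nat \<Rightarrow> real \<Rightarrow> (nat \<Rightarrow> nat) \<Rightarrow> (nat \<Rightarrow> nat \<Rightarrow> real ^ 'n \<Rightarrow> real) \<Rightarrow> (real ^ 'n) set \<Rightarrow> ereal"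
where
  "sobolev_wce d \<gamma> Z Y X = worst_case_error X (sobolev_space d \<gamma> Z Y) (sobolev_norm d \<gamma> Z Y)"

definition spherical_design :: "nat \<Rightarrow> (real ^ 'n) set \<Rightarrow> bool" where
  "spherical_design t X \<longleftrightarrow>
     finite X \<and> X \<subseteq> sphere 0 1 \<and> (\<forall>p \<in> polys_upto t. equal_weight_rule X p = sphere_integral p)"

text \<open>Sequences of point sets are indexed by \<open>t \<ge> 1\<close>; the set at \<open>t = 0\<close> plays no role.\<close>

definition design_sequence :: "(nat \<Rightarrow> (real ^ 'n) set) \<Rightarrow> bool" where
  "design_sequence X \<longleftrightarrow> (\<forall>t \<ge> 1. spherical_design t (X t))"

definition well_separated :: "nat \<Rightarrow> real \<Rightarrow> (nat \<Rightarrow> (real ^ 'n) set) \<Rightarrow> bool" where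
  "well_separated d c3 X \<longleftrightarrow>
     c3 > 0 \<and>
     (\<forall>t \<ge> 1. \<forall>x \<in> X t. \<forall>y \<in> X t. x \<noteq> y \<longrightarrow>
        dist x y > c3 * real (card (X t)) powr (- 1 / real d))"

definition property_R :: "real \<Rightarrow> real \<Rightarrow> (nat \<Rightarrow> (real ^ 'n) set) \<Rightarrow> bool" where
  "property_R c1 c2 X \<longleftrightarrow>
     0 < c1 \<and> c1 \<le> pi / 2 \<and> 0 < c2 \<and>
     (\<forall>t \<ge> 1. \<forall>x \<in> sphere 0 1.
        real (card (X t \<inter> spherical_cap x (c1 / real t))) / real (card (X t))
          \<le> c2 * measure sphere_measure (spherical_cap x (c1 / real t)))"

definition same_order :: "real \<Rightarrow> real \<Rightarrow> (nat \<Rightarrow> real) \<Rightarrow> (nat \<Rightarrow> real) \<Rightarrow> bool" where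
  "same_order b1 b2 a b \<longleftrightarrow> b1 > 0 \<and> b2 > 0 \<and> (\<forall>n \<ge> 1. b1 * a n \<le> b n \<and> b n \<le> b2 * a n)"

definition two_sided_wce_bound ::
  "nat \<Rightarrow> real \<Rightarrow> (nat \<Rightarrow> nat) \<Rightarrow> (nat \<Rightarrow> nat \<Rightarrow> real ^ 'n \<Rightarrow> real) \<Rightarrow> (nat \<Rightarrow> (real ^ 'n) set) \<Rightarrow>
   real \<Rightarrow> real \<Rightarrow> bool"
where
  "two_sided_wce_bound d \<gamma> Z Y X C1 C2 \<longleftrightarrow>
     (\<forall>t \<ge> 1. let N = real (card (X t)) in
        ereal (C1 * N powr (- 1 / 2) * ln N powr (- \<gamma> + 1 / 2)) \<le> sobolev_wce d \<gamma> Z Y (X t) \<and>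
        sobolev_wce d \<gamma> Z Y (X t) \<le> ereal (C2 * N powr (- 1 / 2) * ln N powr (- \<gamma> + 1 / 2)))"

end

theory Submission
  imports Defs
begin

text \<open>
  Put \<open>A\<^sub>l = \<Sum>\<^sub>k Q(Y\<^sub>l\<^sub>k)\<^sup>2\<close>. By Cauchy--Schwarz the squared worst-case error is governed by \<open>\<Sum>\<^sub>l A\<^sub>l / w\<^sub>l\<close> over
  \<open>l \<ge> 1\<close>, and for a design only \<open>l > t\<close> contributes. It suffices to know that the partial sums of \<open>A\<^sub>l\<close> up to
  \<open>L\<close> are of order \<open>L\<^sup>d / N\<close>: every dyadic block \<open>2\<^sup>j t < l \<le> 2\<^sup>j\<^sup>+\<^sup>1 t\<close> then contributes \<open>(j + ln t)\<^sup>-\<^sup>2\<^sup>\<gamma> / N\<close>,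
  and summation over \<open>j\<close> gives \<open>(ln N)\<^sup>1\<^sup>-\<^sup>2\<^sup>\<gamma> / N\<close>.

  The upper bound for the partial sums is dual to a large sieve inequality at separated points. It holds
  because the square of a harmonic polynomial is at most its mean over a small ball: balls of radius \<open>c / L\<close> around
  the points are disjoint and lie in a thin shell about the sphere, where orthogonality of harmonic polynomials
  of distinct degrees evaluates the integral.

  The lower bound holds for all \<open>N\<close>-point sets. A power of the Dirichlet kernel, squared, is a nonnegative
  polynomial kernel of degree of order \<open>L\<close>; normalised to have bounded row integrals, its diagonal is of order
  \<open>L\<^sup>d\<close>, and the quadratic form of the rule is at least its diagonal part.
\<close>

section \<open>Homogeneous polynomials\<close>

text \<open>The work is done with harmonic polynomials on the ambient space, not with zonal
  functions or the spherical Laplacian. They obey a mean value property on solid balls, which is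
  what the sieve needs, and orthogonality between degrees reduces through polar coordinates to
  Gaussian integrals, where integration by parts is an identity between one-dimensional moments.

  The norm sees a function only through its coefficients, so the upper bound also needs that the
  expansion of f converges to f at every point; this rests on \<gamma> > 1/2 and on
  Stone-Weierstrass.

  Radii of order 1/L keep the growth (1 + c/L)^(2L) of the polynomials off the sphere bounded, and
  the volume of the shell divided by that of a ball has order L^d.

  Upper bounds on partial sums control every dyadic block, but lower bounds do not: the energy of an
  arbitrary point set may sit in earlier degrees. The lower bound is therefore summed by parts
  against differences of 1/w at the degrees 2 d 2^j, where J <= j < 2 J and 2^J has order N. These
  levels, about ln N in number, each contribute order (ln N)^(-2\<gamma>) / N.\<close>

lemma multi_index_SucE:
  fixes \<alpha> :: "'n::finite \<Rightarrow> nat"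
  assumes "sum \<alpha> UNIV = Suc l"
  obtains i \<beta> where "sum \<beta> UNIV = l" "\<alpha> = \<beta>(i := Suc (\<beta> i))"
proof -
  from assms have "\<exists>i. \<alpha> i \<noteq> 0"
    by (metis (no_types, lifting) nat.distinct(1) sum.neutral)
  then obtain i where i: "\<alpha> i \<noteq> 0" by blast
  define \<beta> where "\<beta> = \<alpha>(i := \<alpha> i - 1)"
  have \<alpha>: "\<alpha> = \<beta>(i := Suc (\<beta> i))"
    using i by (auto simp: \<beta>_def fun_eq_iff)
  have "sum \<alpha> UNIV = Suc (sum \<beta> UNIV)"
    by (subst \<alpha>) (simp add: sum.remove[of UNIV i] cong: sum.cong_simp)
  then have "sum \<beta> UNIV = l" using assms by simp
  with \<alpha> that show thesis by blast
qed

lemma sum_fun_upd_Suc: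
  fixes \<beta> :: "'n::finite \<Rightarrow> nat"
  shows "sum (\<beta>(i := Suc (\<beta> i))) UNIV = Suc (sum \<beta> UNIV)"
  by (simp add: sum.remove[of UNIV i] cong: sum.cong_simp)

lemma monomial_fun_upd_Suc:
  fixes \<beta> :: "'n::finite \<Rightarrow> nat"
  shows "monomial (\<beta>(i := Suc (\<beta> i))) x = x $ i * monomial \<beta> x"
  by (simp add: monomial_def prod.remove[of UNIV i] mult.assoc cong: prod.cong_simp)

lemma finite_multi_indices_eq [simp]: "finite {\<alpha> :: 'n :: finite \<Rightarrow> nat. sum \<alpha> UNIV = l}"
  by (rule finite_subset[OF _ finite_multi_indices[of l]]) auto

text \<open>Hides the coefficient representation: facts can be checked on constants, coordinate
  multiples and sums. Scalar multiples need no case of their own, since the coefficient of a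
  monomial enters at degree 0 and is carried along by the coordinate multiplications.\<close>

lemma homogeneous_polys_induct [consumes 1, case_names const mult add]:
  fixes p :: "real ^ 'n::finite \<Rightarrow> real"
  assumes p: "p \<in> homogeneous_polys l"
    and const: "\<And>c. P 0 (\<lambda>x. c)"
    and mult: "\<And>l q i. P l q \<Longrightarrow> P (Suc l) (\<lambda>x. x $ i * q x)"
    and add: "\<And>l p q. P l p \<Longrightarrow> P l q \<Longrightarrow> P l (\<lambda>x. p x + q x)"
  shows "P l p"
proof -
  have zero: "P l (\<lambda>x. 0)"
  proof (induction l)
    case 0 show ?case by (rule const)
  next
    case (Suc l)
    \<comment> \<open>Any coordinate serves, as the other factor is zero.\<close>
    from mult[OF this, of undefined] show ?case by simp
  qed
  have mono: "P l (\<lambda>x. c * monomial \<alpha> x)" if "sum \<alpha> UNIV = l" for \<alpha> :: "'n \<Rightarrow> nat" and c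
    using that
  proof (induction l arbitrary: \<alpha>)
    case 0
    then have "(\<lambda>x. c * monomial \<alpha> x) = (\<lambda>x. c)" by (auto simp: monomial_def)
    then show ?case using const by simp
  next
    case (Suc l)
    from multi_index_SucE[OF Suc.prems] obtain i \<beta>
      where *: "sum \<beta> UNIV = l" "\<alpha> = \<beta>(i := Suc (\<beta> i))" by metis
    have "(\<lambda>x. c * monomial \<alpha> x) = (\<lambda>x. x $ i * (c * monomial \<beta> x))"
      unfolding *(2) monomial_fun_upd_Suc by (simp add: mult_ac)
    then show ?case using mult[OF Suc.IH[OF *(1)], of i] by simp
  qed
  from p obtain c where c: "p = (\<lambda>x. \<Sum>\<alpha> | sum \<alpha> UNIV = l. c \<alpha> * monomial \<alpha> x)"
    by (auto simp: homogeneous_polys_def)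
  have "P l (\<lambda>x. \<Sum>\<alpha>\<in>A. c \<alpha> * monomial \<alpha> x)" if "finite A" "\<forall>\<alpha>\<in>A. sum \<alpha> UNIV = l" for A
    using that
  proof (induction A rule: finite_induct)
    case (insert \<alpha> A)
    have "P l (\<lambda>x. c \<alpha> * monomial \<alpha> x + (\<Sum>\<alpha>\<in>A. c \<alpha> * monomial \<alpha> x))"
      by (rule add[OF mono insert.IH]) (use insert.prems in blast)+
    then show ?case using insert.hyps by simp
  qed (simp add: zero)
  then show ?thesis unfolding c by this (use finite_multi_indices_eq in blast)+
qed

lemma homogeneous_polys_add:
  assumes "p \<in> homogeneous_polys l" "q \<in> homogeneous_polys l"
  shows "(\<lambda>x. p x + q x) \<in> homogeneous_polys l"
proof -
  from assms obtain c c' where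
    "p = (\<lambda>x. \<Sum>\<alpha> | sum \<alpha> UNIV = l. c \<alpha> * monomial \<alpha> x)"
    "q = (\<lambda>x. \<Sum>\<alpha> | sum \<alpha> UNIV = l. c' \<alpha> * monomial \<alpha> x)"
    by (auto simp: homogeneous_polys_def)
  then show ?thesis
    unfolding homogeneous_polys_def
    by (auto intro!: exI[of _ "\<lambda>\<alpha>. c \<alpha> + c' \<alpha>"] simp: sum.distrib algebra_simps)
qed

lemma homogeneous_polys_cmult:
  assumes "p \<in> homogeneous_polys l"
  shows "(\<lambda>x. a * p x) \<in> homogeneous_polys l"
proof -
  from assms obtain c where
    "p = (\<lambda>x. \<Sum>\<alpha> | sum \<alpha> UNIV = l. c \<alpha> * monomial \<alpha> x)"
    by (auto simp: homogeneous_polys_def)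
  then show ?thesis
    unfolding homogeneous_polys_def
    by (auto intro!: exI[of _ "\<lambda>\<alpha>. a * c \<alpha>"] simp: sum_distrib_left algebra_simps)
qed

lemma homogeneous_polys_zero [simp]: "(\<lambda>x. 0) \<in> homogeneous_polys l"
  unfolding homogeneous_polys_def by (auto intro!: exI[of _ "\<lambda>\<alpha>. 0"])

lemma homogeneous_polys_sum:
  assumes "\<And>i. i \<in> A \<Longrightarrow> f i \<in> homogeneous_polys l"
  shows "(\<lambda>x. \<Sum>i\<in>A. f i x) \<in> homogeneous_polys l"
  using assms by (induction A rule: infinite_finite_induct) (auto intro: homogeneous_polys_add)

lemma homogeneous_polys_monomial:
  assumes "sum \<alpha> UNIV = l"
  shows "monomial \<alpha> \<in> homogeneous_polys l"
proof -
  have "monomial \<alpha> x = (\<Sum>\<beta> | sum \<beta> UNIV = l. (if \<beta> = \<alpha> then 1 else 0) * monomial \<beta> x)" for x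
  proof -
    have "(\<Sum>\<beta> | sum \<beta> UNIV = l. (if \<beta> = \<alpha> then 1 else 0) * monomial \<beta> x) =
        (\<Sum>\<beta> | sum \<beta> UNIV = l. if \<beta> = \<alpha> then monomial \<beta> x else 0)"
      by (intro sum.cong refl) (simp only: if_distrib[of "\<lambda>u. u * _"] mult_1 mult_zero_left)
    also have "\<dots> = monomial \<alpha> x" using assms by (subst sum.delta) simp_all
    finally show ?thesis by (rule sym)
  qed
  then show ?thesis unfolding homogeneous_polys_def
    by (intro CollectI exI[of _ "\<lambda>\<beta>. if \<beta> = \<alpha> then 1 else 0"] ext)
qed

lemma homogeneous_polys_const [simp]: "(\<lambda>x. c) \<in> homogeneous_polys 0"
proof -
  have "(\<lambda>x. c * monomial (\<lambda>_. 0) x) \<in> homogeneous_polys 0"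
    by (intro homogeneous_polys_cmult homogeneous_polys_monomial) simp
  then show ?thesis unfolding monomial_def by simp
qed

lemma homogeneous_polys_0E:
  assumes "p \<in> homogeneous_polys 0"
  obtains c where "p = (\<lambda>x. c)"
proof -
  have "\<exists>c. p = (\<lambda>x. c)" if "p \<in> homogeneous_polys l" "l = 0" for l
    using that by (induction rule: homogeneous_polys_induct) auto
  with assms that show thesis by blast
qed

lemma homogeneous_polys_coord_mult:
  assumes "p \<in> homogeneous_polys l"
  shows "(\<lambda>x. x $ i * p x) \<in> homogeneous_polys (Suc l)"
proof -
  from assms obtain c where
    p: "p = (\<lambda>x. \<Sum>\<alpha> | sum \<alpha> UNIV = l. c \<alpha> * monomial \<alpha> x)"
    by (auto simp: homogeneous_polys_def)
  have "(\<lambda>x. x $ i * p x) =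
      (\<lambda>x. \<Sum>\<alpha> | sum \<alpha> UNIV = l. c \<alpha> * monomial (\<alpha>(i := Suc (\<alpha> i))) x)"
    unfolding p monomial_fun_upd_Suc by (simp add: sum_distrib_left mult_ac)
  then show ?thesis
    by (auto intro!: homogeneous_polys_sum homogeneous_polys_cmult homogeneous_polys_monomial
      simp: sum_fun_upd_Suc simp del: fun_upd_apply)
qed

lemma homogeneous_polys_mult:
  assumes "p \<in> homogeneous_polys l" "q \<in> homogeneous_polys m"
  shows "(\<lambda>x. p x * q x) \<in> homogeneous_polys (l + m)"
  using assms
proof (induction rule: homogeneous_polys_induct)
  case (const c) then show ?case by (auto intro: homogeneous_polys_cmult)
next
  case (mult l p i) then show ?case by (auto dest: homogeneous_polys_coord_mult[of _ _ i] simp: mult.assoc)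
next
  case (add l p q) then show ?case by (auto intro: homogeneous_polys_add simp: distrib_right)
qed

lemma homogeneous_polys_coord: "(\<lambda>x. x $ i) \<in> homogeneous_polys 1"
  using homogeneous_polys_coord_mult[of "\<lambda>x. 1" 0 i] by simp

lemma homogeneous_polys_inner: "(\<lambda>x. y \<bullet> x) \<in> homogeneous_polys 1"
  unfolding inner_vec_def
  by (auto intro!: homogeneous_polys_sum homogeneous_polys_cmult homogeneous_polys_coord[simplified])

lemma homogeneous_polys_norm2: "(\<lambda>x. x \<bullet> x) \<in> homogeneous_polys 2"
  unfolding inner_vec_def
  using homogeneous_polys_mult[OF homogeneous_polys_coord homogeneous_polys_coord]
  by (auto intro!: homogeneous_polys_sum simp: numeral_2_eq_2)

lemma homogeneous_polys_power:
  assumes "p \<in> homogeneous_polys l"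
  shows "(\<lambda>x. p x ^ j) \<in> homogeneous_polys (j * l)"
  by (induction j) (auto intro: homogeneous_polys_mult assms)

lemma homogeneous_polys_scale:
  assumes "p \<in> homogeneous_polys l"
  shows "p (r *\<^sub>R x) = r ^ l * p x"
  using assms by (induction rule: homogeneous_polys_induct) (auto simp: algebra_simps)

lemma continuous_on_homogeneous_polys:
  assumes "p \<in> homogeneous_polys l"
  shows "continuous_on S p"
  using assms by (induction rule: homogeneous_polys_induct) (auto intro!: continuous_intros)

lemma borel_measurable_homogeneous_polys:
  assumes "p \<in> homogeneous_polys l"
  shows "p \<in> borel_measurable borel"
  using continuous_on_homogeneous_polys[OF assms] by (rule borel_measurable_continuous_onI)

text \<open>Obtained by carrying membership along in the predicate; the cases can then differentiate
  the pieces.\<close>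

lemma homogeneous_polys_induct' [consumes 1, case_names const mult add]:
  fixes p :: "real ^ 'n::finite \<Rightarrow> real"
  assumes p: "p \<in> homogeneous_polys l"
    and const: "\<And>c. P 0 (\<lambda>x. c)"
    and mult: "\<And>l q i. q \<in> homogeneous_polys l \<Longrightarrow> P l q \<Longrightarrow> P (Suc l) (\<lambda>x. x $ i * q x)"
    and add: "\<And>l p q. p \<in> homogeneous_polys l \<Longrightarrow> q \<in> homogeneous_polys l \<Longrightarrow>
      P l p \<Longrightarrow> P l q \<Longrightarrow> P l (\<lambda>x. p x + q x)"
  shows "P l p"
proof -
  have "p \<in> homogeneous_polys l \<and> P l p"
    using p
  proof (induction rule: homogeneous_polys_induct)
    case (add l p q)
    then show ?case using assms(4)[of p l q] homogeneous_polys_add[of p l q] by blast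
  qed (simp_all add: const mult homogeneous_polys_coord_mult)
  then show ?thesis ..
qed

section \<open>Partial derivatives\<close>

text \<open>Uses the same one-variable \<open>deriv\<close> as \<open>laplacian\<close>, so that
  \<open>laplacian_eq\<close> only has to identify the inner derivative along the whole
  line.\<close>

definition partial_deriv :: "'n \<Rightarrow> (real ^ 'n \<Rightarrow> real) \<Rightarrow> real ^ 'n \<Rightarrow> real" where
  "partial_deriv i p x = deriv (\<lambda>s. p (x + s *\<^sub>R axis i 1)) 0"

text \<open>At \<open>l = 0\<close> the truncated \<open>l - 1\<close> is again 0, and membership
  alone would admit a nonzero constant; the extra clause rules this out. The derivative is claimed
  at every s, because second derivatives need it along the line.\<close>

lemma partial_deriv_homogeneous_polys_aux:
  assumes "p \<in> homogeneous_polys l"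
  shows "\<exists>q \<in> homogeneous_polys (l - 1). (l = 0 \<longrightarrow> q = (\<lambda>x. 0)) \<and> (\<forall>x s.
     ((\<lambda>s. p (x + s *\<^sub>R axis i 1)) has_real_derivative q (x + s *\<^sub>R axis i 1)) (at s))"
  using assms
proof (induction rule: homogeneous_polys_induct')
  case (const c)
  show ?case by (rule bexI[of _ "\<lambda>x. 0"]) auto
next
  case (mult l p j)
  then obtain q where q: "q \<in> homogeneous_polys (l - 1)" "l = 0 \<Longrightarrow> q = (\<lambda>x. 0)"
    and der: "\<And>x s. ((\<lambda>s. p (x + s *\<^sub>R axis i 1)) has_real_derivative q (x + s *\<^sub>R axis i 1)) (at s)"
    by blast
  define r where "r = (\<lambda>y. axis i 1 $ j * p y + y $ j * q y)"
  have "(\<lambda>y. y $ j * q y) \<in> homogeneous_polys l"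
    using q homogeneous_polys_coord_mult[OF q(1), of j] by (cases l) auto
  then have "r \<in> homogeneous_polys (Suc l - 1)"
    unfolding r_def using mult.hyps by (auto intro!: homogeneous_polys_add homogeneous_polys_cmult)
  moreover have "((\<lambda>s. (x + s *\<^sub>R axis i 1) $ j * p (x + s *\<^sub>R axis i 1))
      has_real_derivative r (x + s *\<^sub>R axis i 1)) (at s)" for x s
    unfolding r_def by (auto intro!: derivative_eq_intros der)
  ultimately show ?case by blast
next
  case (add l p q)
  then obtain p' q' where q: "q' \<in> homogeneous_polys (l - 1)" "p' \<in> homogeneous_polys (l - 1)"
    "l = 0 \<Longrightarrow> q' = (\<lambda>x. 0)" "l = 0 \<Longrightarrow> p' = (\<lambda>x. 0)"
    and der: "\<And>x s. ((\<lambda>s. p (x + s *\<^sub>R axis i 1)) has_real_derivative p' (x + s *\<^sub>R axis i 1)) (at s)"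
      "\<And>x s. ((\<lambda>s. q (x + s *\<^sub>R axis i 1)) has_real_derivative q' (x + s *\<^sub>R axis i 1)) (at s)"
    by blast
  show ?case
    by (rule bexI[of _ "\<lambda>x. p' x + q' x"]) (use q in \<open>auto intro: homogeneous_polys_add DERIV_add der\<close>)
qed

lemma partial_deriv_eqI:
  assumes "\<And>x. ((\<lambda>s. p (x + s *\<^sub>R axis i 1)) has_real_derivative q x) (at 0)"
  shows "partial_deriv i p = q"
  using assms by (auto simp: partial_deriv_def fun_eq_iff intro: DERIV_imp_deriv)

lemma has_partial_deriv:
  assumes "p \<in> homogeneous_polys l"
  shows "((\<lambda>s. p (x + s *\<^sub>R axis i 1)) has_real_derivative partial_deriv i p (x + s *\<^sub>R axis i 1)) (at s)"
proof -
  from partial_deriv_homogeneous_polys_aux[OF assms, of i] obtain q where "q \<in> homogeneous_polys (l - 1)"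
    and q: "\<forall>x s. ((\<lambda>s. p (x + s *\<^sub>R axis i 1)) has_real_derivative q (x + s *\<^sub>R axis i 1)) (at s)"
    by (elim bexE conjE)
  have "partial_deriv i p = q"
    by (rule partial_deriv_eqI) (use q[rule_format, of _ 0] in simp)
  with q show ?thesis by simp
qed

lemma has_partial_deriv_0:
  assumes "p \<in> homogeneous_polys l"
  shows "((\<lambda>s. p (x + s *\<^sub>R axis i 1)) has_real_derivative partial_deriv i p x) (at 0)"
  using has_partial_deriv[OF assms, of x i 0] by simp

lemma partial_deriv_homogeneous_polys:
  assumes "p \<in> homogeneous_polys l"
  shows "partial_deriv i p \<in> homogeneous_polys (l - 1)" "l = 0 \<Longrightarrow> partial_deriv i p = (\<lambda>x. 0)"
proof -
  from partial_deriv_homogeneous_polys_aux[OF assms, of i] obtain q where q: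
     "\<forall>x s. ((\<lambda>s. p (x + s *\<^sub>R axis i 1)) has_real_derivative q (x + s *\<^sub>R axis i 1)) (at s)"
     "q \<in> homogeneous_polys (l - 1)" "l = 0 \<longrightarrow> q = (\<lambda>x. 0)"
    by (elim bexE conjE)
  have "partial_deriv i p = q"
    by (rule partial_deriv_eqI) (use q(1)[rule_format, of _ 0] in simp)
  with q show "partial_deriv i p \<in> homogeneous_polys (l - 1)" "l = 0 \<Longrightarrow> partial_deriv i p = (\<lambda>x. 0)"
    by simp_all
qed

lemma partial_deriv_mult:
  assumes "p \<in> homogeneous_polys l" "q \<in> homogeneous_polys m"
  shows "partial_deriv i (\<lambda>x. p x * q x) = (\<lambda>x. partial_deriv i p x * q x + p x * partial_deriv i q x)"
  by (rule partial_deriv_eqI)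
    (auto intro!: derivative_eq_intros has_partial_deriv_0 assms)

lemma partial_deriv_add:
  assumes "p \<in> homogeneous_polys l" "q \<in> homogeneous_polys m"
  shows "partial_deriv i (\<lambda>x. p x + q x) = (\<lambda>x. partial_deriv i p x + partial_deriv i q x)"
  by (rule partial_deriv_eqI)
    (auto intro!: derivative_eq_intros has_partial_deriv_0 assms)

lemma partial_deriv_cmult:
  assumes "p \<in> homogeneous_polys l"
  shows "partial_deriv i (\<lambda>x. c * p x) = (\<lambda>x. c * partial_deriv i p x)"
  by (rule partial_deriv_eqI)
    (auto intro!: derivative_eq_intros has_partial_deriv_0 assms)

lemma partial_deriv_const [simp]: "partial_deriv i (\<lambda>x. c) = (\<lambda>x. 0)"
  by (rule partial_deriv_eqI) auto

lemma partial_deriv_coord: "partial_deriv i (\<lambda>x. x $ j) = (\<lambda>x. if i = j then 1 else 0)"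
  by (rule partial_deriv_eqI) (auto simp: axis_def intro!: derivative_eq_intros)

lemma partial_deriv_norm2: "partial_deriv i (\<lambda>x. x \<bullet> x) = (\<lambda>x. 2 * x $ i)"
  by (rule partial_deriv_eqI)
    (auto simp: inner_axis inner_axis' algebra_simps intro!: derivative_eq_intros)

lemma euler_homogeneous:
  fixes p :: "real ^ 'n::finite \<Rightarrow> real"
  assumes "p \<in> homogeneous_polys l"
  shows "(\<Sum>i\<in>UNIV. x $ i * partial_deriv i p x) = real l * p x"
  using assms
proof (induction rule: homogeneous_polys_induct')
  case (mult l q j)
  have "(\<Sum>i\<in>UNIV. x $ i * partial_deriv i (\<lambda>x. x $ j * q x) x) =
      (\<Sum>i\<in>UNIV. (if i = j then x $ i * q x else 0) + x $ j * (x $ i * partial_deriv i q x))"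
    by (subst partial_deriv_mult[OF homogeneous_polys_coord mult(1)])
      (auto simp: partial_deriv_coord algebra_simps intro!: sum.cong)
  also have "\<dots> = x $ j * q x + x $ j * (real l * q x)"
    by (simp add: sum.distrib sum_distrib_left[symmetric] mult.IH)
  finally show ?case by (simp add: algebra_simps)
next
  case (add l p q)
  then show ?case
    by (subst partial_deriv_add[OF add(1,2)]) (simp add: distrib_left sum.distrib)
qed simp

lemma laplacian_eq:
  assumes "p \<in> homogeneous_polys l"
  shows "laplacian p x = (\<Sum>i\<in>UNIV. partial_deriv i (partial_deriv i p) x)"
proof -
  have "deriv (\<lambda>s. p (x + s *\<^sub>R axis i 1)) = (\<lambda>s. partial_deriv i p (x + s *\<^sub>R axis i 1))" for i
    using has_partial_deriv[OF assms] by (auto intro!: DERIV_imp_deriv)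
  then show ?thesis unfolding laplacian_def partial_deriv_def[of _ "partial_deriv _ p"] by simp
qed

lemma laplacian_homogeneous_polys:
  assumes "p \<in> homogeneous_polys l"
  shows "laplacian p \<in> homogeneous_polys (l - 2)"
proof -
  have "laplacian p = (\<lambda>x. \<Sum>i\<in>UNIV. partial_deriv i (partial_deriv i p) x)"
    using laplacian_eq[OF assms] by auto
  moreover have "partial_deriv i (partial_deriv i p) \<in> homogeneous_polys (l - 1 - 1)" for i
    by (intro partial_deriv_homogeneous_polys assms)
  ultimately show ?thesis by (auto intro!: homogeneous_polys_sum simp: numeral_2_eq_2)
qed

lemma laplacian_low_degree:
  assumes "p \<in> homogeneous_polys l" "l < 2"
  shows "laplacian p = (\<lambda>x. 0)"
proof -
  have "partial_deriv i (partial_deriv i p) = (\<lambda>x. 0)" for i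
    using assms by (intro partial_deriv_homogeneous_polys(2)[of _ "l - 1"] partial_deriv_homogeneous_polys(1)) auto
  then show ?thesis using laplacian_eq[OF assms(1)] by auto
qed

lemma laplacian_cmult:
  assumes "p \<in> homogeneous_polys l"
  shows "laplacian (\<lambda>x. c * p x) x = c * laplacian p x"
proof -
  note [simp] = laplacian_eq[OF assms(1)]
    laplacian_eq[OF homogeneous_polys_cmult[OF assms]] partial_deriv_cmult[OF assms]
    partial_deriv_cmult[OF partial_deriv_homogeneous_polys(1)[OF assms(1)]]
  show ?thesis by (simp add: sum_distrib_left)
qed

lemma laplacian_sum:
  assumes f: "\<And>j. j \<in> A \<Longrightarrow> f j \<in> homogeneous_polys (l j)"
  shows "laplacian (\<lambda>x. \<Sum>j\<in>A. f j x) x = (\<Sum>j\<in>A. laplacian (f j) x)"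
proof -
  have 1: "deriv (\<lambda>s. \<Sum>j\<in>A. f j (x + s *\<^sub>R axis i 1)) =
      (\<lambda>s. \<Sum>j\<in>A. partial_deriv i (f j) (x + s *\<^sub>R axis i 1))" for i
    by (intro ext DERIV_imp_deriv DERIV_sum) (rule has_partial_deriv[OF f])
  have 2: "deriv (\<lambda>s. \<Sum>j\<in>A. partial_deriv i (f j) (x + s *\<^sub>R axis i 1)) 0 =
      (\<Sum>j\<in>A. partial_deriv i (partial_deriv i (f j)) x)" for i
    by (intro DERIV_imp_deriv DERIV_sum) (rule has_partial_deriv_0[OF partial_deriv_homogeneous_polys(1)[OF f]])
  have "laplacian (\<lambda>x. \<Sum>j\<in>A. f j x) x = (\<Sum>i\<in>UNIV. \<Sum>j\<in>A. partial_deriv i (partial_deriv i (f j)) x)"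
    unfolding laplacian_def 1 2 ..
  also have "\<dots> = (\<Sum>j\<in>A. laplacian (f j) x)"
    by (subst sum.swap) (simp add: laplacian_eq[OF f])
  finally show ?thesis .
qed

text \<open>Product rule: \<open>2 * CARD('n)\<close> is the Laplacian of |x|^2, and
  \<open>4 * l\<close> is twice the inner product of the gradients, evaluated by Euler's
  identity.\<close>

lemma laplacian_norm2_mult:
  fixes q :: "real ^ 'n::finite \<Rightarrow> real"
  assumes q: "q \<in> homogeneous_polys l"
  shows "laplacian (\<lambda>x. (x \<bullet> x) * q x) x =
    (2 * real CARD('n) + 4 * real l) * q x + (x \<bullet> x) * laplacian q x"
proof -
  note N = homogeneous_polys_norm2
  note dq = partial_deriv_homogeneous_polys(1)[OF q]
  have 1: "(\<lambda>x. 2 * x $ i * q x) \<in> homogeneous_polys (l + 1)" for i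
    using homogeneous_polys_cmult[OF homogeneous_polys_coord_mult[OF q], of 2 i] by (simp add: mult.assoc)
  have 2: "(\<lambda>x. (x \<bullet> x) * partial_deriv i q x) \<in> homogeneous_polys (2 + (l - 1))" for i
    by (intro homogeneous_polys_mult N dq)
  have 3: "(\<lambda>x. 2 * x $ i) \<in> homogeneous_polys 1" for i
    by (intro homogeneous_polys_cmult homogeneous_polys_coord)
  have 4: "partial_deriv i (\<lambda>x. 2 * x $ i) = (\<lambda>x. 2)" for i
    by (subst partial_deriv_cmult[OF homogeneous_polys_coord]) (simp add: partial_deriv_coord)
  have "partial_deriv i (partial_deriv i (\<lambda>x. (x \<bullet> x) * q x)) x =
      2 * q x + 4 * (x $ i * partial_deriv i q x) + (x \<bullet> x) * partial_deriv i (partial_deriv i q) x" for i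
    by (simp add: partial_deriv_mult[OF N q] partial_deriv_norm2 partial_deriv_add[OF 1 2]
        partial_deriv_mult[OF 3 q] partial_deriv_mult[OF N dq] 4)
  then have "laplacian (\<lambda>x. (x \<bullet> x) * q x) x =
     (\<Sum>i\<in>UNIV. 2 * q x + 4 * (x $ i * partial_deriv i q x) + (x \<bullet> x) * partial_deriv i (partial_deriv i q) x)"
    by (subst laplacian_eq[OF homogeneous_polys_mult[OF N q]]) simp
  also have "\<dots> = 2 * real CARD('n) * q x + 4 * (real l * q x) + (x \<bullet> x) * laplacian q x"
    by (simp add: sum.distrib sum_distrib_left[symmetric] euler_homogeneous[OF q] laplacian_eq[OF q])
  finally show ?thesis by (simp add: algebra_simps)
qed

lemma homogeneous_polys_norm2_power_mult:
  assumes "q \<in> homogeneous_polys l"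
  shows "(\<lambda>x. (x \<bullet> x) ^ j * q x) \<in> homogeneous_polys (2 * j + l)"
  using homogeneous_polys_mult[OF homogeneous_polys_power[OF homogeneous_polys_norm2] assms, of j]
  by (simp add: mult.commute)

text \<open>Iterates the case of one factor, whose degree grows by 2 each time. The coefficient is
  positive, which is what allows \<open>harmonic_part\<close> to divide by it.\<close>

lemma laplacian_norm2_power_mult:
  fixes q :: "real ^ 'n::finite \<Rightarrow> real"
  assumes q: "q \<in> homogeneous_polys l"
  shows "laplacian (\<lambda>x. (x \<bullet> x) ^ Suc j * q x) x =
    2 * real (Suc j) * (real CARD('n) + 2 * real l + 2 * real j) * (x \<bullet> x) ^ j * q x +
    (x \<bullet> x) ^ Suc j * laplacian q x"
proof (induction j)
  case 0
  show ?case using laplacian_norm2_mult[OF q] by simp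
next
  case (Suc j)
  have "laplacian (\<lambda>x. (x \<bullet> x) ^ Suc (Suc j) * q x) x = laplacian (\<lambda>x. (x \<bullet> x) * ((x \<bullet> x) ^ Suc j * q x)) x"
    by (simp add: mult.assoc)
  also have "\<dots> = (2 * real CARD('n) + 4 * real (2 * Suc j + l)) * ((x \<bullet> x) ^ Suc j * q x) +
      (x \<bullet> x) * laplacian (\<lambda>x. (x \<bullet> x) ^ Suc j * q x) x"
    by (rule laplacian_norm2_mult[OF homogeneous_polys_norm2_power_mult[OF q]])
  finally show ?case unfolding Suc.IH by (simp add: algebra_simps)
qed

section \<open>Polynomials of bounded degree\<close>

lemma homogeneous_polys_subset_polys_upto:
  assumes "p \<in> homogeneous_polys l" "l \<le> t"
  shows "p \<in> polys_upto t"
proof -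
  from assms obtain c where p: "p = (\<lambda>x. \<Sum>\<alpha> | sum \<alpha> UNIV = l. c \<alpha> * monomial \<alpha> x)"
    by (auto simp: homogeneous_polys_def)
  have "p x = (\<Sum>\<alpha> | sum \<alpha> UNIV \<le> t. (if sum \<alpha> UNIV = l then c \<alpha> else 0) * monomial \<alpha> x)" for x
    unfolding p
    by (rule sum.mono_neutral_cong_left) (use assms finite_multi_indices in auto)
  then show ?thesis unfolding polys_upto_def by (intro CollectI exI ext)
qed

lemma polys_upto_add:
  assumes "p \<in> polys_upto l" "q \<in> polys_upto l"
  shows "(\<lambda>x. p x + q x) \<in> polys_upto l"
proof -
  from assms obtain c c' where
    "p = (\<lambda>x. \<Sum>\<alpha> | sum \<alpha> UNIV \<le> l. c \<alpha> * monomial \<alpha> x)"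
    "q = (\<lambda>x. \<Sum>\<alpha> | sum \<alpha> UNIV \<le> l. c' \<alpha> * monomial \<alpha> x)"
    by (auto simp: polys_upto_def)
  then show ?thesis
    unfolding polys_upto_def
    by (auto intro!: exI[of _ "\<lambda>\<alpha>. c \<alpha> + c' \<alpha>"] simp: sum.distrib algebra_simps)
qed

lemma polys_upto_zero [simp]: "(\<lambda>x. 0) \<in> polys_upto t"
  by (rule homogeneous_polys_subset_polys_upto[of _ 0]) auto

lemma polys_upto_const [simp]: "(\<lambda>x. c) \<in> polys_upto t"
  by (rule homogeneous_polys_subset_polys_upto[of _ 0]) auto

lemma polys_upto_sum:
  assumes "\<And>i. i \<in> A \<Longrightarrow> f i \<in> polys_upto l"
  shows "(\<lambda>x. \<Sum>i\<in>A. f i x) \<in> polys_upto l"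
  using assms by (induction A rule: infinite_finite_induct) (auto intro: polys_upto_add)

lemma polys_uptoE:
  assumes "p \<in> polys_upto t"
  obtains g where "\<And>l. g l \<in> homogeneous_polys l" "p = (\<lambda>x. \<Sum>l\<le>t. g l x)"
proof -
  from assms obtain c where p: "p = (\<lambda>x. \<Sum>\<alpha> | sum \<alpha> UNIV \<le> t. c \<alpha> * monomial \<alpha> x)"
    by (auto simp: polys_upto_def)
  define g where "g = (\<lambda>l x. \<Sum>\<alpha> | sum \<alpha> UNIV = l. c \<alpha> * monomial \<alpha> x)"
  have "p x = (\<Sum>l\<le>t. g l x)" for x
  proof -
    have "p x = (\<Sum>l\<in>{..t}. \<Sum>\<alpha> | \<alpha> \<in> {\<alpha>. sum \<alpha> UNIV \<le> t} \<and> sum \<alpha> UNIV = l. c \<alpha> * monomial \<alpha> x)"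
      unfolding p by (rule sum.group[symmetric]) (auto simp: finite_multi_indices)
    also have "\<dots> = (\<Sum>l\<le>t. g l x)"
      unfolding g_def by (intro sum.cong refl) auto
    finally show ?thesis .
  qed
  moreover have "g l \<in> homogeneous_polys l" for l
    unfolding g_def homogeneous_polys_def by blast
  ultimately show thesis using that by blast
qed

lemma polys_upto_mono:
  assumes "p \<in> polys_upto s" "s \<le> t"
  shows "p \<in> polys_upto t"
proof -
  from assms(1) obtain g where g: "\<And>l. g l \<in> homogeneous_polys l" "p = (\<lambda>x. \<Sum>l\<le>s. g l x)"
    by (rule polys_uptoE) blast
  show ?thesis unfolding g(2)
    by (intro polys_upto_sum homogeneous_polys_subset_polys_upto[OF g(1)]) (use assms in auto)
qed

lemma polys_upto_mult:
  assumes "p \<in> polys_upto s" "q \<in> polys_upto t"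
  shows "(\<lambda>x. p x * q x) \<in> polys_upto (s + t)"
proof -
  from assms(1) obtain g where g: "\<And>l. g l \<in> homogeneous_polys l" "p = (\<lambda>x. \<Sum>l\<le>s. g l x)"
    by (rule polys_uptoE) blast
  from assms(2) obtain h where h: "\<And>l. h l \<in> homogeneous_polys l" "q = (\<lambda>x. \<Sum>l\<le>t. h l x)"
    by (rule polys_uptoE) blast
  show ?thesis unfolding g(2) h(2) sum_product
    by (intro polys_upto_sum homogeneous_polys_subset_polys_upto[OF homogeneous_polys_mult[OF g(1) h(1)]]) auto
qed

lemma polys_upto_cmult:
  assumes "p \<in> polys_upto s"
  shows "(\<lambda>x. c * p x) \<in> polys_upto s"
  using polys_upto_mult[OF polys_upto_const[of c 0] assms] by simp

lemma polys_upto_power: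
  assumes "p \<in> polys_upto s"
  shows "(\<lambda>x. p x ^ j) \<in> polys_upto (j * s)"
  by (induction j) (auto intro: polys_upto_mult assms)

lemma polys_upto_coord: "(\<lambda>x. x $ i) \<in> polys_upto 1"
  by (rule homogeneous_polys_subset_polys_upto[OF homogeneous_polys_coord]) simp

text \<open>For expansions about an arbitrary centre: a translation destroys homogeneity but keeps
  the degree bound.\<close>

lemma polys_upto_translation:
  assumes "p \<in> polys_upto t"
  shows "(\<lambda>x. p (a + x)) \<in> polys_upto t"
proof -
  have hom: "(\<lambda>x. q (a + x)) \<in> polys_upto l" if "q \<in> homogeneous_polys l" for q l
    using that
  proof (induction rule: homogeneous_polys_induct)
    case (mult l q i)
    have "(\<lambda>x. (a + x) $ i) \<in> polys_upto 1"
      unfolding vector_add_component by (intro polys_upto_add polys_upto_coord polys_upto_const)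
    from polys_upto_mult[OF this mult] show ?case by simp
  qed (auto intro: polys_upto_add)
  from assms obtain g where g: "\<And>l. g l \<in> homogeneous_polys l" "p = (\<lambda>x. \<Sum>l\<le>t. g l x)"
    by (rule polys_uptoE) blast
  show ?thesis unfolding g(2)
    by (intro polys_upto_sum polys_upto_mono[OF hom[OF g(1)]]) auto
qed

lemma continuous_on_polys_upto:
  assumes "p \<in> polys_upto t"
  shows "continuous_on S p"
proof -
  from assms obtain g where g: "\<And>l. g l \<in> homogeneous_polys l" "p = (\<lambda>x. \<Sum>l\<le>t. g l x)"
    by (rule polys_uptoE) blast
  show ?thesis unfolding g(2)
    by (intro continuous_on_sum continuous_on_homogeneous_polys[OF g(1)])
qed

text \<open>Connects the polynomials produced by Stone-Weierstrass with those that have harmonic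
  expansions.\<close>

lemma real_polynomial_function_imp_polys_upto:
  fixes p :: "real ^ 'n::finite \<Rightarrow> real"
  assumes "real_polynomial_function p"
  shows "\<exists>t. p \<in> polys_upto t"
  using assms
proof (induction rule: real_polynomial_function.induct)
  case (linear f)
  interpret bounded_linear f by fact
  have "f x = (\<Sum>i\<in>UNIV. f (axis i 1) * x $ i)" for x
  proof -
    have "f x = f (\<Sum>i\<in>UNIV. x $ i *\<^sub>R axis i 1)"
      by (rule arg_cong[of _ _ f]) (simp add: vec_eq_iff axis_def if_distrib cong: if_cong)
    then show ?thesis by (simp add: sum scaleR mult.commute)
  qed
  then have "f = (\<lambda>x. \<Sum>i\<in>UNIV. f (axis i 1) * x $ i)" by (rule ext)
  moreover have "(\<lambda>x. \<Sum>i\<in>UNIV. f (axis i 1) * x $ i) \<in> polys_upto 1"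
    by (intro polys_upto_sum polys_upto_cmult polys_upto_coord)
  ultimately have "f \<in> polys_upto 1" by (rule ssubst[where P = "\<lambda>p. p \<in> polys_upto 1"])
  then show ?case ..
next
  case (add f g)
  then obtain s t where "f \<in> polys_upto s" "g \<in> polys_upto t" by blast
  then show ?case
    by (intro exI[of _ "s + t"] polys_upto_add) (auto intro: polys_upto_mono)
next
  case (mult f g)
  then show ?case by (blast intro: polys_upto_mult)
qed (use polys_upto_const in blast)

section \<open>Homogeneous harmonic polynomials\<close>

definition harmonic_polys :: "nat \<Rightarrow> (real ^ 'n \<Rightarrow> real) set" where
  "harmonic_polys l = {p \<in> homogeneous_polys l. laplacian p = (\<lambda>x. 0)}"

lemma harmonic_polys_homogeneous: "p \<in> harmonic_polys l \<Longrightarrow> p \<in> homogeneous_polys l"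
  by (simp add: harmonic_polys_def)

lemma harmonic_polys_laplacian: "p \<in> harmonic_polys l \<Longrightarrow> laplacian p = (\<lambda>x. 0)"
  by (simp add: harmonic_polys_def)

lemma harmonic_polys_sum:
  assumes "\<And>j. j \<in> A \<Longrightarrow> f j \<in> harmonic_polys l"
  shows "(\<lambda>x. \<Sum>j\<in>A. f j x) \<in> harmonic_polys l"
proof -
  have f: "f j \<in> homogeneous_polys l" if "j \<in> A" for j
    using assms[OF that] by (rule harmonic_polys_homogeneous)
  have "laplacian (\<lambda>x. \<Sum>j\<in>A. f j x) x = 0" for x
    by (subst laplacian_sum[OF f]) (simp_all add: harmonic_polys_laplacian[OF assms])
  then show ?thesis
    unfolding harmonic_polys_def using f by (auto intro!: homogeneous_polys_sum)
qed

lemma harmonic_polys_cmult: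
  assumes "f \<in> harmonic_polys l"
  shows "(\<lambda>x. c * f x) \<in> harmonic_polys l"
  using assms laplacian_cmult[of f l c] by (auto simp: harmonic_polys_def intro: homogeneous_polys_cmult)

lemma harmonic_polys_zero [simp]: "(\<lambda>x. 0) \<in> harmonic_polys l"
  using harmonic_polys_sum[of "{}"] by simp

text \<open>
  The Laplacian turns the homogeneous parts of a polynomial into homogeneous polynomials of distinct
  degrees, so these vanish separately.
\<close>

lemma homogeneous_parts_harmonic:
  fixes g :: "nat \<Rightarrow> real ^ 'n::finite \<Rightarrow> real"
  assumes g: "\<And>l. g l \<in> homogeneous_polys l"
    and lap: "\<And>x. laplacian (\<lambda>x. \<Sum>l\<le>L. g l x) x = 0" and l: "l \<le> L"
  shows "g l \<in> harmonic_polys l"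
proof -
  have "laplacian (g l) y = 0" for y
  proof -
    have "(\<Sum>l\<le>L. laplacian (g l) y * s ^ l) = 0" for s
    proof -
      \<comment> \<open>The factor s^2 lifts the degree \<open>l - 2\<close> back to l, so that the
        identity on the line through y becomes a vanishing polynomial in s. In degrees below 2 both
        sides are zero, which covers the truncated subtraction.\<close>
      have "laplacian (g l) y * s ^ l = s\<^sup>2 * laplacian (g l) (s *\<^sub>R y)" for l
      proof (cases "l < 2")
        case True
        then show ?thesis using laplacian_low_degree[OF g] by simp
      next
        case False
        then have "s ^ l = s\<^sup>2 * s ^ (l - 2)"
          by (metis le_add_diff_inverse not_less power_add)
        then show ?thesis
          using homogeneous_polys_scale[OF laplacian_homogeneous_polys[OF g], of l s y] by simp
      qed
      then have "(\<Sum>l\<le>L. laplacian (g l) y * s ^ l) = s\<^sup>2 * (\<Sum>l\<le>L. laplacian (g l) (s *\<^sub>R y))"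
        by (simp add: sum_distrib_left)
      also have "(\<Sum>l\<le>L. laplacian (g l) (s *\<^sub>R y)) = 0"
        using laplacian_sum[of "{..L}" g "\<lambda>l. l" "s *\<^sub>R y"] g lap by simp
      finally show ?thesis by simp
    qed
    then have "\<forall>i\<le>L. laplacian (g i) y = 0"
      by (subst polyfun_eq_0[symmetric]) blast
    with l show ?thesis by blast
  qed
  then show ?thesis using g by (auto simp: harmonic_polys_def)
qed

lemma laplacian_translation: "laplacian (\<lambda>x. p (a + x)) x = laplacian p (a + x)"
  by (simp add: laplacian_def add.assoc)

section \<open>Harmonic decomposition\<close>

lemma iterated_laplacian_homogeneous_polys:
  "p \<in> homogeneous_polys l \<Longrightarrow> (laplacian ^^ j) p \<in> homogeneous_polys (l - 2 * j)"
  by (induction j) (auto dest: laplacian_homogeneous_polys simp: diff_diff_eq add.commute)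

text \<open>
  The harmonic part of \<open>p\<close> is \<open>\<Sum>\<^sub>j c\<^sub>j |x|\<^sup>2\<^sup>j \<Delta>\<^sup>j p\<close>, with the coefficients determined by making the
  Laplacian of this sum telescope.
\<close>

lemma harmonic_part:
  fixes p :: "real ^ 'n::finite \<Rightarrow> real"
  assumes p: "p \<in> homogeneous_polys l"
  obtains h r where "h \<in> harmonic_polys l" "l \<ge> 2 \<Longrightarrow> r \<in> homogeneous_polys (l - 2)"
    "l < 2 \<Longrightarrow> r = (\<lambda>x. 0)" "\<And>x. p x = h x + (x \<bullet> x) * r x"
proof -
  define J where "J = l div 2"
  \<comment> \<open>The coefficient of \<open>laplacian_norm2_power_mult\<close> for
    \<open>D (Suc j)\<close>, which has degree \<open>l - 2 * Suc j\<close>. Telescoping requires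
    \<open>c (Suc j) * \<kappa> j = - c j\<close>, hence the product defining c.\<close>
  define \<kappa> where "\<kappa> = (\<lambda>j. 2 * real (Suc j) * (real CARD('n) + 2 * real (l - 2 * Suc j) + 2 * real j))"
  define c where "c = (\<lambda>j. \<Prod>i<j. - 1 / \<kappa> i)"
  define D where "D = (\<lambda>j. (laplacian ^^ j) p)"
  define h where "h = (\<lambda>x. \<Sum>j\<le>J. c j * ((x \<bullet> x) ^ j * D j x))"
  \<comment> \<open>Minus the terms of h with positive index, with one factor |x|^2 taken out; as
    \<open>c 0 = 1\<close>, the remaining term is p itself.\<close>
  define r where "r = (\<lambda>x. \<Sum>j<J. - c (Suc j) * ((x \<bullet> x) ^ j * D (Suc j) x))"
  have \<kappa>: "\<kappa> j > 0" for j
    unfolding \<kappa>_def by (intro mult_pos_pos add_pos_nonneg) auto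
  have D: "D j \<in> homogeneous_polys (l - 2 * j)" for j
    unfolding D_def by (rule iterated_laplacian_homogeneous_polys[OF p])
  have D_Suc: "laplacian (D j) = D (Suc j)" for j by (simp add: D_def)
  \<comment> \<open>\<open>D J\<close> has degree at most 1, so the telescoping sum leaves nothing
    at its end.\<close>
  have DJ: "D (Suc J) = (\<lambda>x. 0)"
    using laplacian_low_degree[OF D[of J]] by (simp add: D_Suc J_def)
  have t: "(\<lambda>x. (x \<bullet> x) ^ j * D j x) \<in> homogeneous_polys l" if "j \<le> J" for j
    using homogeneous_polys_norm2_power_mult[OF D, of j j] that by (simp add: J_def)
  have hl: "h \<in> homogeneous_polys l"
    unfolding h_def by (intro homogeneous_polys_sum homogeneous_polys_cmult t) auto
  have lap_t: "laplacian (\<lambda>x. (x \<bullet> x) ^ Suc j * D (Suc j) x) x =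
      \<kappa> j * ((x \<bullet> x) ^ j * D (Suc j) x) + (x \<bullet> x) ^ Suc j * D (Suc (Suc j)) x" for j x
    unfolding laplacian_norm2_power_mult[OF D] D_Suc \<kappa>_def by (simp only: mult.assoc)
  have "laplacian h x = 0" for x
  proof -
    define e where "e = (\<lambda>j. (x \<bullet> x) ^ j * D (Suc j) x)"
    have "laplacian h x = (\<Sum>j\<le>J. laplacian (\<lambda>x. c j * ((x \<bullet> x) ^ j * D j x)) x)"
      unfolding h_def by (rule laplacian_sum[where l = "\<lambda>_. l"]) (auto intro: homogeneous_polys_cmult t)
    also have "\<dots> = (\<Sum>j\<le>J. c j * laplacian (\<lambda>x. (x \<bullet> x) ^ j * D j x) x)"
      by (intro sum.cong refl laplacian_cmult[OF t]) auto
    also have "\<dots> = c 0 * e 0 + (\<Sum>j<J. c (Suc j) * (\<kappa> j * e j + e (Suc j)))"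
      by (simp add: sum.atMost_shift lap_t e_def D_Suc del: power_Suc)
    also have "\<dots> = c 0 * e 0 + (\<Sum>j<J. c (Suc j) * e (Suc j)) - (\<Sum>j<J. c j * e j)"
    proof -
      have "c (Suc j) * \<kappa> j = - c j" for j using \<kappa>[of j] by (simp add: c_def)
      then have "c (Suc j) * (\<kappa> j * e j + e (Suc j)) = c (Suc j) * e (Suc j) - c j * e j" for j
        by (simp add: distrib_left mult.assoc[symmetric])
      then show ?thesis by (simp add: sum_subtractf)
    qed
    also have "c 0 * e 0 + (\<Sum>j<J. c (Suc j) * e (Suc j)) = (\<Sum>j<Suc J. c j * e j)"
      by (subst sum.lessThan_Suc_shift) simp
    also have "\<dots> - (\<Sum>j<J. c j * e j) = c J * e J" by simp
    also have "\<dots> = 0" using DJ by (simp add: e_def)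
    finally show ?thesis .
  qed
  then have 1: "h \<in> harmonic_polys l" using hl by (auto simp: harmonic_polys_def)
  have "r \<in> homogeneous_polys (l - 2)" if "l \<ge> 2"
  proof -
    have "(\<lambda>x. (x \<bullet> x) ^ j * D (Suc j) x) \<in> homogeneous_polys (l - 2)" if "j < J" for j
    proof -
      have "2 * j + (l - 2 * Suc j) = l - 2" using that by (auto simp: J_def)
      then show ?thesis using homogeneous_polys_norm2_power_mult[OF D, of j "Suc j"] by simp
    qed
    then show ?thesis unfolding r_def by (intro homogeneous_polys_sum homogeneous_polys_cmult) auto
  qed
  moreover have "r = (\<lambda>x. 0)" if "l < 2" using that by (simp add: r_def J_def)
  moreover have "p x = h x + (x \<bullet> x) * r x" for x
    unfolding h_def r_def sum.atMost_shift
    by (simp add: c_def D_def sum_distrib_left mult_ac sum_negf[symmetric] sum.distrib[symmetric])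
  ultimately show thesis using that 1 by blast
qed

text \<open>On the sphere the factor |x|^2 of \<open>harmonic_part\<close> is 1, so the remainder
  may be replaced by a polynomial of degree lower by two, and induction on the degree
  applies.\<close>

lemma polys_upto_harmonic_decomposition:
  fixes p :: "real ^ 'n::finite \<Rightarrow> real"
  assumes "p \<in> polys_upto L"
  obtains g where "\<And>l. g l \<in> harmonic_polys l" "\<And>x. x \<in> sphere 0 1 \<Longrightarrow> p x = (\<Sum>l\<le>L. g l x)"
proof -
  let ?P = "\<lambda>L p. \<exists>g. (\<forall>l. g l \<in> harmonic_polys l) \<and> (\<forall>x \<in> sphere 0 1. p x = (\<Sum>l\<le>L. g l (x :: real ^ 'n)))"
  have hom: "?P L p" if "p \<in> homogeneous_polys l" "l \<le> L" for p l
    using that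
  proof (induction l arbitrary: p rule: less_induct)
    case (less l p)
    from less.prems(1) obtain h r where hr: "h \<in> harmonic_polys l" "l \<ge> 2 \<Longrightarrow> r \<in> homogeneous_polys (l - 2)"
      "l < 2 \<Longrightarrow> r = (\<lambda>x. 0)" "\<And>x. p x = h x + (x \<bullet> x) * r x"
      by (rule harmonic_part) blast
    have "?P L r"
    proof (cases "l < 2")
      case True
      with hr show ?thesis by (intro exI[of _ "\<lambda>l x. 0"]) auto
    next
      case False
      with hr less show ?thesis by (intro less.IH[of "l - 2"]) auto
    qed
    then obtain g where g: "\<And>l. g l \<in> harmonic_polys l" "\<And>x. x \<in> sphere 0 1 \<Longrightarrow> r x = (\<Sum>l\<le>L. g l x)"
      by blast
    define g' where "g' = (\<lambda>m x. g m x + (if m = l then h x else 0))"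
    have "g' m \<in> harmonic_polys m" for m
      using harmonic_polys_sum[of "{0, 1 :: nat}" "\<lambda>j. if j = 0 then g m else if m = l then h else (\<lambda>x. 0)" m] g(1) hr(1)
      by (auto simp: g'_def if_distribR)
    moreover have "p x = (\<Sum>m\<le>L. g' m x)" if "x \<in> sphere 0 1" for x
      using that less.prems g(2)[OF that] hr(4)[of x] by (simp add: g'_def sum.distrib dot_square_norm)
    ultimately show ?case by blast
  qed
  from assms obtain f where f: "\<And>l. f l \<in> homogeneous_polys l" "p = (\<lambda>x. \<Sum>l\<le>L. f l x)"
    by (rule polys_uptoE) blast
  have "\<forall>l. \<exists>g. l \<le> L \<longrightarrow> (\<forall>l. g l \<in> harmonic_polys l) \<and> (\<forall>x \<in> sphere 0 1. f l x = (\<Sum>m\<le>L. g m x))"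
    using hom[OF f(1)] by blast
  then obtain G where G: "\<And>l m. l \<le> L \<Longrightarrow> G l m \<in> harmonic_polys m"
    "\<And>l x. l \<le> L \<Longrightarrow> x \<in> sphere 0 1 \<Longrightarrow> f l x = (\<Sum>m\<le>L. G l m x)" by metis
  show thesis
  proof (rule that[of "\<lambda>m x. \<Sum>l\<le>L. G l m x"])
    show "(\<lambda>x. \<Sum>l\<le>L. G l m x) \<in> harmonic_polys m" for m
      by (intro harmonic_polys_sum G) auto
    show "p x = (\<Sum>m\<le>L. \<Sum>l\<le>L. G l m x)" if "x \<in> sphere 0 1" for x
      unfolding f(2) by (subst sum.swap) (intro sum.cong refl G(2)[OF _ that], simp)
  qed
qed

section \<open>Polar coordinates\<close>

text \<open>The measure inside \<open>sphere_measure\<close> before its restriction. Being defined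
  on all of \<open>borel\<close> it combines directly with image and product measures, and it is
  concentrated on the sphere.\<close>

definition radial_distr :: "(real ^ 'n) measure" where
  "radial_distr = distr (uniform_measure lborel (ball 0 1)) borel sgn"

lemma sgn_borel_measurable [measurable]: "sgn \<in> borel_measurable (borel :: (real ^ 'n::finite) measure)"
  by (simp add: sgn_div_norm[abs_def])

lemma space_sphere_measure [simp]: "space sphere_measure = sphere 0 1"
  by (simp add: sphere_measure_def space_restrict_space)

lemma sets_sphere_measure: "sets sphere_measure = sets (restrict_space borel (sphere 0 1))"
  by (simp add: sphere_measure_def sets_restrict_space)

lemma emeasure_lborel_unit_ball:
  "emeasure lborel (ball 0 1 :: (real ^ 'n::finite) set) \<noteq> 0"
  "emeasure lborel (ball 0 1 :: (real ^ 'n::finite) set) \<noteq> \<infinity>"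
proof -
  have "measure lborel (ball (0 :: real ^ 'n) 1) > 0"
    by (simp add: content_ball_pos)
  then show "emeasure lborel (ball (0 :: real ^ 'n) 1) \<noteq> 0"
    by (auto simp: measure_def)
  show "emeasure lborel (ball (0 :: real ^ 'n) 1) \<noteq> \<infinity>"
    using emeasure_lborel_ball_finite[of "0 :: real ^ 'n" 1] by simp
qed

lemma prob_space_radial_distr: "prob_space (radial_distr :: (real ^ 'n::finite) measure)"
  unfolding radial_distr_def
  by (intro prob_space.prob_space_distr prob_space_uniform_measure emeasure_lborel_unit_ball) simp

lemma sets_radial_distr [simp, measurable_cong]: "sets radial_distr = sets borel"
  by (simp add: radial_distr_def)

lemma space_radial_distr [simp]: "space radial_distr = UNIV"
  by (simp add: radial_distr_def)

lemma AE_radial_distr_sphere: "AE x in radial_distr. x \<in> sphere (0 :: real ^ 'n::finite) 1"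
proof -
  have "AE x in lborel. x \<noteq> (0 :: real ^ 'n)"
    by (rule AE_lborel_singleton)
  then have "AE x in uniform_measure lborel (ball 0 1). sgn x \<in> sphere (0 :: real ^ 'n) 1"
    by (intro AE_uniform_measureI) (auto simp: norm_sgn elim!: eventually_mono)
  then show ?thesis
    unfolding radial_distr_def
    by (subst AE_distr_iff) (auto simp del: mem_sphere_0 mem_sphere)
qed

lemma sphere_integral_eq_radial:
  fixes f :: "real ^ 'n::finite \<Rightarrow> real"
  assumes [measurable]: "f \<in> borel_measurable borel"
  shows "sphere_integral f = (LINT x|radial_distr. f x)"
proof -
  have "sphere_integral f = (LINT x|radial_distr. indicator (sphere 0 1) x *\<^sub>R f x)"
    unfolding sphere_integral_def sphere_measure_def radial_distr_def[symmetric]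
    by (rule integral_restrict_space) simp
  also have "\<dots> = (LINT x|radial_distr. f x)"
  proof (rule integral_cong_AE)
    have [measurable]: "sphere (0 :: real ^ 'n) 1 \<in> sets borel" by (intro borel_closed closed_sphere)
    show "(\<lambda>x. indicator (sphere 0 1) x *\<^sub>R f x) \<in> borel_measurable radial_distr"
      "f \<in> borel_measurable radial_distr" by measurable
  qed (use AE_radial_distr_sphere in \<open>auto elim!: eventually_mono\<close>)
  finally show ?thesis .
qed

definition cone_of :: "(real ^ 'n) set \<Rightarrow> real \<Rightarrow> (real ^ 'n) set" where
  "cone_of A r = {x. norm x < r \<and> sgn x \<in> A}"

lemma cone_of_measurable [measurable]: "A \<in> sets borel \<Longrightarrow> cone_of A r \<in> sets borel"
proof -
  assume A: "A \<in> sets borel"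
  have "cone_of A r = ball 0 r \<inter> sgn -` A" by (auto simp: cone_of_def)
  then show ?thesis using measurable_sets[OF sgn_borel_measurable A] by simp
qed

lemma emeasure_cone_of:
  fixes A :: "(real ^ 'n::finite) set"
  assumes [measurable]: "A \<in> sets borel" and r: "r > 0"
  shows "emeasure lborel (cone_of A r) = ennreal (r ^ CARD('n)) * emeasure lborel (cone_of A 1)"
proof -
  have vimage: "(\<lambda>x. 0 + r *\<^sub>R x) -` cone_of A r = cone_of A 1"
    using r by (auto simp: cone_of_def sgn_scaleR)
  have "emeasure lborel (cone_of A r) =
      emeasure (density (distr lborel borel (\<lambda>x. 0 + r *\<^sub>R x)) (\<lambda>_. \<bar>r\<bar> ^ DIM(real ^ 'n))) (cone_of A r)"
    using lborel_affine[of r "0 :: real ^ 'n"] r by simp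
  also have "\<dots> = ennreal (r ^ CARD('n)) * emeasure (distr lborel borel (\<lambda>x. 0 + r *\<^sub>R x)) (cone_of A r)"
    using r by (subst emeasure_density_const) auto
  also have "emeasure (distr lborel borel (\<lambda>x. 0 + r *\<^sub>R x)) (cone_of A r) = emeasure lborel (cone_of A 1)"
    by (subst emeasure_distr) (simp_all add: vimage[simplified])
  finally show ?thesis .
qed

lemma cone_of_UNIV: "cone_of UNIV r = ball 0 r"
  by (auto simp: cone_of_def)

lemma emeasure_radial_distr:
  fixes A :: "(real ^ 'n::finite) set"
  assumes [measurable]: "A \<in> sets borel"
  shows "emeasure radial_distr A * emeasure lborel (ball (0 :: real ^ 'n) 1) = emeasure lborel (cone_of A 1)"
proof -
  have "emeasure radial_distr A = emeasure lborel (ball 0 1 \<inter> sgn -` A) / emeasure lborel (ball (0 :: real ^ 'n) 1)"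
    unfolding radial_distr_def
    by (subst emeasure_distr) (use measurable_sets[OF sgn_borel_measurable assms] in \<open>auto intro!: emeasure_uniform_measure\<close>)
  also have "ball 0 1 \<inter> sgn -` A = cone_of A 1" by (auto simp: cone_of_def)
  finally show ?thesis
    using emeasure_lborel_unit_ball[where 'n = 'n]
    by (simp add: ennreal_divide_times less_top)
qed

text \<open>For fixed A both sides are measures in B. On the sets \<open>{..<r}\<close> they agree
  by the scaling of cones, and these sets form an intersection-stable generator of the Borel
  sets.\<close>

lemma polar_emeasure:
  fixes A :: "(real ^ 'n::finite) set"
  assumes A [measurable]: "A \<in> sets borel" and [measurable]: "B \<in> sets borel"
  shows "emeasure lborel {x :: real ^ 'n. norm x \<in> B \<and> sgn x \<in> A} =
    emeasure lborel {x :: real ^ 'n. norm x \<in> B} * emeasure radial_distr A"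
proof -
  define N where "N = distr (density lborel (indicator (sgn -` A :: (real ^ 'n) set))) borel norm"
  define M where "M = scale_measure (emeasure radial_distr A) (distr (lborel :: (real ^ 'n) measure) borel norm)"
  have sA [measurable]: "sgn -` A \<in> sets (borel :: (real ^ 'n) measure)"
    using measurable_sets[OF sgn_borel_measurable A] by simp
  have N: "emeasure N X = emeasure lborel {x :: real ^ 'n. norm x \<in> X \<and> sgn x \<in> A}" if [measurable]: "X \<in> sets borel" for X
  proof -
    have "norm -` X \<in> sets (borel :: (real ^ 'n) measure)"
      using measurable_sets[of norm borel borel X] by simp
    then have "emeasure N X = (\<integral>\<^sup>+x. indicator (sgn -` A) x * indicator (norm -` X) x \<partial>(lborel :: (real ^ 'n) measure))"
      unfolding N_def by (simp add: emeasure_distr emeasure_density)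
    also have "\<dots> = (\<integral>\<^sup>+x. indicator (sgn -` A \<inter> norm -` X) x \<partial>(lborel :: (real ^ 'n) measure))"
      by (simp add: indicator_inter_arith)
    also have "\<dots> = emeasure lborel (sgn -` A \<inter> (norm -` X) :: (real ^ 'n) set)"
      using \<open>norm -` X \<in> _\<close> by (intro nn_integral_indicator) simp
    also have "sgn -` A \<inter> norm -` X = {x :: real ^ 'n. norm x \<in> X \<and> sgn x \<in> A}" by auto
    finally show ?thesis .
  qed
  have M: "emeasure M X = emeasure radial_distr A * emeasure lborel {x :: real ^ 'n. norm x \<in> X}"
    if [measurable]: "X \<in> sets borel" for X
    unfolding M_def by (simp add: emeasure_distr vimage_def)
  have "M = N"
  proof (rule measure_eqI_generator_eq[of "range lessThan" UNIV _ _ "\<lambda>i. {..<real i}"])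
    show "Int_stable (range lessThan :: real set set)"
    proof (rule Int_stableI_image)
      show "\<exists>c \<in> UNIV. {..<a} \<inter> {..<b} = {..<c}" for a b :: real
        by (rule bexI[of _ "min a b"]) auto
    qed
    show "sets M = sigma_sets UNIV (range lessThan)" "sets N = sigma_sets UNIV (range lessThan)"
      by (auto simp: M_def N_def borel_Iio)
    show "(\<Union>i. {..<real i}) = UNIV" by (auto intro: reals_Archimedean2)
    have ball: "{x :: real ^ 'n. norm x < r} = ball 0 r" for r by auto
    show "emeasure M {..<real i} \<noteq> \<infinity>" for i
      using prob_space.emeasure_le_1[OF prob_space_radial_distr, of A] emeasure_lborel_ball_finite[of "0 :: real ^ 'n" "real i"]
      by (subst M) (auto simp: ball ennreal_mult_eq_top_iff less_top intro: order_le_less_trans)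
    fix X :: "real set" assume "X \<in> range lessThan"
    then obtain r where X: "X = {..<r}" by auto
    show "emeasure M X = emeasure N X"
    proof (cases "r > 0")
      case True
      have "emeasure M X = emeasure radial_distr A * emeasure lborel (cone_of UNIV r :: (real ^ 'n) set)"
        by (simp add: M X ball cone_of_UNIV)
      also have "\<dots> = ennreal (r ^ CARD('n)) * (emeasure radial_distr A * emeasure lborel (ball (0 :: real ^ 'n) 1))"
        using emeasure_cone_of[of "UNIV :: (real ^ 'n) set" r] True by (simp add: cone_of_UNIV mult_ac)
      also have "\<dots> = emeasure lborel (cone_of A r)"
        unfolding emeasure_radial_distr[OF A] emeasure_cone_of[OF A True] ..
      also have "\<dots> = emeasure N X" by (simp add: N X cone_of_def)
      finally show ?thesis .
    next
      case False
      then have "{x :: real ^ 'n. norm x < r} = {}" "{x :: real ^ 'n. norm x < r \<and> sgn x \<in> A} = {}"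
        by (auto dest: order_le_less_trans[OF norm_ge_zero])
      then show ?thesis by (simp add: M N X)
    qed
  qed auto
  then have "emeasure M B = emeasure N B" by simp
  then show ?thesis by (simp add: M N mult.commute)
qed

lemma sigma_finite_distr_norm:
  fixes M :: "(real ^ 'n::finite) measure"
  assumes M: "M = lborel"
  shows "sigma_finite_measure (distr M borel norm)"
proof (rule sigma_finite_measure.intro)
  let ?A = "range (\<lambda>i :: nat. {..<real i})"
  have "{x :: real ^ 'n. norm x < r} = ball 0 r" for r by auto
  then have 1: "emeasure (distr M borel norm) B \<noteq> \<infinity>" if "B \<in> ?A" for B
    using emeasure_lborel_ball_finite[of "0 :: real ^ 'n"] that
    by (auto simp: emeasure_distr vimage_def less_top M)
  show "\<exists>A. countable A \<and> A \<subseteq> sets (distr M borel norm) \<and>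
      \<Union> A = space (distr M borel norm) \<and>
      (\<forall>a\<in>A. emeasure (distr M borel norm) a \<noteq> \<infinity>)"
    using 1 by (intro exI[of _ ?A]) (auto intro: reals_Archimedean2)
qed

text \<open>Two sigma-finite factors determine their product by its values on rectangles, and those
  are given by \<open>polar_emeasure\<close>.\<close>

lemma polar_distr:
  fixes M :: "(real ^ 'n::finite) measure"
  assumes M: "M = lborel"
  shows "distr M (borel \<Otimes>\<^sub>M borel) (\<lambda>x. (norm x, sgn x)) = distr M borel norm \<Otimes>\<^sub>M radial_distr"
proof (rule pair_measure_eqI[symmetric])
  show "sigma_finite_measure (distr M borel norm)"
    by (rule sigma_finite_distr_norm[OF M])
  show "sigma_finite_measure (radial_distr :: (real ^ 'n) measure)"
    by (intro prob_space_imp_sigma_finite prob_space_radial_distr)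
  show "sets (distr M borel norm \<Otimes>\<^sub>M (radial_distr :: (real ^ 'n) measure)) =
      sets (distr M (borel \<Otimes>\<^sub>M borel) (\<lambda>x. (norm x, sgn x)))"
    by (simp cong: sets_pair_measure_cong)
  fix B :: "real set" and A :: "(real ^ 'n) set"
  assume "B \<in> sets (distr M borel norm)" "A \<in> sets radial_distr"
  then have [measurable]: "B \<in> sets borel" "A \<in> sets borel" by auto
  show "emeasure (distr M borel norm) B * emeasure radial_distr A =
      emeasure (distr M (borel \<Otimes>\<^sub>M borel) (\<lambda>x. (norm x, sgn x))) (B \<times> A)"
    by (simp add: emeasure_distr vimage_def polar_emeasure M)
qed

lemma polar_integral:
  fixes h :: "real \<Rightarrow> real" and g :: "real ^ 'n::finite \<Rightarrow> real"
  assumes [measurable]: "h \<in> borel_measurable borel"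
    and h: "integrable (lborel :: (real ^ 'n) measure) (\<lambda>x. h (norm x))"
    and g: "integrable radial_distr g"
  shows "integrable lborel (\<lambda>x. h (norm x) * g (sgn x))"
    and "(LINT x|lborel. h (norm x) * g (sgn x)) =
      (LINT x|(lborel :: (real ^ 'n) measure). h (norm x)) * (LINT x|radial_distr. g x)"
proof -
  let ?\<nu> = "distr (lborel :: (real ^ 'n) measure) borel norm"
  interpret pair_sigma_finite ?\<nu> "radial_distr :: (real ^ 'n) measure"
    by (intro pair_sigma_finite.intro sigma_finite_distr_norm[OF refl] prob_space_imp_sigma_finite prob_space_radial_distr)
  have [measurable]: "g \<in> borel_measurable borel"
    using g by (simp add: measurable_cong_sets[OF sets_radial_distr refl] borel_measurable_integrable)
  have h': "integrable ?\<nu> h" using h by (simp add: integrable_distr_eq)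
  have int: "integrable (?\<nu> \<Otimes>\<^sub>M radial_distr) (\<lambda>z. h (fst z) * g (snd z))"
  proof (rule Fubini_integrable)
    show "integrable ?\<nu> (\<lambda>x. LINT y|radial_distr. norm (h (fst (x, y)) * g (snd (x, y))))"
      using integrable_norm[OF h'] by (simp add: abs_mult)
    show "AE x in ?\<nu>. integrable radial_distr (\<lambda>y. h (fst (x, y)) * g (snd (x, y)))"
      using g by (intro always_eventually) simp
  qed measurable
  then show "integrable lborel (\<lambda>x. h (norm x) * g (sgn x))"
    unfolding polar_distr[OF refl, symmetric] by (subst (asm) integrable_distr_eq) auto
  have "(LINT x|lborel. h (norm x) * g (sgn x)) = (LINT z|(?\<nu> \<Otimes>\<^sub>M radial_distr). h (fst z) * g (snd z))"
    unfolding polar_distr[OF refl, symmetric] by (subst integral_distr) auto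
  also have "\<dots> = (LINT x|?\<nu>. (LINT y|radial_distr. h x * g y))"
    using integral_fst'[OF int] by simp
  also have "\<dots> = (LINT x|?\<nu>. h x) * (LINT y|radial_distr. g y)" by simp
  also have "(LINT x|?\<nu>. h x) = (LINT x|(lborel :: (real ^ 'n) measure). h (norm x))"
    by (subst integral_distr) auto
  finally show "(LINT x|lborel. h (norm x) * g (sgn x)) =
      (LINT x|(lborel :: (real ^ 'n) measure). h (norm x)) * (LINT x|radial_distr. g x)" .
qed

lemma integrable_radial_distr_continuous:
  fixes f :: "real ^ 'n::finite \<Rightarrow> real"
  assumes [measurable]: "f \<in> borel_measurable borel" and cont: "continuous_on (sphere 0 1) f"
  shows "integrable radial_distr f"
proof -
  interpret prob_space "radial_distr :: (real ^ 'n) measure" by (rule prob_space_radial_distr)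
  have "bounded (f ` sphere 0 1)"
    by (intro compact_imp_bounded compact_continuous_image cont compact_sphere)
  then obtain B where B: "\<forall>x\<in>sphere 0 1. norm (f x) \<le> B"
    by (auto simp: bounded_iff simp del: mem_sphere mem_sphere_0)
  show ?thesis
    by (rule integrable_const_bound[of f B]) (use AE_radial_distr_sphere B in \<open>auto elim!: eventually_mono\<close>)
qed

text \<open>Homogeneity gives f x = |x|^l f (sgn x), so a radial weight h separates from the
  spherical integral. It is applied with Gaussian weights and with indicators of sets of
  radii.\<close>

lemma polar_integral_homogeneous:
  fixes f :: "real ^ 'n::finite \<Rightarrow> real"
  assumes [measurable]: "h \<in> borel_measurable borel"
    and h: "integrable (lborel :: (real ^ 'n) measure) (\<lambda>x. h (norm x) * norm x ^ l)"
    and f: "f \<in> homogeneous_polys l"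
  shows "integrable lborel (\<lambda>x. h (norm x) * f x)"
    and "(LINT x|lborel. h (norm x) * f x) =
      (LINT x|(lborel :: (real ^ 'n) measure). h (norm x) * norm x ^ l) * sphere_integral f"
proof -
  have fx: "f x = norm x ^ l * f (sgn x)" for x
  proof -
    have "x = norm x *\<^sub>R sgn x" by (cases "x = 0") (simp_all add: sgn_div_norm)
    then have "f x = f (norm x *\<^sub>R sgn x)" by simp
    then show ?thesis by (simp add: homogeneous_polys_scale[OF f])
  qed
  have eq: "h (norm x) * f x = (h (norm x) * norm x ^ l) * f (sgn x)" for x
    using fx[of x] by (simp only: mult.assoc)
  have m: "(\<lambda>r. h r * r ^ l) \<in> borel_measurable borel" by measurable
  have i: "integrable radial_distr f"
    by (intro integrable_radial_distr_continuous borel_measurable_homogeneous_polys[OF f] continuous_on_homogeneous_polys[OF f])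
  show "integrable lborel (\<lambda>x. h (norm x) * f x)"
    unfolding eq by (rule polar_integral(1)[OF m h i])
  show "(LINT x|lborel. h (norm x) * f x) =
      (LINT x|(lborel :: (real ^ 'n) measure). h (norm x) * norm x ^ l) * sphere_integral f"
    unfolding eq sphere_integral_eq_radial[OF borel_measurable_homogeneous_polys[OF f]]
    by (rule polar_integral(2)[OF m h i])
qed

section \<open>Orthogonality of harmonic polynomials via Gaussian integrals\<close>

definition gauss_moment :: "nat \<Rightarrow> real" where
  "gauss_moment k = (LINT t|lborel. exp (- t\<^sup>2 / 2) * t ^ k)"

lemma gauss_moment_integrable: "integrable lborel (\<lambda>t :: real. exp (- t\<^sup>2 / 2) * t ^ k)"
proof -
  have eq: "exp (- t\<^sup>2 / 2) * t ^ k = sqrt (2 * pi) * (std_normal_density t * t ^ k)" for t :: real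
    by (simp add: std_normal_density_def)
  show ?thesis unfolding eq by (intro integrable_mult_right integrable_std_normal_moment)
qed

lemma gauss_moment_eq: "gauss_moment k = sqrt (2 * pi) * (LINT t|lborel. std_normal_density t * t ^ k)"
proof -
  have eq: "exp (- t\<^sup>2 / 2) * t ^ k = sqrt (2 * pi) * (std_normal_density t * t ^ k)" for t :: real
    by (simp add: std_normal_density_def)
  show ?thesis unfolding gauss_moment_def eq by simp
qed

text \<open>Integration by parts for t^k against the Gaussian, read off from the closed formulas for
  the moments. At \<open>k = 0\<close> the factor \<open>real k\<close> makes the truncated
  \<open>k - 1\<close> harmless.\<close>

lemma gauss_moment_Suc: "gauss_moment (Suc k) = real k * gauss_moment (k - 1)"
proof (cases "even k")
  case True
  then obtain j where k: "k = 2 * j" by (auto elim: evenE)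
  have odd: "gauss_moment (2 * j + 1) = 0" for j
    using has_bochner_integral_integral_eq[OF std_normal_moment_odd[of j]]
    unfolding gauss_moment_eq by simp
  show ?thesis
  proof (cases j)
    case 0
    then show ?thesis using k odd[of 0] by simp
  next
    case (Suc i)
    then have "k - 1 = 2 * i + 1" using k by simp
    then show ?thesis using odd[of j] odd[of i] k by simp
  qed
next
  case False
  then obtain j where k: "k = 2 * j + 1" by (auto elim: oddE)
  have "gauss_moment (Suc k) = sqrt (2 * pi) * (fact (2 * Suc j) / (2 ^ Suc j * fact (Suc j)))"
    using integral_std_normal_moment_even[of "Suc j"] k by (simp add: gauss_moment_eq)
  also have "(fact (2 * Suc j) :: real) = (2 * real j + 2) * (2 * real j + 1) * fact (2 * j)"
    by (simp add: algebra_simps)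
  also have "(2 * real j + 2) * (2 * real j + 1) * fact (2 * j) / (2 ^ Suc j * fact (Suc j)) =
      (2 * real j + 1) * (fact (2 * j) / (2 ^ j * fact j))"
    by (simp add: divide_simps)
  finally show ?thesis
    using integral_std_normal_moment_even[of j] k by (simp add: gauss_moment_eq)
qed

lemma bij_betw_axis_Basis: "bij_betw (\<lambda>i. axis i 1 :: real ^ 'n) UNIV Basis"
  by (auto simp: bij_betw_def inj_on_def axis_eq_axis Basis_vec_def)

text \<open>The weight and the monomial both factor over the coordinates, and \<open>lborel\<close>
  is the image of a product measure indexed by \<open>Basis\<close>.\<close>

lemma gauss_monomial:
  fixes \<alpha> :: "'n::finite \<Rightarrow> nat"
  shows "integrable lborel (\<lambda>x. exp (- (norm x)\<^sup>2 / 2) * monomial \<alpha> x)"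
    and "(LINT x|lborel. exp (- (norm x)\<^sup>2 / 2) * monomial \<alpha> x) = (\<Prod>i\<in>UNIV. gauss_moment (\<alpha> i))"
proof -
  define g where "g = (\<lambda>(b :: real ^ 'n) t. exp (- t\<^sup>2 / 2) * t ^ \<alpha> (axis_index b) :: real)"
  interpret product_sigma_finite "\<lambda>b :: real ^ 'n. lborel :: real measure"
    by standard
  have eq: "exp (- (norm x)\<^sup>2 / 2) * monomial \<alpha> x = (\<Prod>b\<in>Basis. g b (x \<bullet> b))" for x
  proof -
    have "(norm x)\<^sup>2 = (\<Sum>i\<in>UNIV. (x $ i)\<^sup>2)"
      unfolding power2_norm_eq_inner inner_vec_def by (simp add: power2_eq_square)
    then have "exp (- (norm x)\<^sup>2 / 2) = (\<Prod>i\<in>UNIV. exp (- (x $ i)\<^sup>2 / 2))"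
      by (simp add: exp_sum[symmetric] sum_negf sum_divide_distrib)
    then have "exp (- (norm x)\<^sup>2 / 2) * monomial \<alpha> x = (\<Prod>i\<in>UNIV. g (axis i 1) (x \<bullet> axis i 1))"
      by (simp add: monomial_def prod.distrib g_def inner_axis)
    also have "\<dots> = (\<Prod>b\<in>Basis. g b (x \<bullet> b))"
      by (rule prod.reindex_bij_betw[OF bij_betw_axis_Basis])
    finally show ?thesis .
  qed
  have int_g: "integrable lborel (g b)" for b
    unfolding g_def by (rule gauss_moment_integrable)
  have [measurable]: "g b \<in> borel_measurable borel" for b unfolding g_def by measurable
  have int: "integrable (Pi\<^sub>M Basis (\<lambda>b :: real ^ 'n. lborel)) (\<lambda>f. \<Prod>b\<in>Basis. g b (f b))"
    by (rule product_integrable_prod) (auto intro: int_g)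
  have val: "integral\<^sup>L (Pi\<^sub>M Basis (\<lambda>b :: real ^ 'n. lborel)) (\<lambda>f. \<Prod>b\<in>Basis. g b (f b)) = (\<Prod>b\<in>Basis. integral\<^sup>L lborel (g b))"
    by (rule product_integral_prod) (auto intro: int_g)
  have m1: "(\<lambda>f. \<Sum>b\<in>Basis. f b *\<^sub>R b) \<in> Pi\<^sub>M Basis (\<lambda>b :: real ^ 'n. lborel) \<rightarrow>\<^sub>M borel" by measurable
  have m2: "(\<lambda>x :: real ^ 'n. \<Prod>b\<in>Basis. g b (x \<bullet> b)) \<in> borel_measurable borel" by measurable
  have in_cong: "(\<Prod>b\<in>Basis. g b ((\<Sum>b\<in>Basis. f b *\<^sub>R b) \<bullet> b)) = (\<Prod>b\<in>Basis. g b (f b))" for f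
    by (intro prod.cong refl) simp
  show "integrable lborel (\<lambda>x. exp (- (norm x)\<^sup>2 / 2) * monomial \<alpha> x)"
    unfolding eq by (subst lborel_eq, subst integrable_distr_eq[OF m1 m2]) (simp only: in_cong int)
  have "(LINT x|lborel. exp (- (norm x)\<^sup>2 / 2) * monomial \<alpha> x) = (\<Prod>b\<in>Basis. integral\<^sup>L lborel (g b))"
    unfolding eq by (subst lborel_eq, subst integral_distr[OF m1 m2]) (simp only: in_cong val)
  also have "\<dots> = (\<Prod>i\<in>UNIV. integral\<^sup>L lborel (g (axis i 1)))"
    by (rule prod.reindex_bij_betw[OF bij_betw_axis_Basis, symmetric])
  finally show "(LINT x|lborel. exp (- (norm x)\<^sup>2 / 2) * monomial \<alpha> x) = (\<Prod>i\<in>UNIV. gauss_moment (\<alpha> i))"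
    by (simp add: g_def gauss_moment_def)
qed

definition gauss_integral :: "(real ^ 'n \<Rightarrow> real) \<Rightarrow> real" where
  "gauss_integral f = (LINT x|lborel. exp (- (norm x)\<^sup>2 / 2) * f x)"

lemma integrable_gauss_homogeneous:
  assumes "f \<in> homogeneous_polys l"
  shows "integrable lborel (\<lambda>x. exp (- (norm x)\<^sup>2 / 2) * f x)"
proof -
  from assms obtain c where f: "f = (\<lambda>x. \<Sum>\<alpha> | sum \<alpha> UNIV = l. c \<alpha> * monomial \<alpha> x)"
    by (auto simp: homogeneous_polys_def)
  have "exp (- (norm x)\<^sup>2 / 2) * f x = (\<Sum>\<alpha> | sum \<alpha> UNIV = l. c \<alpha> * (exp (- (norm x)\<^sup>2 / 2) * monomial \<alpha> x))" for x
    unfolding f by (simp add: sum_distrib_left mult_ac)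
  then show ?thesis
    by (simp only:) (intro Bochner_Integration.integrable_sum integrable_mult_right gauss_monomial(1))
qed

lemma gauss_integral_sum:
  assumes "\<And>j. j \<in> A \<Longrightarrow> f j \<in> homogeneous_polys (l j)"
  shows "gauss_integral (\<lambda>x. \<Sum>j\<in>A. f j x) = (\<Sum>j\<in>A. gauss_integral (f j))"
  unfolding gauss_integral_def sum_distrib_left
  by (rule Bochner_Integration.integral_sum) (rule integrable_gauss_homogeneous[OF assms])

lemma gauss_integral_add:
  assumes "f \<in> homogeneous_polys l" "g \<in> homogeneous_polys m"
  shows "gauss_integral (\<lambda>x. f x + g x) = gauss_integral f + gauss_integral g"
  unfolding gauss_integral_def distrib_left
  by (rule Bochner_Integration.integral_add) (rule integrable_gauss_homogeneous[OF assms(1)], rule integrable_gauss_homogeneous[OF assms(2)])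

lemma gauss_integral_cmult: "gauss_integral (\<lambda>x. c * f x) = c * gauss_integral f"
  unfolding gauss_integral_def by (simp add: mult.left_commute[of _ c])

lemma partial_deriv_sum:
  assumes "\<And>j. j \<in> A \<Longrightarrow> f j \<in> homogeneous_polys l"
  shows "partial_deriv i (\<lambda>x. \<Sum>j\<in>A. f j x) = (\<lambda>x. \<Sum>j\<in>A. partial_deriv i (f j) x)"
  by (intro partial_deriv_eqI DERIV_sum) (rule has_partial_deriv_0[OF assms])

lemma partial_deriv_monomial:
  fixes \<alpha> :: "'n::finite \<Rightarrow> nat"
  shows "partial_deriv i (monomial \<alpha>) = (\<lambda>x. real (\<alpha> i) * monomial (\<alpha>(i := \<alpha> i - 1)) x)"
proof (rule partial_deriv_eqI)
  fix x :: "real ^ 'n"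
  define R where "R = (\<Prod>j\<in>UNIV - {i}. x $ j ^ \<alpha> j)"
  have "monomial \<alpha> (x + s *\<^sub>R axis i 1) = (x $ i + s) ^ \<alpha> i * R" for s
    unfolding monomial_def R_def
    by (subst prod.remove[of UNIV i]) (auto simp: axis_def intro!: prod.cong)
  moreover have "monomial (\<alpha>(i := \<alpha> i - 1)) x = (x $ i) ^ (\<alpha> i - 1) * R"
    unfolding monomial_def R_def by (subst prod.remove[of UNIV i]) (auto intro!: prod.cong)
  moreover have "((\<lambda>s. (x $ i + s) ^ \<alpha> i * R) has_real_derivative real (\<alpha> i) * ((x $ i) ^ (\<alpha> i - 1) * R)) (at 0)"
    by (auto intro!: derivative_eq_intros)
  ultimately show "((\<lambda>s. monomial \<alpha> (x + s *\<^sub>R axis i 1)) has_real_derivative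
      real (\<alpha> i) * monomial (\<alpha>(i := \<alpha> i - 1)) x) (at 0)" by simp
qed

text \<open>By linearity only monomials matter; there the factors other than the i-th agree on both
  sides and the i-th is \<open>gauss_moment_Suc\<close>. No boundary terms occur.\<close>

lemma gauss_integration_by_parts:
  fixes f :: "real ^ 'n::finite \<Rightarrow> real"
  assumes "f \<in> homogeneous_polys l"
  shows "gauss_integral (partial_deriv i f) = gauss_integral (\<lambda>x. x $ i * f x)"
proof -
  have mono: "gauss_integral (partial_deriv i (monomial \<alpha>)) = gauss_integral (\<lambda>x. x $ i * monomial \<alpha> x)" for \<alpha> :: "'n \<Rightarrow> nat"
  proof -
    define R where "R = (\<Prod>j\<in>UNIV - {i}. gauss_moment (\<alpha> j))"
    have R: "(\<Prod>j\<in>UNIV. gauss_moment ((\<alpha>(i := k)) j)) = gauss_moment k * R" for k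
      unfolding R_def by (subst prod.remove[of UNIV i]) (auto intro!: prod.cong)
    have "gauss_integral (monomial (\<alpha>(i := k))) = gauss_moment k * R" for k
      unfolding gauss_integral_def gauss_monomial(2) R ..
    then show ?thesis
      unfolding partial_deriv_monomial gauss_integral_cmult monomial_fun_upd_Suc[symmetric]
      by (simp add: gauss_moment_Suc)
  qed
  from assms obtain c where f: "f = (\<lambda>x. \<Sum>\<alpha> | sum \<alpha> UNIV = l. c \<alpha> * monomial \<alpha> x)"
    by (auto simp: homogeneous_polys_def)
  have h: "monomial \<alpha> \<in> homogeneous_polys l" if "\<alpha> \<in> {\<alpha>. sum \<alpha> UNIV = l}" for \<alpha> :: "'n \<Rightarrow> nat"
    using that by (auto intro: homogeneous_polys_monomial)
  have "gauss_integral (partial_deriv i f) =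
      gauss_integral (\<lambda>x. \<Sum>\<alpha> | sum \<alpha> UNIV = l. c \<alpha> * partial_deriv i (monomial \<alpha>) x)"
    unfolding f
    by (subst partial_deriv_sum[OF homogeneous_polys_cmult[OF h]])
       (auto intro!: arg_cong[of _ _ gauss_integral] sum.cong ext simp: partial_deriv_cmult[OF h])
  also have "\<dots> = (\<Sum>\<alpha> | sum \<alpha> UNIV = l. c \<alpha> * gauss_integral (partial_deriv i (monomial \<alpha>)))"
    by (subst gauss_integral_sum[OF homogeneous_polys_cmult[OF partial_deriv_homogeneous_polys(1)[OF h]]])
      (simp_all add: gauss_integral_cmult)
  also have "\<dots> = (\<Sum>\<alpha> | sum \<alpha> UNIV = l. gauss_integral (\<lambda>x. c \<alpha> * (x $ i * monomial \<alpha> x)))"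
    unfolding mono gauss_integral_cmult ..
  also have "\<dots> = gauss_integral (\<lambda>x. \<Sum>\<alpha> | sum \<alpha> UNIV = l. c \<alpha> * (x $ i * monomial \<alpha> x))"
    by (rule gauss_integral_sum[symmetric])
      (rule homogeneous_polys_cmult[OF homogeneous_polys_coord_mult[OF h]])
  also have "(\<lambda>x. \<Sum>\<alpha> | sum \<alpha> UNIV = l. c \<alpha> * (x $ i * monomial \<alpha> x)) = (\<lambda>x. x $ i * f x)"
    unfolding f sum_distrib_left by (simp only: mult.left_commute)
  finally show ?thesis .
qed

text \<open>For odd k the power of the norm is not a polynomial, but it is dominated by 1 +
  |x|^(2k), which is.\<close>

lemma gauss_radial_integrable: "integrable (lborel :: (real ^ 'n::finite) measure) (\<lambda>x. exp (- (norm x)\<^sup>2 / 2) * norm x ^ k)"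
proof -
  have 1: "integrable (lborel :: (real ^ 'n) measure) (\<lambda>x. exp (- (norm x)\<^sup>2 / 2) * 1)"
    by (rule integrable_gauss_homogeneous[OF homogeneous_polys_const])
  have 2: "integrable (lborel :: (real ^ 'n) measure) (\<lambda>x. exp (- (norm x)\<^sup>2 / 2) * (x \<bullet> x) ^ k)"
    by (rule integrable_gauss_homogeneous[OF homogeneous_polys_power[OF homogeneous_polys_norm2]])
  have le: "r ^ k \<le> 1 + (r ^ k)\<^sup>2" for r :: real
    using zero_le_power2[of "r ^ k - 1 / 2"] by (simp add: power2_eq_square algebra_simps)
  show ?thesis
  proof (rule Bochner_Integration.integrable_bound[OF Bochner_Integration.integrable_add[OF 1 2]])
    show "AE x :: real ^ 'n in lborel. norm (exp (- (norm x)\<^sup>2 / 2) * norm x ^ k) \<le>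
        norm (exp (- (norm x)\<^sup>2 / 2) * 1 + exp (- (norm x)\<^sup>2 / 2) * (x \<bullet> x) ^ k)"
    proof (intro always_eventually allI)
      fix x :: "real ^ 'n"
      have "norm (exp (- (norm x)\<^sup>2 / 2) * norm x ^ k) = exp (- (norm x)\<^sup>2 / 2) * norm x ^ k" by simp
      also have "\<dots> \<le> exp (- (norm x)\<^sup>2 / 2) * (1 + (norm x ^ k)\<^sup>2)"
        by (intro mult_left_mono le) simp
      also have "(norm x ^ k)\<^sup>2 = (x \<bullet> x) ^ k"
        by (simp add: power_even_eq[symmetric] dot_square_norm power_mult[symmetric] mult.commute)
      also have "exp (- (norm x)\<^sup>2 / 2) * (1 + (x \<bullet> x) ^ k) =
          exp (- (norm x)\<^sup>2 / 2) * 1 + exp (- (norm x)\<^sup>2 / 2) * (x \<bullet> x) ^ k"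
        by (simp only: distrib_left)
      finally show "norm (exp (- (norm x)\<^sup>2 / 2) * norm x ^ k) \<le>
        norm (exp (- (norm x)\<^sup>2 / 2) * 1 + exp (- (norm x)\<^sup>2 / 2) * (x \<bullet> x) ^ k)" by simp
    qed
  qed measurable
qed

lemma gauss_radial_pos: "(LINT x|(lborel :: (real ^ 'n::finite) measure). exp (- (norm x)\<^sup>2 / 2) * norm x ^ k) > 0"
proof (rule ccontr)
  let ?f = "\<lambda>x :: real ^ 'n. exp (- (norm x)\<^sup>2 / 2) * norm x ^ k"
  assume "\<not> integral\<^sup>L lborel ?f > 0"
  moreover have "integral\<^sup>L lborel ?f \<ge> 0" by (rule Bochner_Integration.integral_nonneg) simp
  ultimately have "integral\<^sup>L lborel ?f = 0" by linarith
  then have "AE x in lborel. ?f x = 0"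
    by (subst (asm) integral_nonneg_eq_0_iff_AE[OF gauss_radial_integrable]) auto
  with AE_lborel_singleton[of 0] have "AE x :: real ^ 'n in lborel. False"
    by eventually_elim auto
  then show False
    by (simp add: AE_iff_null null_sets_def)
qed

text \<open>The radial factor is positive by \<open>gauss_radial_pos\<close>, so vanishing of the
  Gaussian integral is the same as vanishing of the spherical one.\<close>

lemma gauss_integral_homogeneous:
  fixes f :: "real ^ 'n::finite \<Rightarrow> real"
  assumes f: "f \<in> homogeneous_polys l"
  shows "gauss_integral f =
    (LINT x|(lborel :: (real ^ 'n) measure). exp (- (norm x)\<^sup>2 / 2) * norm x ^ l) * sphere_integral f"
  unfolding gauss_integral_def
  by (rule polar_integral_homogeneous(2)[OF _ _ f, of "\<lambda>r. exp (- r\<^sup>2 / 2)"])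
    (use gauss_radial_integrable in simp_all)

text \<open>
  Integration by parts shows that \<open>\<integral> \<nabla>p \<cdot> \<nabla>q\<close> against the Gaussian is \<open>deg q \<integral> p q\<close> for harmonic \<open>q\<close>, and
  the left-hand side is symmetric.
\<close>

lemma gauss_gradient_harmonic:
  fixes p q :: "real ^ 'n::finite \<Rightarrow> real"
  assumes p: "p \<in> homogeneous_polys l" and q: "q \<in> harmonic_polys m"
  shows "(\<Sum>i\<in>UNIV. gauss_integral (\<lambda>x. partial_deriv i p x * partial_deriv i q x)) =
    real m * gauss_integral (\<lambda>x. p x * q x)"
proof -
  note q' = harmonic_polys_homogeneous[OF q]
  note dp = partial_deriv_homogeneous_polys(1)[OF p]
  note dq = partial_deriv_homogeneous_polys(1)[OF q']
  note ddq = partial_deriv_homogeneous_polys(1)[OF dq]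
  have "(\<Sum>i\<in>UNIV. gauss_integral (\<lambda>x. partial_deriv i p x * partial_deriv i q x)) +
      (\<Sum>i\<in>UNIV. gauss_integral (\<lambda>x. p x * partial_deriv i (partial_deriv i q) x)) =
      (\<Sum>i\<in>UNIV. gauss_integral (partial_deriv i (\<lambda>x. p x * partial_deriv i q x)))"
    unfolding sum.distrib[symmetric]
    by (intro sum.cong refl, subst partial_deriv_mult[OF p dq])
      (rule gauss_integral_add[OF homogeneous_polys_mult[OF dp dq] homogeneous_polys_mult[OF p ddq], symmetric])
  also have "\<dots> = (\<Sum>i\<in>UNIV. gauss_integral (\<lambda>x. x $ i * (p x * partial_deriv i q x)))"
    by (intro sum.cong refl gauss_integration_by_parts[OF homogeneous_polys_mult[OF p dq]])
  also have "\<dots> = gauss_integral (\<lambda>x. \<Sum>i\<in>UNIV. x $ i * (p x * partial_deriv i q x))"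
    by (rule gauss_integral_sum[symmetric]) (rule homogeneous_polys_coord_mult[OF homogeneous_polys_mult[OF p dq]])
  also have "(\<lambda>x. \<Sum>i\<in>UNIV. x $ i * (p x * partial_deriv i q x)) = (\<lambda>x. real m * (p x * q x))"
  proof
    fix x
    have "(\<Sum>i\<in>UNIV. x $ i * (p x * partial_deriv i q x)) = p x * (\<Sum>i\<in>UNIV. x $ i * partial_deriv i q x)"
      by (simp add: sum_distrib_left mult_ac)
    then show "(\<Sum>i\<in>UNIV. x $ i * (p x * partial_deriv i q x)) = real m * (p x * q x)"
      by (simp add: euler_homogeneous[OF q'])
  qed
  also have "(\<Sum>i\<in>UNIV. gauss_integral (\<lambda>x. p x * partial_deriv i (partial_deriv i q) x)) =
      gauss_integral (\<lambda>x. \<Sum>i\<in>UNIV. p x * partial_deriv i (partial_deriv i q) x)"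
    by (rule gauss_integral_sum[symmetric]) (rule homogeneous_polys_mult[OF p ddq])
  also have "(\<lambda>x. \<Sum>i\<in>UNIV. p x * partial_deriv i (partial_deriv i q) x) = (\<lambda>x. p x * laplacian q x)"
    by (simp add: laplacian_eq[OF q'] sum_distrib_left)
  also have "gauss_integral (\<lambda>x. p x * laplacian q x) = 0"
    by (simp add: harmonic_polys_laplacian[OF q] gauss_integral_def)
  finally show ?thesis by (simp add: gauss_integral_cmult)
qed

text \<open>Takes the place of self-adjointness of the spherical Laplacian: evaluating the symmetric
  gradient form in both ways yields (m - l) I = 0 for the Gaussian integral I of p q.\<close>

lemma harmonic_polys_orthogonal:
  fixes p q :: "real ^ 'n::finite \<Rightarrow> real"
  assumes p: "p \<in> harmonic_polys l" and q: "q \<in> harmonic_polys m" and "l \<noteq> m"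
  shows "sphere_integral (\<lambda>x. p x * q x) = 0"
proof -
  note p' = harmonic_polys_homogeneous[OF p]
  note q' = harmonic_polys_homogeneous[OF q]
  have "real m * gauss_integral (\<lambda>x. p x * q x) = real l * gauss_integral (\<lambda>x. q x * p x)"
    unfolding gauss_gradient_harmonic[OF p' q, symmetric] gauss_gradient_harmonic[OF q' p, symmetric]
    by (simp add: mult.commute)
  also have "(\<lambda>x. q x * p x) = (\<lambda>x. p x * q x)" by (simp add: mult.commute)
  finally have "gauss_integral (\<lambda>x. p x * q x) = 0" using \<open>l \<noteq> m\<close> by simp
  then show ?thesis
    unfolding gauss_integral_homogeneous[OF homogeneous_polys_mult[OF p' q']]
    using gauss_radial_pos[of "l + m", where 'n = 'n] by simp
qed

lemma harmonic_polys_const [simp]: "(\<lambda>x. c) \<in> harmonic_polys 0"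
  using laplacian_low_degree[OF homogeneous_polys_const] by (simp add: harmonic_polys_def)

lemma sphere_integral_harmonic:
  assumes "p \<in> harmonic_polys l" "l > 0"
  shows "sphere_integral p = 0"
  using harmonic_polys_orthogonal[OF assms(1) harmonic_polys_const[of 1]] assms(2) by simp

section \<open>Mean values and a large sieve inequality\<close>

lemma integrable_indicator_bounded:
  fixes f :: "real ^ 'n::finite \<Rightarrow> real"
  assumes cont: "continuous_on UNIV f" and [measurable]: "A \<in> sets borel" and "bounded A"
  shows "integrable lborel (\<lambda>x. indicator A x * f x)"
proof -
  have "compact (closure A)" using \<open>bounded A\<close> by simp
  then have "bounded (f ` closure A)"
    by (intro compact_imp_bounded compact_continuous_image continuous_on_subset[OF cont]) auto
  then obtain B where "\<forall>y \<in> f ` closure A. norm y \<le> B" unfolding bounded_iff by blast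
  then have B: "norm (f x) \<le> B" if "x \<in> A" for x using that closure_subset[of A] by blast
  have [measurable]: "f \<in> borel_measurable borel" by (rule borel_measurable_continuous_onI[OF cont])
  have "integrable lborel (\<lambda>x. indicator A x *\<^sub>R f x)"
    by (rule integrableI_bounded_set_indicator[of A _ f B])
      (use B emeasure_bounded_finite[OF \<open>bounded A\<close>] in auto)
  then show ?thesis by simp
qed

lemma integral_indicator_translate:
  fixes f :: "real ^ 'n::finite \<Rightarrow> real"
  assumes [measurable]: "f \<in> borel_measurable borel"
  shows "(LINT y|lborel. indicator (ball x r) y * f y) = (LINT y|lborel. indicator (ball 0 r) y * f (x + y))"
proof -
  have "(LINT y|lborel. indicator (ball x r) y * f y) = (LINT y|distr lborel borel ((+) x). indicator (ball x r) y * f y)"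
    by (simp add: lborel_distr_plus)
  also have "\<dots> = (LINT y|lborel. indicator (ball x r) (x + y) * f (x + y))"
    by (subst integral_distr) (auto intro!: borel_measurable_times borel_measurable_indicator)
  also have "(\<lambda>y. indicator (ball x r) (x + y) :: real) = indicator (ball 0 r)"
    by (auto simp: indicator_def dist_norm fun_eq_iff)
  finally show ?thesis .
qed

text \<open>B is a set of radii, so that one statement serves both balls and shells.\<close>

lemma integral_ball_homogeneous:
  fixes f :: "real ^ 'n::finite \<Rightarrow> real"
  assumes [measurable]: "B \<in> sets borel" "bounded B" and f: "f \<in> homogeneous_polys l"
  shows "(LINT x|lborel. indicator B (norm x) * f x) =
    (LINT x|(lborel :: (real ^ 'n) measure). indicator B (norm x) * norm x ^ l) * sphere_integral f"
proof (rule polar_integral_homogeneous(2)[OF _ _ f])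
  have 1: "(\<lambda>x :: real ^ 'n. indicator B (norm x) :: real) = indicator (norm -` B)"
    by (auto simp: indicator_def)
  have "bounded (norm -` B :: (real ^ 'n) set)"
  proof -
    from \<open>bounded B\<close> obtain a where "\<forall>x\<in>B. \<bar>x\<bar> \<le> a" by (auto simp: bounded_iff)
    then show ?thesis unfolding bounded_iff by (intro exI[of _ a]) auto
  qed
  moreover have "norm -` B \<in> sets (borel :: (real ^ 'n) measure)"
    using measurable_sets[of norm borel borel B] by simp
  ultimately have "integrable (lborel :: (real ^ 'n) measure) (\<lambda>x. indicator (norm -` B) x * norm x ^ l)"
    by (intro integrable_indicator_bounded) (auto intro!: continuous_intros)
  then show "integrable (lborel :: (real ^ 'n) measure) (\<lambda>x. indicator B (norm x) * norm x ^ l)"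
    by (simp add: fun_cong[OF 1])
qed simp

text \<open>Expanded about x, the homogeneous parts of P are harmonic; those of positive degree
  integrate to zero over spheres and hence over the ball, and the constant part is
  \<open>P x\<close>.\<close>

lemma harmonic_mean_value:
  fixes P :: "real ^ 'n::finite \<Rightarrow> real"
  assumes P: "P \<in> polys_upto L" and lap: "\<And>x. laplacian P x = 0"
  shows "(LINT y|lborel. indicator (ball x r) y * P y) = measure lborel (ball (0 :: real ^ 'n) r) * P x"
proof -
  from polys_upto_translation[OF P, of x] obtain g where
    g: "\<And>l. g l \<in> homogeneous_polys l" and Pg: "(\<lambda>y. P (x + y)) = (\<lambda>y. \<Sum>l\<le>L. g l y)"
    by (rule polys_uptoE) blast
  have gh: "g l \<in> harmonic_polys l" if "l \<le> L" for l
    using homogeneous_parts_harmonic[OF g _ that] lap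
    unfolding Pg[symmetric] laplacian_translation by blast
  obtain c where c: "g 0 = (\<lambda>x. c)" using homogeneous_polys_0E[OF g[of 0]] by blast
  have g0: "g l 0 = 0" if "l > 0" for l
    using homogeneous_polys_scale[OF g, of l 0 0] that by (simp add: power_0_left)
  have "P x = (\<Sum>l\<le>L. g l 0)" using fun_cong[OF Pg, of 0] by simp
  also have "\<dots> = (\<Sum>l\<le>L. if l = 0 then c else 0)"
    by (intro sum.cong) (auto simp: c g0)
  also have "\<dots> = c" by simp
  finally have Px: "P x = c" .
  have z: "(LINT y|lborel. indicator (ball 0 r) y * g l y) =
      (if l = 0 then measure lborel (ball (0 :: real ^ 'n) r) * c else 0)" if "l \<le> L" for l
  proof (cases "l = 0")
    case True
    then show ?thesis by (simp add: c)
  next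
    case False
    have ind: "indicator (ball (0 :: real ^ 'n) r) y = (indicator {0..<r} (norm y) :: real)" for y
      by (simp add: indicator_def)
    have "(LINT y|lborel. indicator (ball 0 r) y * g l y) =
        (LINT x|(lborel :: (real ^ 'n) measure). indicator {0..<r} (norm x) * norm x ^ l) * sphere_integral (g l)"
      unfolding ind by (rule integral_ball_homogeneous[OF _ _ g]) auto
    then show ?thesis using False sphere_integral_harmonic[OF gh[OF that]] by simp
  qed
  have "(LINT y|lborel. indicator (ball x r) y * P y) = (LINT y|lborel. indicator (ball 0 r) y * P (x + y))"
    by (rule integral_indicator_translate)
      (rule borel_measurable_continuous_onI[OF continuous_on_polys_upto[OF P]])
  also have "\<dots> = (LINT y|lborel. (\<Sum>l\<le>L. indicator (ball 0 r) y * g l y))"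
    by (simp add: fun_cong[OF Pg] sum_distrib_left)
  also have "\<dots> = (\<Sum>l\<le>L. (LINT y|lborel. indicator (ball 0 r) y * g l y))"
    by (rule Bochner_Integration.integral_sum)
      (rule integrable_indicator_bounded[OF continuous_on_homogeneous_polys[OF g]], auto)
  also have "\<dots> = measure lborel (ball (0 :: real ^ 'n) r) * c"
    by (simp add: z)
  finally show ?thesis by (simp add: Px)
qed

text \<open>Expand the nonnegative integral of (P y - P x)^2 over the ball and evaluate the mixed
  term by the mean value property.\<close>

lemma harmonic_local_bound:
  fixes P :: "real ^ 'n::finite \<Rightarrow> real"
  assumes P: "P \<in> polys_upto L" and lap: "\<And>x. laplacian P x = 0"
  shows "measure lborel (ball (0 :: real ^ 'n) r) * (P x)\<^sup>2 \<le> (LINT y|lborel. indicator (ball x r) y * (P y)\<^sup>2)"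
proof -
  have cont: "continuous_on UNIV P" by (rule continuous_on_polys_upto[OF P])
  have i1: "integrable lborel (\<lambda>y. indicator (ball x r) y * (P y)\<^sup>2)"
    by (rule integrable_indicator_bounded) (auto intro!: continuous_intros cont)
  have i2: "integrable lborel (\<lambda>y. indicator (ball x r) y * P y)"
    by (rule integrable_indicator_bounded) (auto intro!: continuous_intros cont)
  have i3: "integrable lborel (\<lambda>y. indicator (ball x r) y * (1 :: real))"
    by (rule integrable_indicator_bounded) (auto intro!: continuous_intros)
  have v: "(LINT y|lborel. indicator (ball x r) y * (1 :: real)) = measure lborel (ball (0 :: real ^ 'n) r)"
    using integral_indicator_translate[of "\<lambda>_. 1" x r] by simp
  have "0 \<le> (LINT y|lborel. indicator (ball x r) y * (P y - P x)\<^sup>2)"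
    by (rule Bochner_Integration.integral_nonneg) simp
  also have "(\<lambda>y. indicator (ball x r) y * (P y - P x)\<^sup>2) =
      (\<lambda>y. indicator (ball x r) y * (P y)\<^sup>2 + (- 2 * P x) * (indicator (ball x r) y * P y) +
        (P x)\<^sup>2 * (indicator (ball x r) y * (1 :: real)))"
    by (auto simp: power2_eq_square algebra_simps fun_eq_iff)
  also have "integral\<^sup>L lborel \<dots> = (LINT y|lborel. indicator (ball x r) y * (P y)\<^sup>2) +
      (- 2 * P x) * (measure lborel (ball (0 :: real ^ 'n) r) * P x) +
      (P x)\<^sup>2 * measure lborel (ball (0 :: real ^ 'n) r)"
    using i1 i2 i3 by (simp only: harmonic_mean_value[OF P lap] v Bochner_Integration.integral_add Bochner_Integration.integrable_add
        integrable_mult_right integral_mult_right_zero simp_thms)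
  finally show ?thesis by (simp add: power2_eq_square algebra_simps)
qed

lemma power_diff_le:
  fixes a b :: real
  assumes "0 \<le> b" "b \<le> a"
  shows "a ^ n - b ^ n \<le> real n * a ^ (n - 1) * (a - b)"
proof (induction n)
  case (Suc n)
  have "a ^ Suc n - b ^ Suc n = a * (a ^ n - b ^ n) + b ^ n * (a - b)"
    by (simp add: algebra_simps)
  also have "\<dots> \<le> a * (real n * a ^ (n - 1) * (a - b)) + a ^ n * (a - b)"
    using assms by (intro add_mono mult_left_mono mult_right_mono power_mono Suc.IH) auto
  also have "\<dots> = real (Suc n) * a ^ (Suc n - 1) * (a - b)"
    by (cases n) (simp_all add: algebra_simps)
  finally show ?case .
qed simp

text \<open>Here d is half the thickness of the shell, not a dimension. Orthogonality removes the
  mixed terms, \<open>(1 + d) ^ (2 * L)\<close> bounds the radial growth, and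
  \<open>CARD('n) * 2 ^ CARD('n) * d\<close> bounds the volume of the shell relative to the unit
  ball.\<close>

lemma shell_integral_bound:
  fixes p :: "nat \<Rightarrow> real ^ 'n::finite \<Rightarrow> real"
  assumes p: "\<And>l. p l \<in> harmonic_polys l" and d: "0 < d" "d \<le> 1"
  shows "(LINT y|lborel. indicator {1 - d<..<1 + d} (norm y) * (\<Sum>l\<le>L. p l y)\<^sup>2) \<le>
    measure lborel (ball (0 :: real ^ 'n) 1) * (real CARD('n) * 2 ^ CARD('n) * d) * (1 + d) ^ (2 * L) *
      (\<Sum>l\<le>L. sphere_integral (\<lambda>x. (p l x)\<^sup>2))"
proof -
  note p' = harmonic_polys_homogeneous[OF p]
  let ?B = "{1 - d<..<1 + d}"
  let ?S = "{x :: real ^ 'n. norm x \<in> ?B}"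
  define N where "N = (\<lambda>k. LINT x|(lborel :: (real ^ 'n) measure). indicator ?B (norm x) * norm x ^ k)"
  have ind: "indicator ?B (norm y) = (indicator ?S y :: real)" for y :: "real ^ 'n"
    by (simp add: indicator_def)
  have S: "?S \<in> sets borel" by measurable
  have bS: "bounded ?S" by (rule bounded_subset[OF bounded_ball[of 0 2]]) (use d in auto)
  have vol: "measure lborel ?S \<le> measure lborel (ball (0 :: real ^ 'n) 1) * (real CARD('n) * 2 ^ CARD('n) * d)"
  proof -
    have "measure lborel ?S \<le> measure lborel (ball (0 :: real ^ 'n) (1 + d) - cball 0 (1 - d))"
      by (intro measure_mono_fmeasurable) (auto simp: S intro!: fmeasurableI emeasure_bounded_finite intro: bounded_subset[OF bounded_ball])
    also have "\<dots> = measure lborel (ball (0 :: real ^ 'n) (1 + d)) - measure lborel (cball (0 :: real ^ 'n) (1 - d))"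
      by (rule measure_Diff) (use d emeasure_lborel_ball_finite[of "0 :: real ^ 'n" "1 + d"] in auto)
    also have "\<dots> = measure lborel (ball (0 :: real ^ 'n) 1) * ((1 + d) ^ CARD('n) - (1 - d) ^ CARD('n))"
      using d by (simp add: content_ball content_cball algebra_simps)
    also have "(1 + d) ^ CARD('n) - (1 - d) ^ CARD('n) \<le> real CARD('n) * (1 + d) ^ (CARD('n) - 1) * ((1 + d) - (1 - d))"
      using d by (intro power_diff_le) auto
    also have "\<dots> = real CARD('n) * (2 * (1 + d) ^ (CARD('n) - 1)) * d" by simp
    also have "\<dots> \<le> real CARD('n) * (2 * 2 ^ (CARD('n) - 1)) * d"
      using d by (intro mult_right_mono mult_left_mono power_mono) auto
    also have "2 * 2 ^ (CARD('n) - 1) = (2 :: real) ^ CARD('n)"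
      by (simp add: power_Suc[symmetric] del: power_Suc)
    finally show ?thesis by (simp add: mult_left_mono)
  qed
  have N_le: "N (2 * l) \<le> (1 + d) ^ (2 * L) * measure lborel ?S" if "l \<le> L" for l
  proof -
    have "N (2 * l) \<le> (LINT x|(lborel :: (real ^ 'n) measure). (1 + d) ^ (2 * L) * (indicator ?S x * 1))"
      unfolding N_def ind
    proof (rule integral_mono)
      show "integrable (lborel :: (real ^ 'n) measure) (\<lambda>x. indicator ?S x * norm x ^ (2 * l))"
        by (rule integrable_indicator_bounded[OF _ S bS]) (auto intro!: continuous_intros)
      show "integrable (lborel :: (real ^ 'n) measure) (\<lambda>x. (1 + d) ^ (2 * L) * (indicator ?S x * 1))"
        by (rule integrable_mult_right, rule integrable_indicator_bounded[OF _ S bS]) (auto intro!: continuous_intros)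
      fix x :: "real ^ 'n"
      have "norm x ^ (2 * l) \<le> (1 + d) ^ (2 * L)" if "x \<in> ?S"
      proof -
        have "norm x ^ (2 * l) \<le> (1 + d) ^ (2 * l)" using that by (intro power_mono) auto
        also have "\<dots> \<le> (1 + d) ^ (2 * L)" using \<open>l \<le> L\<close> d by (intro power_increasing) auto
        finally show ?thesis .
      qed
      then show "indicator ?S x * norm x ^ (2 * l) \<le> (1 + d) ^ (2 * L) * (indicator ?S x * 1)"
        by (auto simp: indicator_def)
    qed
    then show ?thesis using S by simp
  qed
  have val: "(LINT y|lborel. indicator ?B (norm y) * (p l y * p m y)) =
      (if l = m then N (2 * l) * sphere_integral (\<lambda>x. (p l x)\<^sup>2) else 0)" for l m
  proof -
    have "(LINT y|lborel. indicator ?B (norm y) * (p l y * p m y)) = N (l + m) * sphere_integral (\<lambda>x. p l x * p m x)"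
      unfolding N_def by (rule integral_ball_homogeneous[OF _ _ homogeneous_polys_mult[OF p' p']]) auto
    then show ?thesis
      using harmonic_polys_orthogonal[OF p p, of l m] by (auto simp: power2_eq_square mult_2)
  qed
  have "(LINT y|lborel. indicator ?B (norm y) * (\<Sum>l\<le>L. p l y)\<^sup>2) =
      (LINT y|lborel. (\<Sum>l\<le>L. \<Sum>m\<le>L. indicator ?B (norm y) * (p l y * p m y)))"
    unfolding power2_eq_square sum_product unfolding sum_distrib_left ..
  also have "\<dots> = (\<Sum>l\<le>L. \<Sum>m\<le>L. (LINT y|lborel. indicator ?B (norm y) * (p l y * p m y)))"
  proof -
    have "integrable lborel (\<lambda>y. indicator ?B (norm y) * (p l y * p m y))" for l m
      unfolding ind
      by (rule integrable_indicator_bounded[OF _ S bS]) (intro continuous_intros continuous_on_homogeneous_polys[OF p'])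
    then show ?thesis by (simp only: Bochner_Integration.integral_sum Bochner_Integration.integrable_sum)
  qed
  also have "\<dots> = (\<Sum>l\<le>L. N (2 * l) * sphere_integral (\<lambda>x. (p l x)\<^sup>2))"
    by (simp add: val)
  also have "\<dots> \<le> (\<Sum>l\<le>L. ((1 + d) ^ (2 * L) * measure lborel ?S) * sphere_integral (\<lambda>x. (p l x)\<^sup>2))"
    by (intro sum_mono mult_right_mono N_le) (auto simp: sphere_integral_def)
  also have "\<dots> = (1 + d) ^ (2 * L) * measure lborel ?S * (\<Sum>l\<le>L. sphere_integral (\<lambda>x. (p l x)\<^sup>2))"
    by (simp add: sum_distrib_left)
  also have "\<dots> \<le> (1 + d) ^ (2 * L) * (measure lborel (ball (0 :: real ^ 'n) 1) * (real CARD('n) * 2 ^ CARD('n) * d)) *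
      (\<Sum>l\<le>L. sphere_integral (\<lambda>x. (p l x)\<^sup>2))"
    using d by (intro mult_right_mono mult_left_mono vol sum_nonneg) (auto simp: sphere_integral_def)
  finally show ?thesis by (simp add: mult_ac)
qed

text \<open>Again d is a radius. The balls have volume of order d^n with n = \<open>CARD('n)\<close>
  and the shell has volume of order d; cancelling one factor leaves the exponent n - 1, the
  dimension of the sphere.\<close>

lemma large_sieve:
  fixes p :: "nat \<Rightarrow> real ^ 'n::finite \<Rightarrow> real"
  assumes p: "\<And>l. p l \<in> harmonic_polys l" and d: "0 < d" "d \<le> 1"
    and X: "finite X" "X \<subseteq> sphere 0 1" and sep: "\<And>x y. x \<in> X \<Longrightarrow> y \<in> X \<Longrightarrow> x \<noteq> y \<Longrightarrow> dist x y \<ge> 2 * d"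
  shows "d ^ (CARD('n) - 1) * (\<Sum>x\<in>X. (\<Sum>l\<le>L. p l x)\<^sup>2) \<le>
    real CARD('n) * 2 ^ CARD('n) * (1 + d) ^ (2 * L) * (\<Sum>l\<le>L. sphere_integral (\<lambda>x. (p l x)\<^sup>2))"
proof -
  note p' = harmonic_polys_homogeneous[OF p]
  define P where "P = (\<lambda>x. \<Sum>l\<le>L. p l x)"
  let ?I = "\<Sum>l\<le>L. sphere_integral (\<lambda>x. (p l x)\<^sup>2)"
  let ?v = "measure lborel (ball (0 :: real ^ 'n) 1)"
  have P: "P \<in> polys_upto L"
    unfolding P_def by (intro polys_upto_sum homogeneous_polys_subset_polys_upto[OF p']) auto
  have lap: "laplacian P x = 0" for x
    unfolding P_def by (subst laplacian_sum[OF p']) (simp_all add: harmonic_polys_laplacian[OF p])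
  have cont: "continuous_on UNIV P" by (rule continuous_on_polys_upto[OF P])
  have v: "?v > 0" by (simp add: content_ball_pos)
  let ?B = "{1 - d<..<1 + d}"
  let ?S = "{x :: real ^ 'n. norm x \<in> ?B}"
  have bS: "bounded ?S" by (rule bounded_subset[OF bounded_ball[of 0 2]]) (use d in auto)
  have "measure lborel (ball (0 :: real ^ 'n) d) * (\<Sum>x\<in>X. (P x)\<^sup>2) \<le>
      (\<Sum>x\<in>X. (LINT y|lborel. indicator (ball x d) y * (P y)\<^sup>2))"
    unfolding sum_distrib_left by (intro sum_mono harmonic_local_bound[OF P lap])
  also have "\<dots> = (LINT y|lborel. (\<Sum>x\<in>X. indicator (ball x d) y * (P y)\<^sup>2))"
    by (rule Bochner_Integration.integral_sum[symmetric], rule integrable_indicator_bounded)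
      (auto intro!: continuous_intros cont)
  also have "\<dots> \<le> (LINT y|lborel. indicator ?S y * (P y)\<^sup>2)"
  proof (rule integral_mono)
    show "integrable lborel (\<lambda>y. \<Sum>x\<in>X. indicator (ball x d) y * (P y)\<^sup>2)"
      by (rule Bochner_Integration.integrable_sum, rule integrable_indicator_bounded)
        (auto intro!: continuous_intros cont)
    show "integrable lborel (\<lambda>y. indicator ?S y * (P y)\<^sup>2)"
      by (rule integrable_indicator_bounded[OF _ _ bS]) (auto intro!: continuous_intros cont)
    fix y :: "real ^ 'n"
    \<comment> \<open>Separation by \<open>2 * d\<close> puts y into at most one ball, and a ball of
      radius d about a unit vector stays inside the shell.\<close>
    have "(\<Sum>x\<in>X. indicator (ball x d) y) \<le> (indicator ?S y :: real)"
    proof (cases "\<exists>x\<in>X. y \<in> ball x d")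
      case True
      then obtain x where x: "x \<in> X" "dist x y < d" by auto
      have "\<not> dist x' y < d" if "x' \<in> X" "x' \<noteq> x" for x'
        using sep[OF that(1) x(1) that(2)] x(2) dist_triangle[of x' x y] by (auto simp: dist_commute)
      then have "(\<Sum>x\<in>X. indicator (ball x d) y) = (\<Sum>x'\<in>X. if x' = x then 1 else 0 :: real)"
        using x by (intro sum.cong) (auto simp: indicator_def)
      also have "\<dots> = 1" using x X by simp
      also have "y \<in> ?S"
        using x X norm_triangle_ineq3[of x y] by (auto simp: dist_norm abs_less_iff)
      then have "1 = (indicator ?S y :: real)" by simp
      finally show ?thesis by simp
    qed (simp add: indicator_def)
    then show "(\<Sum>x\<in>X. indicator (ball x d) y * (P y)\<^sup>2) \<le> indicator ?S y * (P y)\<^sup>2"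
      unfolding sum_distrib_right[symmetric] by (rule mult_right_mono) simp
  qed
  also have "\<dots> = (LINT y|lborel. indicator ?B (norm y) * (P y)\<^sup>2)"
    by (simp add: indicator_def)
  also have "\<dots> \<le> ?v * (real CARD('n) * 2 ^ CARD('n) * d) * (1 + d) ^ (2 * L) * ?I"
    unfolding P_def by (rule shell_integral_bound[OF p d])
  also have "measure lborel (ball (0 :: real ^ 'n) d) = ?v * d * d ^ (CARD('n) - 1)"
    using d by (simp add: content_ball power_Suc[symmetric] del: power_Suc)
  finally have "(?v * d) * (d ^ (CARD('n) - 1) * (\<Sum>x\<in>X. (P x)\<^sup>2)) \<le>
      (?v * d) * (real CARD('n) * 2 ^ CARD('n) * (1 + d) ^ (2 * L) * ?I)"
    by (simp add: mult_ac)
  moreover have "?v * d > 0" using v d by simp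
  ultimately show ?thesis unfolding P_def by (simp only: mult_le_cancel_left_pos)
qed

section \<open>Integration of continuous functions on the sphere\<close>

lemma borel_measurable_sphere_continuous:
  fixes f :: "real ^ 'n::finite \<Rightarrow> real"
  assumes "continuous_on (sphere 0 1) f"
  shows "f \<in> borel_measurable sphere_measure"
  using borel_measurable_continuous_on_restrict[OF assms]
  by (simp add: measurable_cong_sets[OF sets_sphere_measure refl])

lemma integrable_sphere_continuous:
  fixes f :: "real ^ 'n::finite \<Rightarrow> real"
  assumes "continuous_on (sphere 0 1) f"
  shows "integrable sphere_measure f"
proof -
  interpret prob_space "sphere_measure :: (real ^ 'n) measure" by (rule prob_space_sphere_measure)
  have "bounded (f ` sphere 0 1)"
    by (intro compact_imp_bounded compact_continuous_image assms compact_sphere)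
  then obtain B where B: "\<forall>x\<in>sphere 0 1. norm (f x) \<le> B"
    by (auto simp: bounded_iff simp del: mem_sphere mem_sphere_0)
  have "AE x in sphere_measure. norm (f x) \<le> B"
    by (rule AE_I2) (use B in auto)
  then show ?thesis
    by (rule integrable_const_bound) (rule borel_measurable_sphere_continuous[OF assms])
qed

lemma sphere_integral_cong:
  assumes "\<And>x. norm x = 1 \<Longrightarrow> f x = g x"
  shows "sphere_integral f = sphere_integral g"
  unfolding sphere_integral_def by (rule Bochner_Integration.integral_cong) (use assms in auto)

lemma sphere_integral_const [simp]: "sphere_integral (\<lambda>x :: real ^ 'n. c) = c"
proof -
  interpret prob_space "sphere_measure :: (real ^ 'n) measure" by (rule prob_space_sphere_measure)
  show ?thesis unfolding sphere_integral_def using prob_space by simp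
qed

lemma sphere_integral_sum:
  assumes "\<And>i. i \<in> A \<Longrightarrow> continuous_on (sphere 0 1) (f i)"
  shows "sphere_integral (\<lambda>x. \<Sum>i\<in>A. f i x) = (\<Sum>i\<in>A. sphere_integral (f i))"
  unfolding sphere_integral_def
  by (rule Bochner_Integration.integral_sum) (rule integrable_sphere_continuous[OF assms])

lemma sphere_integral_add:
  assumes "continuous_on (sphere 0 1) f" "continuous_on (sphere 0 1) g"
  shows "sphere_integral (\<lambda>x. f x + g x) = sphere_integral f + sphere_integral g"
  unfolding sphere_integral_def
  by (rule Bochner_Integration.integral_add) (intro integrable_sphere_continuous assms)+

lemma sphere_integral_diff:
  assumes "continuous_on (sphere 0 1) f" "continuous_on (sphere 0 1) g"
  shows "sphere_integral (\<lambda>x. f x - g x) = sphere_integral f - sphere_integral g"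
  unfolding sphere_integral_def
  by (rule Bochner_Integration.integral_diff) (intro integrable_sphere_continuous assms)+

lemma sphere_integral_cmult [simp]: "sphere_integral (\<lambda>x. c * f x) = c * sphere_integral f"
  unfolding sphere_integral_def by simp

lemma sphere_integral_mono:
  assumes "continuous_on (sphere 0 1) f" "continuous_on (sphere 0 1) g" "\<And>x. norm x = 1 \<Longrightarrow> f x \<le> g x"
  shows "sphere_integral f \<le> sphere_integral g"
  unfolding sphere_integral_def
  by (rule integral_mono) (use assms integrable_sphere_continuous in auto)

lemma sphere_integral_abs_le:
  fixes f :: "real ^ 'n::finite \<Rightarrow> real"
  assumes f: "continuous_on (sphere 0 1) f" and "\<And>x. norm x = 1 \<Longrightarrow> \<bar>f x\<bar> \<le> B"
  shows "\<bar>sphere_integral f\<bar> \<le> B"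
proof -
  have "\<bar>sphere_integral f\<bar> \<le> sphere_integral (\<lambda>x. \<bar>f x\<bar>)"
    unfolding sphere_integral_def by (rule integral_abs_bound)
  also have "\<dots> \<le> sphere_integral (\<lambda>x :: real ^ 'n. B)"
    by (intro sphere_integral_mono assms) (use f in \<open>auto intro!: continuous_intros\<close>)
  finally show ?thesis by simp
qed

lemma sphere_L2_continuous:
  fixes f :: "real ^ 'n::finite \<Rightarrow> real"
  assumes "continuous_on (sphere 0 1) f"
  shows "f \<in> sphere_L2"
  unfolding sphere_L2_def
  using assms by (auto intro!: borel_measurable_sphere_continuous integrable_sphere_continuous continuous_intros)

text \<open>Surface measure has full support: if u were nonzero at x0, it would be nonzero on a cap
  about x0, and the cone over that cap contains a solid ball about x0 / 2, which has positive
  volume.\<close>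

lemma sphere_integral_square_eq_0:
  fixes u :: "real ^ 'n::finite \<Rightarrow> real"
  assumes u: "continuous_on (sphere 0 1) u" and 0: "sphere_integral (\<lambda>x. (u x)\<^sup>2) = 0" and x0: "norm x0 = 1"
  shows "u x0 = 0"
proof (rule ccontr)
  assume "u x0 \<noteq> 0"
  have "AE x in sphere_measure. (u x)\<^sup>2 = 0"
    using 0 unfolding sphere_integral_def
    by (subst (asm) integral_nonneg_eq_0_iff_AE)
      (auto intro!: integrable_sphere_continuous continuous_intros u)
  then have "AE x in restrict_space radial_distr (sphere 0 1). u x = 0"
    unfolding sphere_measure_def radial_distr_def by simp
  then have "AE x in radial_distr. x \<in> sphere 0 1 \<longrightarrow> u x = 0"
    by (subst (asm) AE_restrict_space_iff) auto
  with AE_radial_distr_sphere have AE: "AE x in radial_distr. norm x = 1 \<and> u x = 0"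
    by eventually_elim auto
  obtain e where e: "e > 0" "\<And>x. norm x = 1 \<Longrightarrow> dist x x0 < e \<Longrightarrow> dist (u x) (u x0) < \<bar>u x0\<bar>"
    using u[unfolded continuous_on_iff, rule_format, of x0 "\<bar>u x0\<bar>"] x0 \<open>u x0 \<noteq> 0\<close> by auto
  have "AE x in radial_distr. x \<notin> ball x0 e"
    using AE
  proof eventually_elim
    case (elim x)
    then show ?case using e(2)[of x] by (auto simp: dist_commute dist_real_def)
  qed
  then have "emeasure radial_distr (ball x0 e) = 0"
    by (subst (asm) AE_iff_measurable[OF _ refl]) (auto simp: ball_def)
  then have null: "emeasure lborel (cone_of (ball x0 e) 1) = 0"
    using emeasure_radial_distr[of "ball x0 e"] by simp
  have "isCont sgn ((1 / 2) *\<^sub>R x0)"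
    using x0 by (intro isCont_sgn continuous_ident) auto
  moreover have "sgn ((1 / 2) *\<^sub>R x0) = x0" using x0 by (simp add: sgn_div_norm)
  ultimately obtain d where d: "d > 0" "\<And>y. dist y ((1 / 2) *\<^sub>R x0) < d \<Longrightarrow> dist (sgn y) x0 < e"
    using e(1) unfolding continuous_at_eps_delta by metis
  define r where "r = min d (1 / 2)"
  have "ball ((1 / 2) *\<^sub>R x0) r \<subseteq> cone_of (ball x0 e) 1"
  proof
    fix y assume y: "y \<in> ball ((1 / 2) *\<^sub>R x0) r"
    then have "norm y < 1"
      using norm_triangle_ineq2[of y "(1 / 2) *\<^sub>R x0"] x0 by (simp add: r_def dist_norm norm_minus_commute)
    then show "y \<in> cone_of (ball x0 e) 1"
      using d(2)[of y] y by (simp add: cone_of_def r_def dist_commute)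
  qed
  then have "emeasure lborel (ball ((1 / 2) *\<^sub>R x0) r) \<le> emeasure lborel (cone_of (ball x0 e) 1)"
    by (intro emeasure_mono) (auto intro: cone_of_measurable)
  then have "emeasure lborel (ball ((1 / 2) *\<^sub>R x0) r) = 0" using null by simp
  then have "measure lborel (ball ((1 / 2) *\<^sub>R x0) r) = 0" by (simp add: measure_def)
  moreover have "measure lborel (ball ((1 / 2) *\<^sub>R x0) r) > 0"
    using d(1) by (intro content_ball_pos) (simp add: r_def)
  ultimately show False by simp
qed

section \<open>Expansions in spherical harmonics\<close>

locale harmonic_basis =
  fixes Z :: "nat \<Rightarrow> nat" and Y :: "nat \<Rightarrow> nat \<Rightarrow> real ^ 'n::finite \<Rightarrow> real"
  assumes bases: "harmonic_bases Z Y"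
begin

text \<open>Membership in \<open>spherical_harmonics\<close> constrains Y only on the sphere;
  arguments about polynomials and solid balls need a harmonic polynomial with the same values
  there.\<close>

definition Yext :: "nat \<Rightarrow> nat \<Rightarrow> real ^ 'n \<Rightarrow> real" where
  "Yext l k = (SOME p. p \<in> harmonic_polys l \<and> (\<forall>x. norm x = 1 \<longrightarrow> Y l k x = p x))"

lemma Yext:
  assumes "k \<in> {1..Z l}"
  shows "Yext l k \<in> harmonic_polys l" "norm x = 1 \<Longrightarrow> Yext l k x = Y l k x"
proof -
  have "Y l k \<in> spherical_harmonics l"
    using bases assms by (auto simp: harmonic_bases_def)
  then have "\<exists>p. p \<in> harmonic_polys l \<and> (\<forall>x. norm x = 1 \<longrightarrow> Y l k x = p x)"
    unfolding spherical_harmonics_def harmonic_polys_def mem_Collect_eq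
    by (metis (no_types, lifting) ext mem_sphere_0)
  from someI_ex[OF this] show "Yext l k \<in> harmonic_polys l" "norm x = 1 \<Longrightarrow> Yext l k x = Y l k x"
    unfolding Yext_def by auto
qed

lemma continuous_on_Y:
  assumes "k \<in> {1..Z l}"
  shows "continuous_on (sphere 0 1) (Y l k)"
proof -
  have "continuous_on (sphere 0 1) (Yext l k)"
    by (rule continuous_on_homogeneous_polys[OF harmonic_polys_homogeneous[OF Yext(1)[OF assms]]])
  then show ?thesis by (rule continuous_on_eq) (use Yext(2)[OF assms] in auto)
qed

text \<open>\<open>harmonic_bases\<close> speaks of one degree at a time; between different degrees
  \<open>harmonic_polys_orthogonal\<close> is needed.\<close>

lemma Y_orthonormal:
  assumes j: "j \<in> {1..Z l}" and k: "k \<in> {1..Z m}"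
  shows "sphere_integral (\<lambda>x. Y l j x * Y m k x) = (if l = m \<and> j = k then 1 else 0)"
proof (cases "l = m")
  case True
  then show ?thesis using bases j k by (auto simp: harmonic_bases_def)
next
  case False
  have "sphere_integral (\<lambda>x. Y l j x * Y m k x) = sphere_integral (\<lambda>x. Yext l j x * Yext m k x)"
    by (rule sphere_integral_cong) (simp add: Yext(2)[OF j] Yext(2)[OF k])
  also have "\<dots> = 0" by (rule harmonic_polys_orthogonal[OF Yext(1)[OF j] Yext(1)[OF k] False])
  finally show ?thesis using False by simp
qed

definition coeff :: "(real ^ 'n \<Rightarrow> real) \<Rightarrow> nat \<Rightarrow> nat \<Rightarrow> real" where
  "coeff f l k = sphere_integral (\<lambda>x. f x * Y l k x)"

definition expansion :: "nat \<Rightarrow> (nat \<Rightarrow> nat \<Rightarrow> real) \<Rightarrow> real ^ 'n \<Rightarrow> real" where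
  "expansion L c x = (\<Sum>l\<le>L. \<Sum>k = 1..Z l. c l k * Y l k x)"

lemma continuous_on_expansion: "continuous_on (sphere 0 1) (expansion L c)"
  unfolding expansion_def[abs_def] by (intro continuous_intros continuous_on_Y)

lemma integral_expansion_mult:
  assumes f: "continuous_on (sphere 0 1) f"
  shows "sphere_integral (\<lambda>x. f x * expansion L c x) = (\<Sum>l\<le>L. \<Sum>k = 1..Z l. c l k * coeff f l k)"
proof -
  have "(\<lambda>x. f x * expansion L c x) = (\<lambda>x. \<Sum>l\<le>L. \<Sum>k = 1..Z l. c l k * (f x * Y l k x))"
    by (simp only: expansion_def sum_distrib_left mult.left_commute)
  then have "sphere_integral (\<lambda>x. f x * expansion L c x) =
      sphere_integral (\<lambda>x. \<Sum>l\<le>L. \<Sum>k = 1..Z l. c l k * (f x * Y l k x))" by simp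
  also have "\<dots> = (\<Sum>l\<le>L. sphere_integral (\<lambda>x. \<Sum>k = 1..Z l. c l k * (f x * Y l k x)))"
    by (rule sphere_integral_sum) (intro continuous_intros f continuous_on_Y)
  also have "\<dots> = (\<Sum>l\<le>L. \<Sum>k = 1..Z l. sphere_integral (\<lambda>x. c l k * (f x * Y l k x)))"
    by (intro sum.cong refl sphere_integral_sum continuous_intros f continuous_on_Y)
  finally show ?thesis by (simp add: coeff_def)
qed

lemma coeff_expansion:
  assumes k: "k \<in> {1..Z l}"
  shows "coeff (expansion L c) l k = (if l \<le> L then c l k else 0)"
proof -
  have "coeff (expansion L c) l k = sphere_integral (\<lambda>x. Y l k x * expansion L c x)"
    unfolding coeff_def by (simp add: mult.commute)
  also have "\<dots> = (\<Sum>m\<le>L. \<Sum>j = 1..Z m. c m j * coeff (Y l k) m j)"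
    by (rule integral_expansion_mult[OF continuous_on_Y[OF k]])
  also have "\<dots> = (\<Sum>m\<le>L. \<Sum>j = 1..Z m. if m = l \<and> j = k then c l k else 0)"
    by (intro sum.cong refl) (auto simp: coeff_def Y_orthonormal[OF k])
  also have "\<dots> = (\<Sum>m\<le>L. if m = l then c l k else 0)"
  proof (intro sum.cong refl)
    fix m
    show "(\<Sum>j = 1..Z m. if m = l \<and> j = k then c l k else 0) = (if m = l then c l k else 0)"
      using k by (cases "m = l") simp_all
  qed
  also have "\<dots> = (if l \<le> L then c l k else 0)" by simp
  finally show ?thesis .
qed

lemma integral_expansion_square:
  "sphere_integral (\<lambda>x. (expansion L c x)\<^sup>2) = (\<Sum>l\<le>L. \<Sum>k = 1..Z l. (c l k)\<^sup>2)"
  unfolding power2_eq_square integral_expansion_mult[OF continuous_on_expansion]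
  by (intro sum.cong refl) (simp add: coeff_expansion)

text \<open>The harmonic decomposition together with spanning in each degree gives some expansion;
  orthonormality then identifies its coefficients.\<close>

lemma polys_upto_expansion:
  assumes p: "p \<in> polys_upto L" and x: "norm x = 1"
  shows "p x = expansion L (coeff p) x"
proof -
  obtain g where g: "\<And>l. g l \<in> harmonic_polys l" "\<And>x. norm x = 1 \<Longrightarrow> p x = (\<Sum>l\<le>L. g l x)"
    using polys_upto_harmonic_decomposition[OF p] by (metis mem_sphere_0)
  have "\<exists>c. \<forall>x \<in> sphere 0 1. g l x = (\<Sum>k = 1..Z l. c k * Y l k x)" for l
  proof -
    have "g l \<in> spherical_harmonics l"
      using g(1)[of l] unfolding spherical_harmonics_def harmonic_polys_def mem_Collect_eq
      by (intro bexI[of _ "g l"]) auto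
    then show ?thesis using bases by (auto simp: harmonic_bases_def)
  qed
  then obtain c where c: "\<And>l x. norm x = 1 \<Longrightarrow> g l x = (\<Sum>k = 1..Z l. c l k * Y l k x)"
    by (metis mem_sphere_0)
  have eq: "p x = expansion L c x" if "norm x = 1" for x
    using that by (simp add: g(2) c expansion_def)
  have "coeff p l k = c l k" if "l \<le> L" "k \<in> {1..Z l}" for l k
  proof -
    have "coeff p l k = coeff (expansion L c) l k"
      unfolding coeff_def by (rule sphere_integral_cong) (simp add: eq)
    then show ?thesis using that by (simp add: coeff_expansion)
  qed
  then show ?thesis unfolding eq[OF x] expansion_def by (intro sum.cong refl) auto
qed

text \<open>Duality: take the sums s over X as coefficients of a harmonic polynomial P. Then S is
  both the squared norm of P and the sum of P over X, so Cauchy-Schwarz and the sieve bound S^2 by a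
  multiple of \<open>card X * S\<close>, and one factor S cancels.\<close>

lemma sum_Y_square_le:
  assumes d: "0 < d" "d \<le> 1" and X: "finite X" "X \<subseteq> sphere 0 1"
    and sep: "\<And>x y. x \<in> X \<Longrightarrow> y \<in> X \<Longrightarrow> x \<noteq> y \<Longrightarrow> dist x y \<ge> 2 * d"
  shows "d ^ (CARD('n) - 1) * (\<Sum>l\<le>L. \<Sum>k = 1..Z l. (\<Sum>x\<in>X. Y l k x)\<^sup>2) \<le>
    real CARD('n) * 2 ^ CARD('n) * (1 + d) ^ (2 * L) * real (card X)"
proof -
  define s where "s = (\<lambda>l k. \<Sum>x\<in>X. Y l k x)"
  define S where "S = (\<Sum>l\<le>L. \<Sum>k = 1..Z l. (s l k)\<^sup>2)"
  define p where "p = (\<lambda>l x. \<Sum>k = 1..Z l. s l k * Yext l k x)"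
  define K where "K = real CARD('n) * 2 ^ CARD('n) * (1 + d) ^ (2 * L)"
  have p: "p l \<in> harmonic_polys l" for l
    unfolding p_def by (intro harmonic_polys_sum harmonic_polys_cmult Yext)
  have pY: "p l x = (\<Sum>k = 1..Z l. s l k * Y l k x)" if "norm x = 1" for l x
    unfolding p_def by (intro sum.cong refl) (simp add: Yext(2)[OF _ that])
  have I: "sphere_integral (\<lambda>x. (p l x)\<^sup>2) = (\<Sum>k = 1..Z l. (s l k)\<^sup>2)" for l
  proof -
    have "expansion l (\<lambda>m k. if m = l then s l k else 0) x = (\<Sum>m\<le>l. if m = l then \<Sum>k = 1..Z l. s l k * Y l k x else 0)" for x
      unfolding expansion_def by (intro sum.cong refl) auto
    then have "sphere_integral (\<lambda>x. (p l x)\<^sup>2) = sphere_integral (\<lambda>x. (expansion l (\<lambda>m k. if m = l then s l k else 0) x)\<^sup>2)"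
      by (intro sphere_integral_cong) (simp add: pY)
    also have "\<dots> = (\<Sum>m\<le>l. \<Sum>k = 1..Z m. (if m = l then s l k else 0)\<^sup>2)"
      by (rule integral_expansion_square)
    also have "\<dots> = (\<Sum>m\<le>l. if m = l then \<Sum>k = 1..Z l. (s l k)\<^sup>2 else 0)"
      by (intro sum.cong refl) auto
    finally show ?thesis by simp
  qed
  have "S = (\<Sum>x\<in>X. \<Sum>l\<le>L. p l x)"
  proof -
    have "(\<Sum>x\<in>X. \<Sum>l\<le>L. p l x) = (\<Sum>x\<in>X. \<Sum>l\<le>L. \<Sum>k = 1..Z l. s l k * Y l k x)"
      using X(2) by (intro sum.cong refl pY) auto
    also have "\<dots> = (\<Sum>l\<le>L. \<Sum>k = 1..Z l. \<Sum>x\<in>X. s l k * Y l k x)"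
      by (subst sum.swap, intro sum.cong refl, rule sum.swap)
    finally show ?thesis by (simp add: S_def s_def power2_eq_square sum_distrib_left)
  qed
  then have "S\<^sup>2 = (\<Sum>x\<in>X. 1 * (\<Sum>l\<le>L. p l x))\<^sup>2" by simp
  also have "\<dots> \<le> (\<Sum>x\<in>X. 1\<^sup>2) * (\<Sum>x\<in>X. (\<Sum>l\<le>L. p l x)\<^sup>2)"
    by (rule Cauchy_Schwarz_ineq_sum)
  finally have "d ^ (CARD('n) - 1) * S\<^sup>2 \<le> real (card X) * (d ^ (CARD('n) - 1) * (\<Sum>x\<in>X. (\<Sum>l\<le>L. p l x)\<^sup>2))"
    using d by (simp add: mult.left_commute)
  also have "\<dots> \<le> real (card X) * (K * (\<Sum>l\<le>L. sphere_integral (\<lambda>x. (p l x)\<^sup>2)))"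
    unfolding K_def by (intro mult_left_mono large_sieve[OF p d X sep]) auto
  also have "\<dots> = real (card X) * (K * S)" by (simp add: I S_def)
  finally have *: "(d ^ (CARD('n) - 1) * S) * S \<le> (K * real (card X)) * S"
    by (simp add: power2_eq_square mult_ac)
  have "S \<ge> 0" unfolding S_def by (intro sum_nonneg) auto
  then have "d ^ (CARD('n) - 1) * S \<le> K * real (card X)"
  proof (cases "S = 0")
    case True
    then show ?thesis using d by (simp add: K_def)
  next
    case False
    with \<open>S \<ge> 0\<close> * show ?thesis by (simp add: mult_le_cancel_right)
  qed
  then show ?thesis unfolding S_def s_def K_def .
qed

text \<open>With radius e / L the growth factor \<open>(1 + e / L) ^ (2 * L)\<close> is at most exp
  2, so the constant no longer depends on L.\<close>

lemma sum_Y_square_le':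
  assumes e: "0 < e" "e \<le> 1" and L: "L \<ge> 1" and X: "finite X" "X \<subseteq> sphere 0 1"
    and sep: "\<And>x y. x \<in> X \<Longrightarrow> y \<in> X \<Longrightarrow> x \<noteq> y \<Longrightarrow> dist x y \<ge> 2 * (e / real L)"
  shows "(\<Sum>l\<le>L. \<Sum>k = 1..Z l. (\<Sum>x\<in>X. Y l k x)\<^sup>2) \<le>
    real CARD('n) * 2 ^ CARD('n) * exp 2 / e ^ (CARD('n) - 1) * real L ^ (CARD('n) - 1) * real (card X)"
proof -
  let ?S = "\<Sum>l\<le>L. \<Sum>k = 1..Z l. (\<Sum>x\<in>X. Y l k x)\<^sup>2"
  have eL: "0 < e / real L" "e / real L \<le> 1" using e L by (auto simp: divide_le_eq)
  have "(1 + e / real L) ^ (2 * L) \<le> exp (e / real L) ^ (2 * L)"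
    using eL by (intro power_mono) auto
  also have "\<dots> = exp (2 * e)"
    using L by (simp add: exp_of_nat_mult[symmetric])
  also have "\<dots> \<le> exp 2" using e by simp
  finally have exp: "(1 + e / real L) ^ (2 * L) \<le> exp 2" .
  have "(e / real L) ^ (CARD('n) - 1) * ?S \<le>
      real CARD('n) * 2 ^ CARD('n) * (1 + e / real L) ^ (2 * L) * real (card X)"
    by (rule sum_Y_square_le[OF eL X sep])
  also have "\<dots> \<le> real CARD('n) * 2 ^ CARD('n) * exp 2 * real (card X)"
    by (intro mult_right_mono mult_left_mono exp) auto
  finally have "e ^ (CARD('n) - 1) / real L ^ (CARD('n) - 1) * ?S \<le> real CARD('n) * 2 ^ CARD('n) * exp 2 * real (card X)"
    by (simp add: power_divide)
  then have "?S \<le> (real CARD('n) * 2 ^ CARD('n) * exp 2 * real (card X)) / (e ^ (CARD('n) - 1) / real L ^ (CARD('n) - 1))"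
    using e L by (subst pos_le_divide_eq) (auto simp: mult.commute)
  then show ?thesis by (simp add: mult_ac)
qed

end

section \<open>Weighted sums\<close>

lemma powr_neg_step:
  fixes u a b :: real
  assumes "u > 0" "a > 0" "b > 0"
  shows "(u + a) powr (- b - 1) * (a * b) \<le> u powr (- b) - (u + a) powr (- b)"
proof -
  have "\<exists>z>u. z < u + a \<and> (u + a) powr (- b) - u powr (- b) = ((u + a) - u) * (- b * z powr (- b - 1))"
    by (rule MVT2) (use assms in \<open>auto intro!: derivative_eq_intros\<close>)
  then obtain z where z: "u < z" "z < u + a" "(u + a) powr (- b) - u powr (- b) = a * (- b * z powr (- b - 1))"
    by auto
  have "(u + a) powr (- b - 1) \<le> z powr (- b - 1)"
    using z assms by (intro powr_mono2') auto
  then have "(u + a) powr (- b - 1) * (a * b) \<le> z powr (- b - 1) * (a * b)"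
    using assms by (intro mult_right_mono) auto
  then show ?thesis using z(3) by (simp add: algebra_simps)
qed

text \<open>Comparison with the antiderivative of x^(-b-1), telescoped by
  \<open>powr_neg_step\<close>. The first term stays apart, because the comparison covers the points
  from \<open>u + a\<close> on. The application has b = 2\<gamma> - 1, positive exactly because
  \<gamma> > 1/2.\<close>

lemma sum_powr_le:
  fixes u a b :: real
  assumes "u > 0" "a > 0" "b > 0"
  shows "(\<Sum>j<J. (u + real j * a) powr (- b - 1)) \<le> u powr (- b - 1) + u powr (- b) / (a * b)"
proof -
  have "(\<Sum>j<J. (u + real (Suc j) * a) powr (- b - 1)) * (a * b) \<le> u powr (- b) - (u + real J * a) powr (- b)" for J
  proof (induction J)
    case (Suc J)
    have "(u + real (Suc J) * a) powr (- b - 1) * (a * b) \<le>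
        (u + real J * a) powr (- b) - (u + real (Suc J) * a) powr (- b)"
      using powr_neg_step[of "u + real J * a" a b] assms by (simp add: algebra_simps add_pos_nonneg)
    then show ?case using Suc.IH by (simp add: distrib_right del: of_nat_Suc)
  qed simp
  then have *: "(\<Sum>j<J. (u + real (Suc j) * a) powr (- b - 1)) * (a * b) \<le> u powr (- b)" for J
    by (rule order_trans) simp
  have ab: "a * b > 0" using assms by simp
  show ?thesis
  proof (cases J)
    case 0
    then show ?thesis using ab by simp
  next
    case (Suc I)
    have "(\<Sum>j<I. (u + real (Suc j) * a) powr (- b - 1)) \<le> u powr (- b) / (a * b)"
      using *[of I] ab by (simp add: pos_le_divide_eq)
    then show ?thesis unfolding Suc sum.lessThan_Suc_shift by simp
  qed
qed

lemma sobolev_weight_ge: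
  assumes "d \<ge> 2" "\<gamma> > 1 / 2" "1 \<le> m" "m \<le> l"
  shows "real m ^ d * ln (3 + (real m)\<^sup>2) powr (2 * \<gamma>) \<le> sobolev_weight d \<gamma> l"
proof -
  have "(real m)\<^sup>2 \<le> (real l)\<^sup>2" using assms by (intro power_mono) auto
  also have "(real l)\<^sup>2 \<le> laplace_eigenvalue d l"
    unfolding laplace_eigenvalue_def power2_eq_square using assms by (intro mult_left_mono) auto
  finally have le: "(real m)\<^sup>2 \<le> laplace_eigenvalue d l" .
  have "real m ^ d = real m powr real d"
    using powr_realpow[of "real m" d] assms by simp
  also have "\<dots> = (real m powr 2) powr (real d / 2)"
    by (simp only: powr_powr) simp
  also have "real m powr 2 = (real m)\<^sup>2" using assms by (simp add: powr_numeral)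
  also have "(real m)\<^sup>2 powr (real d / 2) \<le> (1 + laplace_eigenvalue d l) powr (real d / 2)"
    using le by (intro powr_mono2) auto
  finally have 1: "real m ^ d \<le> (1 + laplace_eigenvalue d l) powr (real d / 2)" .
  have 2: "ln (3 + (real m)\<^sup>2) powr (2 * \<gamma>) \<le> ln (3 + laplace_eigenvalue d l) powr (2 * \<gamma>)"
    using le assms by (intro powr_mono2 ln_mono) (auto simp: add_pos_nonneg)
  show ?thesis unfolding sobolev_weight_def by (intro mult_mono 1 2) auto
qed

lemma sobolev_weight_pos: "d \<ge> 2 \<Longrightarrow> sobolev_weight d \<gamma> l > 0"
proof -
  assume "d \<ge> 2"
  then have "laplace_eigenvalue d l \<ge> 0" by (simp add: laplace_eigenvalue_def)
  then show ?thesis unfolding sobolev_weight_def by (intro mult_pos_pos) auto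
qed

text \<open>\<open>2 ^ d\<close> is the price of bounding a block by the partial sum up to its upper
  end; the bracket is \<open>sum_powr_le\<close> with step ln 2 and b = 2\<gamma> - 1, after the
  single first term has been absorbed.\<close>

definition tail_const :: "nat \<Rightarrow> real \<Rightarrow> real" where
  "tail_const d \<gamma> = 2 ^ d * (1 / ln 2 + 1 / (ln 2 * (2 * \<gamma> - 1)))"

lemma tail_const_pos: "\<gamma> > 1 / 2 \<Longrightarrow> tail_const d \<gamma> > 0"
  unfolding tail_const_def by (intro mult_pos_pos add_pos_pos divide_pos_pos) auto

text \<open>Stated for general B because it is used twice: for the squared basis values at one
  point, giving convergence of expansions, and for the energies of the design, giving the
  error.\<close>

lemma weighted_tail_bound:
  fixes B :: "nat \<Rightarrow> real"
  assumes d: "d \<ge> 2" and \<gamma>: "\<gamma> > 1 / 2" and t: "t \<ge> 1" and B: "\<And>l. B l \<ge> 0"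
    and le: "\<And>L. L \<ge> t \<Longrightarrow> (\<Sum>l\<le>L. B l) \<le> K * real L ^ d"
  shows "(\<Sum>l\<in>{t<..T}. B l / sobolev_weight d \<gamma> l) \<le> tail_const d \<gamma> * K * ln (real t + 1) powr (1 - 2 * \<gamma>)"
proof -
  define \<tau> where "\<tau> = ln (real t + 1)"
  define b where "b = 2 * \<gamma> - 1"
  have b: "b > 0" using \<gamma> by (simp add: b_def)
  have \<tau>: "\<tau> \<ge> ln 2" using t by (simp add: \<tau>_def)
  have \<tau>0: "\<tau> > 0" using \<tau> ln_gt_zero[of 2] by linarith
  \<comment> \<open>The sign of K follows from the assumed bound at \<open>L = t\<close>.\<close>
  have K: "K \<ge> 0"
  proof -
    have "0 \<le> (\<Sum>l\<le>t. B l)" by (intro sum_nonneg B)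
    also have "\<dots> \<le> K * real t ^ d" by (rule le) simp
    finally have "0 \<le> K * real t ^ d" .
    moreover have "real t ^ d > 0" using t by simp
    ultimately show ?thesis by (simp add: zero_le_mult_iff)
  qed
  have w: "sobolev_weight d \<gamma> l > 0" for l by (rule sobolev_weight_pos[OF d])
  have block: "(\<Sum>l\<in>{m<..2 * m}. B l / sobolev_weight d \<gamma> l) \<le> 2 ^ d * K * (\<tau> + real j * ln 2) powr (- b - 1)"
    if m: "m = 2 ^ j * t" for m j
  proof -
    have m1: "m \<ge> 1" "m \<ge> t" using m t by auto
    define v where "v = real m ^ d * ln (3 + (real m)\<^sup>2) powr (2 * \<gamma>)"
    have ln_pos: "ln (3 + (real m)\<^sup>2) > 0" by (intro ln_gt_zero) (simp add: add_pos_nonneg add_strict_increasing)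
    have v: "v > 0" using m1 ln_pos by (simp add: v_def)
    have "(\<Sum>l\<in>{m<..2 * m}. B l / sobolev_weight d \<gamma> l) \<le> (\<Sum>l\<in>{m<..2 * m}. B l / v)"
    proof (intro sum_mono)
      fix l assume "l \<in> {m<..2 * m}"
      then have "v \<le> sobolev_weight d \<gamma> l"
        unfolding v_def using m1 by (intro sobolev_weight_ge d \<gamma>) auto
      then show "B l / sobolev_weight d \<gamma> l \<le> B l / v" using v B by (intro divide_left_mono) auto
    qed
    also have "\<dots> = (\<Sum>l\<in>{m<..2 * m}. B l) / v" by (simp add: sum_divide_distrib)
    also have "\<dots> \<le> (\<Sum>l\<le>2 * m. B l) / v"
      using v B by (intro divide_right_mono sum_mono2) auto
    also have "\<dots> \<le> (K * real (2 * m) ^ d) / v"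
      using v m1 by (intro divide_right_mono le) auto
    also have "\<dots> = 2 ^ d * K * ln (3 + (real m)\<^sup>2) powr (- (2 * \<gamma>))"
      using m1 ln_pos by (simp add: v_def power_mult_distrib powr_minus divide_simps)
    also have "\<dots> \<le> 2 ^ d * K * (\<tau> + real j * ln 2) powr (- (2 * \<gamma>))"
    proof (intro mult_left_mono powr_mono2')
      \<comment> \<open>With 2 m <= 1 + m^2 this places the arithmetic progression \<tau> + j ln 2
        below the logarithm in the weight.\<close>
      have "(real t + 1) * 2 ^ j \<le> 2 * real m" using t m by (simp add: algebra_simps)
      also have "\<dots> \<le> 3 + (real m)\<^sup>2"
        using zero_le_power2[of "real m - 1"] by (simp add: power2_eq_square algebra_simps)
      finally have "ln ((real t + 1) * 2 ^ j) \<le> ln (3 + (real m)\<^sup>2)"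
        by (intro ln_mono) (auto simp: add_pos_nonneg)
      then show "\<tau> + real j * ln 2 \<le> ln (3 + (real m)\<^sup>2)"
        by (simp add: \<tau>_def ln_mult ln_realpow add_pos_nonneg)
    qed (use \<gamma> K \<tau>0 in \<open>auto simp: add_pos_nonneg\<close>)
    finally show ?thesis by (simp add: b_def)
  qed
  have dyadic: "(\<Sum>l\<in>{t<..2 ^ J * t}. B l / sobolev_weight d \<gamma> l) \<le>
      2 ^ d * K * (\<Sum>j<J. (\<tau> + real j * ln 2) powr (- b - 1))" for J
  proof (induction J)
    case (Suc J)
    have "{t<..2 ^ Suc J * t} = {t<..2 ^ J * t} \<union> {2 ^ J * t<..2 * (2 ^ J * t)}"
      by (simp add: ivl_disj_un mult.assoc) 
    then have "(\<Sum>l\<in>{t<..2 ^ Suc J * t}. B l / sobolev_weight d \<gamma> l) =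
        (\<Sum>l\<in>{t<..2 ^ J * t}. B l / sobolev_weight d \<gamma> l) +
        (\<Sum>l\<in>{2 ^ J * t<..2 * (2 ^ J * t)}. B l / sobolev_weight d \<gamma> l)"
      by (simp only:) (rule sum.union_disjoint, auto)
    also have "\<dots> \<le> 2 ^ d * K * (\<Sum>j<J. (\<tau> + real j * ln 2) powr (- b - 1)) +
        2 ^ d * K * (\<tau> + real J * ln 2) powr (- b - 1)"
      by (intro add_mono Suc.IH block) simp
    finally show ?case by (simp add: distrib_left)
  qed simp
  \<comment> \<open>T blocks are far more than necessary, but the sum over blocks is bounded
    independently of their number.\<close>
  have "T < 2 ^ T" by (rule less_exp)
  also have "(2 :: nat) ^ T \<le> 2 ^ T * t" using t by simp
  finally have T: "T \<le> 2 ^ T * t" by simp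
  have "(\<Sum>l\<in>{t<..T}. B l / sobolev_weight d \<gamma> l) \<le> (\<Sum>l\<in>{t<..2 ^ T * t}. B l / sobolev_weight d \<gamma> l)"
    using T B w by (intro sum_mono2) (auto intro: divide_nonneg_pos)
  also have "\<dots> \<le> 2 ^ d * K * (\<Sum>j<T. (\<tau> + real j * ln 2) powr (- b - 1))" by (rule dyadic)
  also have "\<dots> \<le> 2 ^ d * K * (\<tau> powr (- b - 1) + \<tau> powr (- b) / (ln 2 * b))"
    using K \<tau>0 b by (intro mult_left_mono sum_powr_le) auto
  \<comment> \<open>The first term is of lower order and is absorbed through \<tau> >= ln 2, that
    is, through t >= 1.\<close>
  also have "\<dots> \<le> 2 ^ d * K * (\<tau> powr (- b) / ln 2 + \<tau> powr (- b) / (ln 2 * b))"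
  proof (intro mult_left_mono add_right_mono)
    have "\<tau> powr (- b - 1) = \<tau> powr (- b) / \<tau>" using \<tau>0 by (simp add: powr_diff)
    also have "\<dots> \<le> \<tau> powr (- b) / ln 2" using \<tau> by (intro divide_left_mono) (auto intro: mult_pos_pos \<tau>0)
    finally show "\<tau> powr (- b - 1) \<le> \<tau> powr (- b) / ln 2" .
  qed (use K in auto)
  also have "\<dots> = tail_const d \<gamma> * K * ln (real t + 1) powr (1 - 2 * \<gamma>)"
    by (simp add: tail_const_def \<tau>_def b_def algebra_simps)
  finally show ?thesis .
qed

lemma sum_mult_le_weighted:
  fixes a b :: "nat \<Rightarrow> nat \<Rightarrow> real" and w :: "nat \<Rightarrow> real"
  assumes w: "\<And>l. w l > 0" and A: "finite A"
  shows "\<bar>\<Sum>l\<in>A. \<Sum>k = 1..Z l. a l k * b l k\<bar> \<le>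
    sqrt (\<Sum>l\<in>A. w l * (\<Sum>k = 1..Z l. (a l k)\<^sup>2)) * sqrt (\<Sum>l\<in>A. (\<Sum>k = 1..Z l. (b l k)\<^sup>2) / w l)"
proof -
  let ?I = "SIGMA l:A. {1..Z l}"
  have I: "finite ?I" using A by auto
  have sig: "(\<Sum>l\<in>A. \<Sum>k = 1..Z l. f l k) = (\<Sum>(l, k)\<in>?I. f l k)" for f :: "nat \<Rightarrow> nat \<Rightarrow> real"
    using A by (subst sum.Sigma) auto
  have ab: "a l k * b l k = (sqrt (w l) * a l k) * (b l k / sqrt (w l))" for l k
    using w[of l] by simp
  have "(\<Sum>l\<in>A. \<Sum>k = 1..Z l. a l k * b l k) = (\<Sum>(l, k)\<in>?I. (sqrt (w l) * a l k) * (b l k / sqrt (w l)))"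
    unfolding sig ab ..
  then have "(\<Sum>l\<in>A. \<Sum>k = 1..Z l. a l k * b l k)\<^sup>2 =
      (\<Sum>i\<in>?I. (sqrt (w (fst i)) * a (fst i) (snd i)) * (b (fst i) (snd i) / sqrt (w (fst i))))\<^sup>2"
    by (simp add: case_prod_unfold)
  also have "\<dots> \<le> (\<Sum>i\<in>?I. (sqrt (w (fst i)) * a (fst i) (snd i))\<^sup>2) * (\<Sum>i\<in>?I. (b (fst i) (snd i) / sqrt (w (fst i)))\<^sup>2)"
    by (rule Cauchy_Schwarz_ineq_sum)
  also have "(\<Sum>i\<in>?I. (sqrt (w (fst i)) * a (fst i) (snd i))\<^sup>2) = (\<Sum>l\<in>A. w l * (\<Sum>k = 1..Z l. (a l k)\<^sup>2))"
    unfolding sum_distrib_left sig using w by (simp add: power_mult_distrib case_prod_unfold less_imp_le)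
  also have "(\<Sum>i\<in>?I. (b (fst i) (snd i) / sqrt (w (fst i)))\<^sup>2) = (\<Sum>l\<in>A. (\<Sum>k = 1..Z l. (b l k)\<^sup>2) / w l)"
    unfolding sum_divide_distrib sig using w by (simp add: power_divide case_prod_unfold less_imp_le)
  finally have "sqrt ((\<Sum>l\<in>A. \<Sum>k = 1..Z l. a l k * b l k)\<^sup>2) \<le>
    sqrt ((\<Sum>l\<in>A. w l * (\<Sum>k = 1..Z l. (a l k)\<^sup>2)) * (\<Sum>l\<in>A. (\<Sum>k = 1..Z l. (b l k)\<^sup>2) / w l))"
    by (rule real_sqrt_le_mono)
  then show ?thesis by (simp only: real_sqrt_abs real_sqrt_mult)
qed

section \<open>The upper bound\<close>

context harmonic_basis
begin

lemma sobolev_term_eq: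
  "sobolev_term d \<gamma> Z Y f l = sobolev_weight d \<gamma> l * (\<Sum>k = 1..Z l. (coeff f l k)\<^sup>2)"
  by (simp add: sobolev_term_def coeff_def)

lemma sum_sobolev_term_le:
  assumes d: "d \<ge> 2" and f: "f \<in> sobolev_space d \<gamma> Z Y" and A: "finite A"
  shows "sqrt (\<Sum>l\<in>A. sobolev_weight d \<gamma> l * (\<Sum>k = 1..Z l. (coeff f l k)\<^sup>2)) \<le> sobolev_norm d \<gamma> Z Y f"
proof -
  have "(\<Sum>l\<in>A. sobolev_term d \<gamma> Z Y f l) \<le> (\<Sum>l. sobolev_term d \<gamma> Z Y f l)"
  proof (rule sum_le_suminf)
    show "summable (sobolev_term d \<gamma> Z Y f)" using f by (simp add: sobolev_space_def)
    show "0 \<le> sobolev_term d \<gamma> Z Y f l" for l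
      unfolding sobolev_term_eq using sobolev_weight_pos[OF d, of \<gamma> l] by (intro mult_nonneg_nonneg sum_nonneg) auto
  qed (rule A)
  then show ?thesis by (simp add: sobolev_norm_def sobolev_term_eq)
qed

definition point_const :: real where
  "point_const = real CARD('n) * 2 ^ CARD('n) * exp 2"

text \<open>A single point satisfies every separation condition, so the sieve bound with e = 1
  yields what the addition theorem would otherwise give.\<close>

lemma sum_Y_point_le:
  assumes "norm x = 1" "L \<ge> 1"
  shows "(\<Sum>l\<le>L. \<Sum>k = 1..Z l. (Y l k x)\<^sup>2) \<le> point_const * real L ^ (CARD('n) - 1)"
  using sum_Y_square_le'[of 1 L "{x}"] assms by (simp add: point_const_def)

text \<open>A quantitative form of the embedding into the continuous functions: the bound is uniform
  in x and T, and it tends to zero in M because 1 - 2\<gamma> is negative.\<close>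

lemma expansion_tail:
  assumes d: "d \<ge> 2" "CARD('n) = d + 1" and \<gamma>: "\<gamma> > 1 / 2" and f: "f \<in> sobolev_space d \<gamma> Z Y"
    and x: "norm x = 1" and M: "1 \<le> M" "M \<le> T"
  shows "\<bar>expansion T (coeff f) x - expansion M (coeff f) x\<bar> \<le>
    sobolev_norm d \<gamma> Z Y f * sqrt (tail_const d \<gamma> * point_const * ln (real M + 1) powr (1 - 2 * \<gamma>))"
proof -
  have "{..T} = {..M} \<union> {M<..T}" using M by auto
  then have "expansion T (coeff f) x = (\<Sum>l\<in>{..M} \<union> {M<..T}. \<Sum>k = 1..Z l. coeff f l k * Y l k x)"
    by (simp add: expansion_def)
  also have "\<dots> = expansion M (coeff f) x + (\<Sum>l\<in>{M<..T}. \<Sum>k = 1..Z l. coeff f l k * Y l k x)"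
    unfolding expansion_def by (rule sum.union_disjoint) auto
  finally have "\<bar>expansion T (coeff f) x - expansion M (coeff f) x\<bar> = \<bar>\<Sum>l\<in>{M<..T}. \<Sum>k = 1..Z l. coeff f l k * Y l k x\<bar>"
    by simp
  also have "\<dots> \<le> sqrt (\<Sum>l\<in>{M<..T}. sobolev_weight d \<gamma> l * (\<Sum>k = 1..Z l. (coeff f l k)\<^sup>2)) *
      sqrt (\<Sum>l\<in>{M<..T}. (\<Sum>k = 1..Z l. (Y l k x)\<^sup>2) / sobolev_weight d \<gamma> l)"
    by (rule sum_mult_le_weighted[OF sobolev_weight_pos[OF d(1)]]) simp
  also have "\<dots> \<le> sobolev_norm d \<gamma> Z Y f * sqrt (tail_const d \<gamma> * point_const * ln (real M + 1) powr (1 - 2 * \<gamma>))"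
  proof (intro mult_mono sum_sobolev_term_le d f real_sqrt_le_mono)
    show "(\<Sum>l\<in>{M<..T}. (\<Sum>k = 1..Z l. (Y l k x)\<^sup>2) / sobolev_weight d \<gamma> l) \<le>
        tail_const d \<gamma> * point_const * ln (real M + 1) powr (1 - 2 * \<gamma>)"
    proof (rule weighted_tail_bound[OF d(1) \<gamma> M(1)])
      fix L assume "M \<le> L"
      then show "(\<Sum>l\<le>L. \<Sum>k = 1..Z l. (Y l k x)\<^sup>2) \<le> point_const * real L ^ d"
        using sum_Y_point_le[OF x, of L] d M by simp
    qed (intro sum_nonneg, simp)
  next
    show "0 \<le> sqrt (\<Sum>l\<in>{M<..T}. (\<Sum>k = 1..Z l. (Y l k x)\<^sup>2) / sobolev_weight d \<gamma> l)"
      by (intro real_sqrt_ge_zero sum_nonneg divide_nonneg_pos sobolev_weight_pos[OF d(1)]) auto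
    have "0 \<le> sqrt (\<Sum>l\<in>{}. sobolev_weight d \<gamma> l * (\<Sum>k = 1..Z l. (coeff f l k)\<^sup>2))" by simp
    also have "\<dots> \<le> sobolev_norm d \<gamma> Z Y f" by (rule sum_sobolev_term_le[OF d(1) f]) simp
    finally show "0 \<le> sobolev_norm d \<gamma> Z Y f" .
  qed auto
  finally show ?thesis .
qed

lemma expansion_tail_tendsto:
  assumes "\<gamma> > 1 / 2"
  shows "(\<lambda>M. c * sqrt (a * ln (real M + 1) powr (1 - 2 * \<gamma>))) \<longlonglongrightarrow> 0"
proof -
  have "filterlim (\<lambda>M :: nat. ln (1 + real M)) at_top sequentially"
    by (intro filterlim_compose[OF ln_at_top] filterlim_tendsto_add_at_top[OF tendsto_const]
        filterlim_real_sequentially)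
  then have "filterlim (\<lambda>M :: nat. ln (real M + 1)) at_top sequentially"
    by (simp only: add.commute)
  then have "(\<lambda>M :: nat. ln (real M + 1) powr (1 - 2 * \<gamma>)) \<longlonglongrightarrow> 0"
    by (intro tendsto_neg_powr) (use assms in auto)
  then have "(\<lambda>M :: nat. c * sqrt (a * ln (real M + 1) powr (1 - 2 * \<gamma>))) \<longlonglongrightarrow> c * sqrt (a * 0)"
    by (intro tendsto_intros)
  then show ?thesis by simp
qed

text \<open>The partial sums converge uniformly to some continuous g, which must still be identified
  with f. The difference u = f - g has no harmonic components; approximating u by polynomials makes
  the integral of u^2 arbitrarily small, so u vanishes.\<close>

lemma expansion_tendsto:
  assumes d: "d \<ge> 2" "CARD('n) = d + 1" and \<gamma>: "\<gamma> > 1 / 2" and f: "f \<in> sobolev_space d \<gamma> Z Y"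
    and x: "norm x = 1"
  shows "(\<lambda>M. expansion M (coeff f) x) \<longlonglongrightarrow> f x"
proof -
  let ?S = "sphere (0 :: real ^ 'n) 1"
  define s where "s = (\<lambda>M. expansion M (coeff f))"
  define e where "e = (\<lambda>M. sobolev_norm d \<gamma> Z Y f * sqrt ((tail_const d \<gamma> * point_const) * ln (real M + 1) powr (1 - 2 * \<gamma>)))"
  have e0: "e \<longlonglongrightarrow> 0" unfolding e_def by (rule expansion_tail_tendsto[OF \<gamma>])
  have tail: "\<bar>s T x - s M x\<bar> \<le> e M" if "norm x = 1" "1 \<le> M" "M \<le> T" for x M T
    unfolding s_def e_def by (rule expansion_tail[OF d \<gamma> f that])
  define g where "g = (\<lambda>x. lim (\<lambda>M. s M x))"
  have lim: "(\<lambda>M. s M x) \<longlonglongrightarrow> g x" if x: "norm x = 1" for x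
  proof -
    have "Cauchy (\<lambda>M. s M x)"
      unfolding Cauchy_altdef2
    proof (intro allI impI)
      fix r :: real assume "r > 0"
      then have "eventually (\<lambda>M. e M < r) sequentially" by (rule order_tendstoD(2)[OF e0])
      then obtain M where "e M < r" "M \<ge> 1"
        unfolding eventually_sequentially by (metis nat_le_linear)
      then show "\<exists>N. \<forall>n\<ge>N. dist (s n x) (s N x) < r"
        using tail[OF x] by (intro exI[of _ M]) (fastforce simp: dist_real_def)
    qed
    then show ?thesis unfolding g_def by (simp add: Cauchy_convergent_iff convergent_LIMSEQ_iff)
  qed
  have g: "\<bar>g x - s M x\<bar> \<le> e M" if x: "norm x = 1" and M: "1 \<le> M" for x M
  proof (rule LIMSEQ_le_const2)
    show "(\<lambda>T. \<bar>s T x - s M x\<bar>) \<longlonglongrightarrow> \<bar>g x - s M x\<bar>"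
      by (intro tendsto_intros lim x)
    show "\<exists>N. \<forall>n\<ge>N. \<bar>s n x - s M x\<bar> \<le> e M" using tail[OF x M] by blast
  qed
  have cs: "continuous_on ?S (s M)" for M unfolding s_def by (rule continuous_on_expansion)
  have cf: "continuous_on ?S f" using f by (simp add: sobolev_space_def)
  have cg: "continuous_on ?S g"
  proof (rule uniform_limit_theorem)
    show "uniform_limit ?S s g sequentially"
    proof (rule uniform_limitI)
      fix r :: real assume "r > 0"
      then have "eventually (\<lambda>M. e M < r) sequentially" by (rule order_tendstoD(2)[OF e0])
      with eventually_ge_at_top[of 1] show "eventually (\<lambda>M. \<forall>x\<in>?S. dist (s M x) (g x) < r) sequentially"
      proof eventually_elim
        case (elim M)
        show ?case
        proof
          fix x :: "real ^ 'n" assume "x \<in> ?S"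
          then show "dist (s M x) (g x) < r"
            using g[of x M] elim by (simp add: dist_real_def abs_minus_commute)
        qed
      qed
    qed
  qed (simp_all add: cs)
  define u where "u = (\<lambda>x. f x - g x)"
  have cu: "continuous_on ?S u" unfolding u_def by (intro continuous_intros cf cg)
  have "bounded (u ` ?S)" by (intro compact_imp_bounded compact_continuous_image cu compact_sphere)
  then obtain U where "\<forall>x\<in>?S. norm (u x) \<le> U" by (auto simp: bounded_iff simp del: mem_sphere mem_sphere_0)
  then have U: "\<bar>u x\<bar> \<le> U" if "norm x = 1" for x using that by simp
  have U0: "U \<ge> 0" using U[OF x] by linarith
  let ?I = "sphere_integral (\<lambda>x. (u x)\<^sup>2)"
  have small: "?I \<le> \<epsilon> * (2 * U + 1)" if eps: "0 < \<epsilon>" "\<epsilon> \<le> 1" for \<epsilon>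
  proof -
    obtain p where p: "real_polynomial_function p" "\<And>x. x \<in> ?S \<Longrightarrow> \<bar>u x - p x\<bar> < \<epsilon>"
      using Stone_Weierstrass_real_polynomial_function[OF compact_sphere cu eps(1)] by metis
    obtain t where t: "p \<in> polys_upto t" using real_polynomial_function_imp_polys_upto[OF p(1)] by blast
    have cp: "continuous_on ?S p" by (rule continuous_on_polys_upto[OF t])
    have up: "\<bar>u x - p x\<bar> \<le> \<epsilon>" if "norm x = 1" for x using p(2)[of x] that by simp
    have "eventually (\<lambda>M. e M < \<epsilon>) sequentially" by (rule order_tendstoD(2)[OF e0 eps(1)])
    then obtain M0 where "\<And>M. M \<ge> M0 \<Longrightarrow> e M < \<epsilon>" unfolding eventually_sequentially by blast
    then have "e (M0 + t + 1) < \<epsilon>" by simp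
    moreover define M where "M = M0 + t + 1"
    ultimately have M: "e M < \<epsilon>" "M \<ge> 1" "M \<ge> t" by auto
    \<comment> \<open>Since M >= t, the partial sum has the same coefficients as f in all degrees
      occurring in p, so their difference is orthogonal to p.\<close>
    have "sphere_integral (\<lambda>x. (f x - s M x) * p x) = sphere_integral (\<lambda>x. (f x - s M x) * expansion t (coeff p) x)"
      by (rule sphere_integral_cong) (simp add: polys_upto_expansion[OF t, symmetric])
    also have "\<dots> = (\<Sum>l\<le>t. \<Sum>k = 1..Z l. coeff p l k * coeff (\<lambda>x. f x - s M x) l k)"
      by (rule integral_expansion_mult) (intro continuous_intros cf cs)
    also have "\<dots> = (\<Sum>l\<le>t. \<Sum>k = 1..Z l. coeff p l k * 0)"
    proof (intro sum.cong refl arg_cong2[of _ _ _ _ times])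
      fix l k assume lk: "l \<in> {..t}" "k \<in> {1..Z l}"
      have "coeff (\<lambda>x. f x - s M x) l k = coeff f l k - coeff (s M) l k"
        unfolding coeff_def left_diff_distrib
        by (rule sphere_integral_diff) (intro continuous_intros cf cs continuous_on_Y lk)+
      also have "\<dots> = 0" using coeff_expansion[OF lk(2), of M "coeff f"] lk M by (simp add: s_def)
      finally show "coeff (\<lambda>x. f x - s M x) l k = 0" .
    qed
    finally have orth: "sphere_integral (\<lambda>x. (f x - s M x) * p x) = 0" by simp
    \<comment> \<open>The summands are small for three reasons: p approximates u, the middle term is
      orthogonal, and the last contains the uniform tail.\<close>
    have "?I = sphere_integral (\<lambda>x. u x * (u x - p x) + ((f x - s M x) * p x + (s M x - g x) * p x))"
      by (rule sphere_integral_cong) (simp add: u_def power2_eq_square algebra_simps)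
    also have "\<dots> = sphere_integral (\<lambda>x. u x * (u x - p x)) +
        (sphere_integral (\<lambda>x. (f x - s M x) * p x) + sphere_integral (\<lambda>x. (s M x - g x) * p x))"
      by (subst sphere_integral_add, (intro continuous_intros cu cp cf cs cg)+, subst sphere_integral_add)
        (auto intro!: continuous_intros cu cp cf cs cg)
    also have "\<dots> \<le> U * \<epsilon> + (0 + \<epsilon> * (U + \<epsilon>))"
    proof (intro add_mono)
      have "\<bar>sphere_integral (\<lambda>x. u x * (u x - p x))\<bar> \<le> U * \<epsilon>"
        by (rule sphere_integral_abs_le)
          (use U U0 up in \<open>auto intro!: continuous_intros cu cp mult_mono simp: abs_mult\<close>)
      then show "sphere_integral (\<lambda>x. u x * (u x - p x)) \<le> U * \<epsilon>" by linarith
      have pb: "\<bar>p x\<bar> \<le> U + \<epsilon>" if "norm x = 1" for x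
        using U[OF that] up[OF that] by linarith
      have sg: "\<bar>s M x - g x\<bar> \<le> \<epsilon>" if "norm x = 1" for x
        using g[OF that M(2)] M(1) by (simp add: abs_minus_commute)
      have "\<bar>sphere_integral (\<lambda>x. (s M x - g x) * p x)\<bar> \<le> \<epsilon> * (U + \<epsilon>)"
        by (rule sphere_integral_abs_le)
          (use pb sg eps in \<open>auto intro!: continuous_intros cs cg cp mult_mono simp: abs_mult\<close>)
      then show "sphere_integral (\<lambda>x. (s M x - g x) * p x) \<le> \<epsilon> * (U + \<epsilon>)" by linarith
    qed (simp add: orth)
    also have "\<dots> = \<epsilon> * (2 * U + \<epsilon>)" by (simp add: algebra_simps)
    also have "\<dots> \<le> \<epsilon> * (2 * U + 1)" using eps by (intro mult_left_mono) auto
    finally show ?thesis .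
  qed
  have "?I = 0"
  proof (rule antisym)
    show "?I \<ge> 0" by (simp add: sphere_integral_def)
    show "?I \<le> 0"
    proof (rule ccontr)
      assume "\<not> ?I \<le> 0"
      then have I: "?I > 0" by simp
      \<comment> \<open>Chosen so that \<open>small\<close> gives
        \<open>?I \<le> ?I / 2\<close>.\<close>
      define \<epsilon> where "\<epsilon> = min 1 (?I / (2 * (2 * U + 1)))"
      have "0 < \<epsilon>" "\<epsilon> \<le> 1" unfolding \<epsilon>_def using I U0 by auto
      then have "?I \<le> \<epsilon> * (2 * U + 1)" by (rule small)
      also have "\<dots> \<le> ?I / (2 * (2 * U + 1)) * (2 * U + 1)"
        using U0 by (intro mult_right_mono) (auto simp: \<epsilon>_def)
      also have "\<dots> = ?I / 2" using U0 by (simp add: divide_simps)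
      finally show False using I by simp
    qed
  qed
  then have "u x = 0" by (rule sphere_integral_square_eq_0[OF cu _ x])
  then show ?thesis using lim[OF x] by (simp add: u_def s_def)
qed

text \<open>Expanding the constant 1 in degree 0 avoids determining \<open>Z 0\<close> and the sign
  of the basis function.\<close>

lemma integral_eq_zeroth_coeffs:
  assumes "continuous_on (sphere 0 1) f"
  shows "sphere_integral f = (\<Sum>k = 1..Z 0. coeff f 0 k * sphere_integral (Y 0 k))"
proof -
  have "sphere_integral f = sphere_integral (\<lambda>x. f x * expansion 0 (coeff (\<lambda>x. 1)) x)"
    by (rule sphere_integral_cong) (simp add: polys_upto_expansion[symmetric, where p = "\<lambda>x. 1"])
  then show ?thesis
    unfolding integral_expansion_mult[OF assms] by (simp add: coeff_def mult.commute)
qed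

lemma sphere_integral_Y:
  assumes k: "k \<in> {1..Z l}" and "l > 0"
  shows "sphere_integral (Y l k) = 0"
proof -
  have "sphere_integral (Y l k) = sphere_integral (Yext l k)"
    by (rule sphere_integral_cong) (simp add: Yext(2)[OF k])
  then show ?thesis using sphere_integral_harmonic[OF Yext(1)[OF k] \<open>l > 0\<close>] by simp
qed

lemma equal_weight_rule_expansion:
  "equal_weight_rule X (expansion M c) = (\<Sum>l\<le>M. \<Sum>k = 1..Z l. c l k * equal_weight_rule X (Y l k))"
proof -
  define S where "S = (\<lambda>l k. \<Sum>x\<in>X. Y l k x)"
  have "(\<Sum>x\<in>X. expansion M c x) = (\<Sum>l\<le>M. \<Sum>k = 1..Z l. c l k * S l k)"
    unfolding expansion_def S_def sum_distrib_left by (subst sum.swap, intro sum.cong refl, rule sum.swap)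
  moreover have "equal_weight_rule X (Y l k) = S l k / real (card X)" for l k
    by (simp only: equal_weight_rule_def S_def)
  ultimately show ?thesis
    by (simp only: equal_weight_rule_def[of X "expansion M c"] sum_divide_distrib times_divide_eq_right)
qed

lemma design_Y:
  assumes "spherical_design t X" "l \<le> t" and k: "k \<in> {1..Z l}"
  shows "equal_weight_rule X (Y l k) = sphere_integral (Y l k)"
proof -
  have X: "norm x = 1" if "x \<in> X" for x using assms(1) that by (auto simp: spherical_design_def)
  have "Yext l k \<in> polys_upto t"
    by (rule homogeneous_polys_subset_polys_upto[OF harmonic_polys_homogeneous[OF Yext(1)[OF k]] assms(2)])
  then have "equal_weight_rule X (Yext l k) = sphere_integral (Yext l k)"
    using assms(1) by (simp add: spherical_design_def)
  moreover have "equal_weight_rule X (Yext l k) = equal_weight_rule X (Y l k)"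
    unfolding equal_weight_rule_def by (intro arg_cong2[of _ _ _ _ "(/)"] sum.cong refl Yext(2)[OF k] X)
  moreover have "sphere_integral (Yext l k) = sphere_integral (Y l k)"
    by (rule sphere_integral_cong) (simp add: Yext(2)[OF k])
  ultimately show ?thesis by simp
qed

text \<open>The rule is estimated on partial sums of the expansion; their convergence at the
  finitely many nodes carries the bound over to f.\<close>

lemma design_error_bound:
  assumes d: "d \<ge> 2" "CARD('n) = d + 1" and \<gamma>: "\<gamma> > 1 / 2" and f: "f \<in> sobolev_space d \<gamma> Z Y"
    and X: "spherical_design t X" "t \<ge> 1" "card X > 0" and e: "0 < e" "e \<le> 1"
    and sep: "\<And>x y. x \<in> X \<Longrightarrow> y \<in> X \<Longrightarrow> x \<noteq> y \<Longrightarrow> dist x y \<ge> 2 * (e / real t)"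
  shows "\<bar>equal_weight_rule X f - sphere_integral f\<bar> \<le> sobolev_norm d \<gamma> Z Y f *
    sqrt (tail_const d \<gamma> * (point_const / e ^ d / real (card X)) * ln (real t + 1) powr (1 - 2 * \<gamma>))"
    (is "_ \<le> ?R")
proof (rule LIMSEQ_le_const2)
  have X': "finite X" "X \<subseteq> sphere 0 1" using X by (auto simp: spherical_design_def)
  have "(\<lambda>M. equal_weight_rule X (expansion M (coeff f))) \<longlonglongrightarrow> equal_weight_rule X f"
    unfolding equal_weight_rule_def
    by (intro tendsto_intros expansion_tendsto[OF d \<gamma> f]) (use X X' in auto)
  then show "(\<lambda>M. \<bar>equal_weight_rule X (expansion M (coeff f)) - sphere_integral f\<bar>) \<longlonglongrightarrow>
      \<bar>equal_weight_rule X f - sphere_integral f\<bar>"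
    by (intro tendsto_intros)
  have "\<bar>equal_weight_rule X (expansion M (coeff f)) - sphere_integral f\<bar> \<le> ?R" if M: "M \<ge> t" for M
  proof -
    define q where "q = (\<lambda>l k. equal_weight_rule X (Y l k))"
    have cf: "continuous_on (sphere 0 1) f" using f by (simp add: sobolev_space_def)
    have sets: "{..M} = {0} \<union> ({0<..t} \<union> {t<..M})" using M by auto
    have "equal_weight_rule X (expansion M (coeff f)) = (\<Sum>l\<in>{0} \<union> ({0<..t} \<union> {t<..M}). \<Sum>k = 1..Z l. coeff f l k * q l k)"
      unfolding equal_weight_rule_expansion q_def sets ..
    also have "\<dots> = (\<Sum>l\<in>{0}. \<Sum>k = 1..Z l. coeff f l k * q l k) +
        ((\<Sum>l\<in>{0<..t}. \<Sum>k = 1..Z l. coeff f l k * q l k) + (\<Sum>l\<in>{t<..M}. \<Sum>k = 1..Z l. coeff f l k * q l k))"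
      by (subst sum.union_disjoint, simp, simp, force, subst sum.union_disjoint) auto
    also have "(\<Sum>l\<in>{0}. \<Sum>k = 1..Z l. coeff f l k * q l k) = sphere_integral f"
      unfolding integral_eq_zeroth_coeffs[OF cf] q_def using design_Y[OF X(1), of 0] by simp
    also have "(\<Sum>l\<in>{0<..t}. \<Sum>k = 1..Z l. coeff f l k * q l k) = 0"
      unfolding q_def using design_Y[OF X(1)] sphere_integral_Y by (intro sum.neutral ballI) simp
    finally have "\<bar>equal_weight_rule X (expansion M (coeff f)) - sphere_integral f\<bar> =
        \<bar>\<Sum>l\<in>{t<..M}. \<Sum>k = 1..Z l. coeff f l k * q l k\<bar>" by simp
    also have "\<dots> \<le> sqrt (\<Sum>l\<in>{t<..M}. sobolev_weight d \<gamma> l * (\<Sum>k = 1..Z l. (coeff f l k)\<^sup>2)) *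
        sqrt (\<Sum>l\<in>{t<..M}. (\<Sum>k = 1..Z l. (q l k)\<^sup>2) / sobolev_weight d \<gamma> l)"
      by (rule sum_mult_le_weighted[OF sobolev_weight_pos[OF d(1)]]) simp
    also have "\<dots> \<le> ?R"
    proof (intro mult_mono sum_sobolev_term_le d f real_sqrt_le_mono)
      show "(\<Sum>l\<in>{t<..M}. (\<Sum>k = 1..Z l. (q l k)\<^sup>2) / sobolev_weight d \<gamma> l) \<le>
          tail_const d \<gamma> * (point_const / e ^ d / real (card X)) * ln (real t + 1) powr (1 - 2 * \<gamma>)"
      proof (rule weighted_tail_bound[OF d(1) \<gamma> X(2)])
        fix L assume L: "t \<le> L"
        \<comment> \<open>Separation at scale 1/t implies separation at every finer scale 1/L, so
          the sieve applies to all L >= t with the same e.\<close>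
        have "2 * (e / real L) \<le> 2 * (e / real t)"
          using L X e by (intro mult_left_mono divide_left_mono) auto
        then have "(\<Sum>l\<le>L. \<Sum>k = 1..Z l. (\<Sum>x\<in>X. Y l k x)\<^sup>2) \<le>
            real CARD('n) * 2 ^ CARD('n) * exp 2 / e ^ (CARD('n) - 1) * real L ^ (CARD('n) - 1) * real (card X)"
          using L X by (intro sum_Y_square_le' e X') (auto intro: order_trans[OF _ sep])
        also have "\<dots> = (point_const / e ^ d) * real L ^ d * real (card X)"
          using d by (simp add: point_const_def)
        finally have "(\<Sum>l\<le>L. \<Sum>k = 1..Z l. (\<Sum>x\<in>X. Y l k x)\<^sup>2) / (real (card X))\<^sup>2 \<le>
            (point_const / e ^ d) * real L ^ d * real (card X) / (real (card X))\<^sup>2"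
          by (rule divide_right_mono) simp
        also have "\<dots> = point_const / e ^ d / real (card X) * real L ^ d"
          using X by (simp add: power2_eq_square)
        also have "(\<Sum>l\<le>L. \<Sum>k = 1..Z l. (\<Sum>x\<in>X. Y l k x)\<^sup>2) / (real (card X))\<^sup>2 =
            (\<Sum>l\<le>L. \<Sum>k = 1..Z l. (q l k)\<^sup>2)"
        proof -
          define S where "S = (\<lambda>l k. \<Sum>x\<in>X. Y l k x)"
          have "q l k = S l k / real (card X)" for l k
            by (simp only: q_def equal_weight_rule_def S_def)
          then show ?thesis
            unfolding S_def[symmetric, THEN fun_cong, THEN fun_cong] by (simp add: power_divide sum_divide_distrib)
        qed
        finally show "(\<Sum>l\<le>L. \<Sum>k = 1..Z l. (q l k)\<^sup>2) \<le> point_const / e ^ d / real (card X) * real L ^ d" .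
      qed (intro sum_nonneg, simp)
    next
      show "0 \<le> sqrt (\<Sum>l\<in>{t<..M}. (\<Sum>k = 1..Z l. (q l k)\<^sup>2) / sobolev_weight d \<gamma> l)"
        by (intro real_sqrt_ge_zero sum_nonneg divide_nonneg_pos sobolev_weight_pos[OF d(1)]) auto
      have "0 \<le> sqrt (\<Sum>l\<in>{}. sobolev_weight d \<gamma> l * (\<Sum>k = 1..Z l. (coeff f l k)\<^sup>2))" by simp
      also have "\<dots> \<le> sobolev_norm d \<gamma> Z Y f" by (rule sum_sobolev_term_le[OF d(1) f]) simp
      finally show "0 \<le> sobolev_norm d \<gamma> Z Y f" .
    qed auto
    finally show ?thesis .
  qed
  then show "\<exists>N. \<forall>M\<ge>N. \<bar>equal_weight_rule X (expansion M (coeff f)) - sphere_integral f\<bar> \<le> ?R" by blast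
qed

end

text \<open>Makes ln N positive. The empty rule misses the constant 1, and a single node a misses
  the linear polynomial a . x, which has mean 0 but value 1 at a.\<close>

lemma design_card_ge_2:
  fixes X :: "(real ^ 'n::finite) set"
  assumes X: "spherical_design t X" and t: "t \<ge> 1"
  shows "card X \<ge> 2"
proof (rule ccontr)
  assume "\<not> card X \<ge> 2"
  then have "card X = 0 \<or> card X = 1" by auto
  then show False
  proof
    assume "card X = 0"
    moreover have "equal_weight_rule X (\<lambda>x. 1) = sphere_integral (\<lambda>x :: real ^ 'n. 1)"
      using X by (simp only: spherical_design_def polys_upto_const)
    ultimately show False by (simp add: equal_weight_rule_def)
  next
    assume "card X = 1"
    then obtain a where a: "X = {a}" by (auto simp: card_1_singleton_iff)
    have n: "norm a = 1" using X by (simp add: a spherical_design_def)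
    have h: "(\<lambda>x. a \<bullet> x) \<in> homogeneous_polys 1" by (rule homogeneous_polys_inner)
    then have "(\<lambda>x. a \<bullet> x) \<in> harmonic_polys 1"
      using laplacian_low_degree[OF h] by (simp add: harmonic_polys_def)
    then have "sphere_integral (\<lambda>x. a \<bullet> x) = 0" by (rule sphere_integral_harmonic) simp
    moreover have "equal_weight_rule X (\<lambda>x. a \<bullet> x) = sphere_integral (\<lambda>x. a \<bullet> x)"
      using X homogeneous_polys_subset_polys_upto[OF h t] by (simp add: spherical_design_def)
    ultimately show False using n by (simp add: equal_weight_rule_def a dot_square_norm)
  qed
qed

lemma sobolev_wce_upper:
  fixes b2 c3 \<gamma> :: real
  assumes d: "d \<ge> 2" "CARD('n::finite) = d + 1" and \<gamma>: "\<gamma> > 1 / 2" and b2: "b2 > 0" and c3: "c3 > 0"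
  shows "\<exists>C > 0. \<forall>Z Y t (X :: (real ^ 'n) set). harmonic_bases Z Y \<and> t \<ge> 1 \<and> spherical_design t X \<and>
    real (card X) \<le> b2 * real t ^ d \<and>
    (\<forall>x\<in>X. \<forall>y\<in>X. x \<noteq> y \<longrightarrow> dist x y > c3 * real (card X) powr (- 1 / real d)) \<longrightarrow>
    sobolev_wce d \<gamma> Z Y X \<le> ereal (C * real (card X) powr (- 1 / 2) * ln (real (card X)) powr (- \<gamma> + 1 / 2))"
proof -
  \<comment> \<open>As N <= b2 t^d, the separation c3 N^(-1/d) is at least c3 b2^(-1/d) / t, hence
    at least 2 e / t; the minimum secures \<open>e \<le> 1\<close> for the sieve.\<close>
  define e where "e = min 1 (c3 * b2 powr (- 1 / real d) / 2)"
  \<comment> \<open>Gives ln N <= \<kappa> ln (t + 1); the constant ln b2 is absorbed by ln (t + 1)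
    >= ln 2.\<close>
  define \<kappa> where "\<kappa> = \<bar>ln b2\<bar> / ln 2 + real d"
  \<comment> \<open>Has the value of the locale's \<open>point_const\<close>, but is fixed before Z
    and Y so that the final constant is uniform in them.\<close>
  define K where "K = real CARD('n) * 2 ^ CARD('n) * exp 2"
  define A where "A = tail_const d \<gamma> * (K / e ^ d) * \<kappa> powr (2 * \<gamma> - 1)"
  have e: "0 < e" "e \<le> 1" using b2 c3 by (auto simp: e_def)
  have \<kappa>: "\<kappa> > 0" using d by (auto simp: \<kappa>_def intro!: add_nonneg_pos)
  have K: "K > 0" by (simp add: K_def)
  have A: "A > 0" unfolding A_def using tail_const_pos[OF \<gamma>] e K \<kappa> by (intro mult_pos_pos) auto
  show ?thesis
  proof (intro exI[of _ "sqrt A"] conjI allI impI)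
    show "sqrt A > 0" using A by simp
    fix Z :: "nat \<Rightarrow> nat" and Y :: "nat \<Rightarrow> nat \<Rightarrow> real ^ 'n \<Rightarrow> real" and t :: nat and X :: "(real ^ 'n) set"
    assume asm: "harmonic_bases Z Y \<and> t \<ge> 1 \<and> spherical_design t X \<and>
      real (card X) \<le> b2 * real t ^ d \<and>
      (\<forall>x\<in>X. \<forall>y\<in>X. x \<noteq> y \<longrightarrow> dist x y > c3 * real (card X) powr (- 1 / real d))"
    define N where "N = real (card X)"
    interpret harmonic_basis Z Y by unfold_locales (use asm in simp)
    have t: "t \<ge> 1" and X: "spherical_design t X" and Nle: "N \<le> b2 * real t ^ d"
      using asm by (auto simp: N_def)
    have N2: "N \<ge> 2" using design_card_ge_2[OF X t] by (simp add: N_def)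
    have lnN: "ln N > 0" using N2 by simp
    have sep: "dist x y \<ge> 2 * (e / real t)" if "x \<in> X" "y \<in> X" "x \<noteq> y" for x y
    proof -
      have "2 * (e / real t) \<le> c3 * b2 powr (- 1 / real d) / real t"
        using t by (auto simp: e_def divide_simps)
      also have "\<dots> = c3 * (b2 * real t ^ d) powr (- 1 / real d)"
      proof -
        have "(real t ^ d) powr (- 1 / real d) = (real t powr real d) powr (- 1 / real d)"
          using t by (simp add: powr_realpow)
        also have "\<dots> = real t powr (- 1)" using d by (simp only: powr_powr) simp
        also have "\<dots> = 1 / real t" using t by (simp add: powr_minus_divide)
        finally show ?thesis using b2 by (simp add: powr_mult)
      qed
      also have "\<dots> \<le> c3 * N powr (- 1 / real d)"
        using c3 Nle N2 by (intro mult_left_mono powr_mono2') auto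
      also have "\<dots> < dist x y" using asm that by (auto simp: N_def)
      finally show ?thesis by simp
    qed
    have "ln N \<le> ln (b2 * real t ^ d)" using Nle N2 by (intro ln_mono) auto
    also have "\<dots> = ln b2 + real d * ln (real t)"
      using b2 t by (simp add: ln_mult ln_realpow)
    also have "\<dots> \<le> \<bar>ln b2\<bar> / ln 2 * ln (real t + 1) + real d * ln (real t + 1)"
    proof (intro add_mono mult_left_mono ln_mono)
      have "ln b2 \<le> \<bar>ln b2\<bar> / ln 2 * ln 2" by simp
      also have "\<dots> \<le> \<bar>ln b2\<bar> / ln 2 * ln (real t + 1)"
        using t by (intro mult_left_mono ln_mono) auto
      finally show "ln b2 \<le> \<bar>ln b2\<bar> / ln 2 * ln (real t + 1)" .
    qed (use t in auto)
    also have "\<dots> = \<kappa> * ln (real t + 1)" by (simp add: \<kappa>_def distrib_right)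
    finally have "ln N / \<kappa> \<le> ln (real t + 1)" using \<kappa> by (simp add: divide_le_eq mult.commute)
    then have "ln (real t + 1) powr (1 - 2 * \<gamma>) \<le> (ln N / \<kappa>) powr (1 - 2 * \<gamma>)"
      using \<gamma> lnN \<kappa> by (intro powr_mono2') auto
    also have "\<dots> = \<kappa> powr (2 * \<gamma> - 1) * ln N powr (1 - 2 * \<gamma>)"
      using lnN \<kappa> powr_minus[of \<kappa> "1 - 2 * \<gamma>"] by (simp add: powr_divide divide_simps)
    finally have ln_le: "ln (real t + 1) powr (1 - 2 * \<gamma>) \<le> \<kappa> powr (2 * \<gamma> - 1) * ln N powr (1 - 2 * \<gamma>)" .
    show "sobolev_wce d \<gamma> Z Y X \<le> ereal (sqrt A * real (card X) powr (- 1 / 2) * ln (real (card X)) powr (- \<gamma> + 1 / 2))"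
      unfolding sobolev_wce_def worst_case_error_def
    proof (rule SUP_least)
      fix f assume "f \<in> {f \<in> sobolev_space d \<gamma> Z Y. sobolev_norm d \<gamma> Z Y f \<le> 1}"
      then have f: "f \<in> sobolev_space d \<gamma> Z Y" "sobolev_norm d \<gamma> Z Y f \<le> 1" by auto
      have "\<bar>equal_weight_rule X f - sphere_integral f\<bar> \<le> sobolev_norm d \<gamma> Z Y f *
          sqrt (tail_const d \<gamma> * (K / e ^ d / N) * ln (real t + 1) powr (1 - 2 * \<gamma>))"
        using design_error_bound[OF d \<gamma> f(1) X t _ e sep] N2 by (simp add: N_def K_def point_const_def)
      also have "\<dots> \<le> 1 * sqrt (tail_const d \<gamma> * (K / e ^ d / N) * (\<kappa> powr (2 * \<gamma> - 1) * ln N powr (1 - 2 * \<gamma>)))"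
        using f(2) ln_le tail_const_pos[OF \<gamma>, of d] K e N2
        by (intro mult_mono real_sqrt_le_mono mult_left_mono) (auto intro!: mult_nonneg_nonneg)
      also have "\<dots> = sqrt (A * (1 / N) * ln N powr (1 - 2 * \<gamma>))"
        by (simp add: A_def mult_ac)
      also have "\<dots> = sqrt A * N powr (- 1 / 2) * ln N powr (- \<gamma> + 1 / 2)"
      proof -
        have "sqrt (1 / N) = N powr (- 1 / 2)"
          using N2 by (simp add: powr_minus_divide powr_half_sqrt real_sqrt_divide)
        moreover have "sqrt (ln N powr (1 - 2 * \<gamma>)) = ln N powr (- \<gamma> + 1 / 2)"
          using lnN by (simp add: powr_half_sqrt[symmetric] powr_powr field_simps)
        ultimately show ?thesis by (simp only: real_sqrt_mult)
      qed
      finally show "ereal \<bar>equal_weight_rule X f - sphere_integral f\<bar> \<le>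
          ereal (sqrt A * real (card X) powr (- 1 / 2) * ln (real (card X)) powr (- \<gamma> + 1 / 2))"
        by (simp add: N_def)
    qed
  qed
qed

section \<open>A localised polynomial kernel\<close>

fun chebyshev :: "nat \<Rightarrow> real \<Rightarrow> real" where
  "chebyshev 0 u = 1"
| "chebyshev (Suc 0) u = u"
| "chebyshev (Suc (Suc n)) u = 2 * u * chebyshev (Suc n) u - chebyshev n u"

lemma chebyshev_cos: "chebyshev n (cos \<theta>) = cos (real n * \<theta>)"
proof (induction n "cos \<theta>" rule: chebyshev.induct)
  case (3 n)
  have "cos (real (Suc (Suc n)) * \<theta>) + cos (real n * \<theta>) = 2 * cos \<theta> * cos (real (Suc n) * \<theta>)"
    using cos_add[of "real (Suc n) * \<theta>" \<theta>] cos_diff[of "real (Suc n) * \<theta>" \<theta>]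
    by (simp add: algebra_simps)
  then show ?case using 3 by simp
qed simp_all

text \<open>The trigonometric Dirichlet kernel written in u = cos \<theta>, so that inserting an
  inner product gives a polynomial of degree at most m on the ambient space.\<close>

definition dirichlet :: "nat \<Rightarrow> real \<Rightarrow> real" where
  "dirichlet m u = 1 + 2 * (\<Sum>j = 1..m. chebyshev j u)"

lemma dirichlet_sin: "dirichlet m (cos \<theta>) * sin (\<theta> / 2) = sin ((real m + 1 / 2) * \<theta>)"
proof (induction m)
  case (Suc m)
  have "dirichlet (Suc m) (cos \<theta>) * sin (\<theta> / 2) =
      dirichlet m (cos \<theta>) * sin (\<theta> / 2) + 2 * cos (real (Suc m) * \<theta>) * sin (\<theta> / 2)"
    by (simp add: dirichlet_def chebyshev_cos algebra_simps)
  also have "\<dots> = sin ((real m + 1 / 2) * \<theta>) + 2 * cos (real (Suc m) * \<theta>) * sin (\<theta> / 2)"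
    by (simp only: Suc.IH)
  also have "\<dots> = sin ((real (Suc m) + 1 / 2) * \<theta>)"
  proof -
    have 1: "(real m + 1 / 2) * \<theta> = real (Suc m) * \<theta> - \<theta> / 2"
      and 2: "(real (Suc m) + 1 / 2) * \<theta> = real (Suc m) * \<theta> + \<theta> / 2"
      by (simp_all add: algebra_simps)
    show ?thesis unfolding 1 2 sin_add sin_diff by simp
  qed
  finally show ?case .
qed (simp add: dirichlet_def)

lemma dirichlet_bound:
  assumes "\<bar>u\<bar> \<le> 1"
  shows "\<bar>dirichlet m u\<bar> \<le> 2 * real m + 1"
proof -
  have "\<bar>chebyshev j u\<bar> \<le> 1" for j
    using chebyshev_cos[of j "arccos u"] assms by (simp add: cos_arccos_abs)
  then have "\<bar>\<Sum>j = 1..m. chebyshev j u\<bar> \<le> (\<Sum>j = 1..m. 1)"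
    by (intro order_trans[OF sum_abs] sum_mono)
  then show ?thesis unfolding dirichlet_def by simp
qed

lemma dirichlet_1: "dirichlet m 1 = 2 * real m + 1"
proof -
  have "chebyshev j 1 = 1" for j using chebyshev_cos[of j 0] by simp
  then show ?thesis by (simp add: dirichlet_def)
qed

text \<open>For u = cos \<theta> the factor 2 - 2u equals 4 sin^2(\<theta>/2), the squared chordal
  distance of unit vectors with inner product u. The product form of the decay 2 / distance also
  covers u = 1.\<close>

lemma dirichlet_decay:
  assumes "\<bar>u\<bar> \<le> 1"
  shows "(dirichlet m u)\<^sup>2 * (2 - 2 * u) \<le> 4"
proof -
  define \<theta> where "\<theta> = arccos u"
  have u: "u = cos \<theta>" using assms by (simp add: \<theta>_def cos_arccos_abs)
  have "2 - 2 * u = 4 * (sin (\<theta> / 2))\<^sup>2"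
    using cos_double_sin[of "\<theta> / 2"] by (simp add: u)
  then have "(dirichlet m u)\<^sup>2 * (2 - 2 * u) = 4 * (dirichlet m u * sin (\<theta> / 2))\<^sup>2"
    by (simp add: power_mult_distrib)
  also have "\<dots> = 4 * (sin ((real m + 1 / 2) * \<theta>))\<^sup>2"
    unfolding u dirichlet_sin ..
  also have "\<dots> \<le> 4 * 1" by (intro mult_left_mono) (auto simp: abs_square_le_1)
  finally show ?thesis by simp
qed

lemma chebyshev_inner_polys_upto: "(\<lambda>x. chebyshev n (y \<bullet> x)) \<in> polys_upto n"
proof (induction n rule: induct_nat_012)
  case (ge2 n)
  have y: "(\<lambda>x. y \<bullet> x) \<in> polys_upto 1"
    by (rule homogeneous_polys_subset_polys_upto[OF homogeneous_polys_inner]) simp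
  have "(\<lambda>x. (2 * (y \<bullet> x)) * chebyshev (Suc n) (y \<bullet> x)) \<in> polys_upto (1 + Suc n)"
    by (rule polys_upto_mult[OF polys_upto_cmult[OF y] ge2(2)])
  moreover have "(\<lambda>x. (- 1) * chebyshev n (y \<bullet> x)) \<in> polys_upto (1 + Suc n)"
    by (rule polys_upto_cmult[OF polys_upto_mono[OF ge2(1)]]) simp
  ultimately show ?case
    using polys_upto_add by fastforce
qed (auto intro: homogeneous_polys_subset_polys_upto[OF homogeneous_polys_inner])

lemma dirichlet_inner_polys_upto: "(\<lambda>x. dirichlet m (y \<bullet> x)) \<in> polys_upto m"
  unfolding dirichlet_def
  by (intro polys_upto_add polys_upto_cmult polys_upto_sum polys_upto_const
      polys_upto_mono[OF chebyshev_inner_polys_upto]) auto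

section \<open>The measure of spherical caps\<close>

text \<open>The cone over the cap is covered by balls of radius 2r centred at the multiples jr x on
  its axis: a point of norm s is within 2r of the multiple with j = floor(s / r). At most 3 / r
  balls suffice if r <= 1; for larger r the bound exceeds 1.\<close>

lemma measure_radial_distr_cball_le:
  fixes x :: "real ^ 'n::finite"
  assumes x: "norm x = 1" and r: "r > 0"
  shows "measure radial_distr (cball x r) \<le> 3 * 2 ^ CARD('n) * r ^ (CARD('n) - 1)"
proof -
  interpret prob_space "radial_distr :: (real ^ 'n) measure" by (rule prob_space_radial_distr)
  show ?thesis
  proof (cases "r \<le> 1")
    case False
    have "(1 :: real) \<le> 3 * 2 ^ CARD('n)"
      using one_le_power[of "2 :: real" "CARD('n)"] by linarith
    moreover have "1 \<le> r ^ (CARD('n) - 1)" using False by (intro one_le_power) simp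
    ultimately have "1 * 1 \<le> 3 * 2 ^ CARD('n) * r ^ (CARD('n) - 1)"
      by (intro mult_mono) auto
    then show ?thesis using prob_le_1[of "cball x r"] by linarith
  next
    case True
    define n where "n = CARD('n)"
    let ?v = "measure lborel (ball (0 :: real ^ 'n) 1)"
    define I where "I = nat \<lceil>1 / r\<rceil>"
    let ?B = "\<lambda>j. cball ((real j * r) *\<^sub>R x) (2 * r)"
    have v: "?v > 0" by (simp add: content_ball_pos)
    have sub: "cone_of (cball x r) 1 \<subseteq> (\<Union>j\<in>{..I}. ?B j)"
    proof
      fix y assume "y \<in> cone_of (cball x r) 1"
      then have y: "norm y < 1" "dist x (sgn y) \<le> r" by (auto simp: cone_of_def)
      define s where "s = norm y"
      define j where "j = nat \<lfloor>s / r\<rfloor>"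
      have s: "0 \<le> s" "s \<le> 1" using y by (auto simp: s_def)
      have j: "real j \<le> s / r" "s / r < real j + 1"
        using s r by (auto simp: j_def)
      have "real j \<le> 1 / r" using j(1) s r by (meson divide_right_mono order_trans less_imp_le)
      then have "j \<le> I" unfolding I_def by linarith
      moreover have "dist ((real j * r) *\<^sub>R x) y \<le> 2 * r"
      proof -
        have "y = s *\<^sub>R sgn y" by (cases "y = 0") (simp_all add: s_def sgn_div_norm)
        then have "(real j * r) *\<^sub>R x - y = (real j * r - s) *\<^sub>R x + s *\<^sub>R (x - sgn y)"
          by (simp add: algebra_simps)
        then have "dist ((real j * r) *\<^sub>R x) y \<le> \<bar>real j * r - s\<bar> * norm x + s * norm (x - sgn y)"
          unfolding dist_norm using s norm_triangle_ineq[of "(real j * r - s) *\<^sub>R x" "s *\<^sub>R (x - sgn y)"] by simp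
        also have "\<dots> \<le> r + 1 * r"
        proof (intro add_mono mult_mono)
          show "\<bar>real j * r - s\<bar> * norm x \<le> r" using j r x by (simp add: field_simps abs_le_iff)
        qed (use s y in \<open>auto simp: dist_norm\<close>)
        finally show ?thesis by simp
      qed
      ultimately show "y \<in> (\<Union>j\<in>{..I}. ?B j)" by auto
    qed
    have fin: "emeasure lborel A < \<infinity>" if "bounded A" for A :: "(real ^ 'n) set"
      by (rule emeasure_bounded_finite[OF that])
    have "measure lborel (cone_of (cball x r) 1) \<le> measure lborel (\<Union>j\<in>{..I}. ?B j)"
      by (intro measure_mono_fmeasurable sub fmeasurableI fin) auto
    also have "\<dots> \<le> (\<Sum>j\<le>I. measure lborel (?B j))"
      by (intro measure_UNION_le) auto
    also have "\<dots> = (real I + 1) * ((2 * r) ^ n * ?v)"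
      using r by (simp add: content_cball content_ball n_def)
    also have "\<dots> \<le> (3 / r) * ((2 * r) ^ n * ?v)"
    proof (intro mult_right_mono)
      have "real I \<le> 1 / r + 1" unfolding I_def using r by (simp add: ceiling_correct less_imp_le)
      also have "1 / r + 1 + 1 \<le> 3 / r" using True r by (simp add: field_simps)
      finally show "real I + 1 \<le> 3 / r" by simp
    qed (use r v in auto)
    also have "\<dots> = ?v * (3 * 2 ^ n * r ^ (n - 1))"
    proof -
      have "r ^ n = r * r ^ (n - 1)" by (simp add: n_def power_Suc[symmetric] del: power_Suc)
      then show ?thesis using r by (simp add: power_mult_distrib)
    qed
    finally have le: "measure lborel (cone_of (cball x r) 1) \<le> ?v * (3 * 2 ^ n * r ^ (n - 1))" .
    have "measure radial_distr (cball x r) * ?v = measure lborel (cone_of (cball x r) 1)"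
      using emeasure_radial_distr[of "cball x r"] unfolding measure_def by (simp add: enn2real_mult[symmetric])
    with le have "?v * measure radial_distr (cball x r) \<le> ?v * (3 * 2 ^ n * r ^ (n - 1))"
      by (simp add: mult.commute)
    then show ?thesis using v unfolding n_def by (simp only: mult_le_cancel_left_pos)
  qed
qed

text \<open>A dyadic majorant. For the least i whose ball contains y, the kernel is at most a / 2^i:
  by the trivial bound if i = 0, and otherwise by the decay 2 / distance, as y lies outside the
  previous ball.\<close>

lemma dirichlet_kernel_pointwise:
  fixes x y :: "real ^ 'n::finite"
  assumes x: "norm x = 1" and y: "norm y = 1" and a: "a = 2 * real m + 1"
  shows "(dirichlet m (x \<bullet> y) ^ d)\<^sup>2 \<le>
    (\<Sum>i\<le>Suc m. (a / 2 ^ i) ^ (2 * d) * indicator (cball x (2 ^ (i + 2) / a)) y)"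
proof -
  have a1: "a \<ge> 1" using a by simp
  have u: "\<bar>x \<bullet> y\<bar> \<le> 1" using Cauchy_Schwarz_ineq2[of x y] x y by simp
  define \<rho> where "\<rho> = dist x y"
  have \<rho>2: "\<rho>\<^sup>2 = 2 - 2 * (x \<bullet> y)"
  proof -
    have "\<rho>\<^sup>2 = (x - y) \<bullet> (x - y)" by (simp only: \<rho>_def dist_norm power2_norm_eq_inner)
    also have "\<dots> = x \<bullet> x + y \<bullet> y - 2 * (x \<bullet> y)"
      by (simp add: inner_diff_left inner_diff_right inner_commute)
    finally show ?thesis using x y by (simp add: dot_square_norm)
  qed
  have \<rho>: "0 \<le> \<rho>" "\<rho> \<le> 2"
    using x y norm_triangle_ineq4[of x y] by (auto simp: \<rho>_def dist_norm)
  define P where "P = (\<lambda>i :: nat. \<rho> \<le> 2 ^ (i + 2) / a)"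
  \<comment> \<open>The last ball has radius at least 2, the diameter of the sphere, so a least
    index exists.\<close>
  have "P (Suc m)"
  proof -
    have "real (Suc m) \<le> real (2 ^ Suc m)"
      using less_exp[of "Suc m"] by (simp only: of_nat_le_iff less_imp_le)
    then have "2 * a \<le> 2 ^ (Suc m + 2)" using a by simp
    then have "2 \<le> 2 ^ (Suc m + 2) / a" using a1 by (subst pos_le_divide_eq) auto
    then show ?thesis using \<rho>(2) by (simp only: P_def)
  qed
  define i where "i = (LEAST i. P i)"
  have Pi: "P i" unfolding i_def by (rule LeastI[of P, OF \<open>P (Suc m)\<close>])
  have i: "i \<le> Suc m" unfolding i_def by (rule Least_le) fact
  have D: "\<bar>dirichlet m (x \<bullet> y)\<bar> \<le> a / 2 ^ i"
  proof (cases i)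
    case 0
    then show ?thesis using dirichlet_bound[OF u, of m] a by simp
  next
    case (Suc j)
    then have "\<not> P j" unfolding i_def using not_less_Least[of j P] by simp
    then have \<rho>j: "2 ^ (j + 2) / a < \<rho>" by (simp add: P_def)
    have "0 < 2 ^ (j + 2) / a" using a1 by simp
    then have \<rho>0: "\<rho> > 0" using \<rho>j by linarith
    have "(\<bar>dirichlet m (x \<bullet> y)\<bar> * \<rho>)\<^sup>2 \<le> 2\<^sup>2"
      using dirichlet_decay[OF u, of m] by (simp add: power_mult_distrib \<rho>2)
    then have "\<bar>dirichlet m (x \<bullet> y)\<bar> * \<rho> \<le> 2" by (rule power2_le_imp_le) simp
    then have "\<bar>dirichlet m (x \<bullet> y)\<bar> \<le> 2 / \<rho>" using \<rho>0 by (simp add: pos_le_divide_eq)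
    also have "\<dots> \<le> 2 / (2 ^ (j + 2) / a)" using \<rho>j \<rho>0 a1 by (intro divide_left_mono) auto
    also have "\<dots> = a / 2 ^ i" by (simp add: Suc)
    finally show ?thesis .
  qed
  have "(dirichlet m (x \<bullet> y) ^ d)\<^sup>2 = \<bar>dirichlet m (x \<bullet> y)\<bar> ^ (2 * d)"
    by (simp add: power_mult[symmetric] mult.commute power_even_abs)
  also have "\<dots> \<le> (a / 2 ^ i) ^ (2 * d)" by (intro power_mono D) simp
  also have "\<dots> = (a / 2 ^ i) ^ (2 * d) * indicator (cball x (2 ^ (i + 2) / a)) y"
    using Pi by (simp add: P_def \<rho>_def)
  also have "\<dots> \<le> (\<Sum>i\<le>Suc m. (a / 2 ^ i) ^ (2 * d) * indicator (cball x (2 ^ (i + 2) / a)) y)"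
    using i a1 by (intro member_le_sum) auto
  finally show ?thesis .
qed

text \<open>\<open>3 * 2 ^ Suc d\<close> is the cap constant for \<open>CARD('n) = d + 1\<close>,
  \<open>4 ^ d\<close> comes from the factor 4 in the radii \<open>2 ^ (i + 2) / a\<close>, and the
  remaining factor 2 bounds a geometric series.\<close>

definition kernel_const :: "nat \<Rightarrow> real" where
  "kernel_const d = 6 * 2 ^ Suc d * 4 ^ d"

text \<open>This is why the d-th power is squared: the decay 2^(-2di) outweighs the growth 2^(di) of
  the caps, the dyadic sum is geometric, and the integral has order a^d while the diagonal value is
  a^(2d).\<close>

lemma dirichlet_kernel_integral:
  fixes x :: "real ^ 'n::finite"
  assumes x: "norm x = 1" and d: "CARD('n) = d + 1" "d \<ge> 1"
  shows "sphere_integral (\<lambda>y. (dirichlet m (x \<bullet> y) ^ d)\<^sup>2) \<le> kernel_const d * (2 * real m + 1) ^ d"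
proof -
  interpret prob_space "radial_distr :: (real ^ 'n) measure" by (rule prob_space_radial_distr)
  define a where "a = 2 * real m + 1"
  have a1: "a \<ge> 1" using a_def by simp
  have p: "(\<lambda>y. (dirichlet m (x \<bullet> y) ^ d)\<^sup>2) \<in> polys_upto (2 * (d * m))"
    by (intro polys_upto_power dirichlet_inner_polys_upto)
  have meas: "(\<lambda>y. (dirichlet m (x \<bullet> y) ^ d)\<^sup>2) \<in> borel_measurable borel"
    by (rule borel_measurable_continuous_onI[OF continuous_on_polys_upto[OF p]])
  have "sphere_integral (\<lambda>y. (dirichlet m (x \<bullet> y) ^ d)\<^sup>2) = (LINT y|radial_distr. (dirichlet m (x \<bullet> y) ^ d)\<^sup>2)"
    by (rule sphere_integral_eq_radial[OF meas])
  also have "\<dots> \<le> (LINT y|radial_distr. (\<Sum>i\<le>Suc m. (a / 2 ^ i) ^ (2 * d) * indicator (cball x (2 ^ (i + 2) / a)) y))"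
  proof (rule integral_mono_AE)
    show "integrable radial_distr (\<lambda>y. (dirichlet m (x \<bullet> y) ^ d)\<^sup>2)"
      by (rule integrable_radial_distr_continuous[OF meas continuous_on_polys_upto[OF p]])
    show "integrable radial_distr (\<lambda>y. (\<Sum>i\<le>Suc m. (a / 2 ^ i) ^ (2 * d) * indicator (cball x (2 ^ (i + 2) / a)) y))"
      by (intro Bochner_Integration.integrable_sum integrable_mult_right integrable_real_indicator) (auto simp: emeasure_eq_measure)
    show "AE y in radial_distr. (dirichlet m (x \<bullet> y) ^ d)\<^sup>2 \<le>
        (\<Sum>i\<le>Suc m. (a / 2 ^ i) ^ (2 * d) * indicator (cball x (2 ^ (i + 2) / a)) y)"
      using AE_radial_distr_sphere
    proof eventually_elim
      case (elim y)
      then show ?case by (intro dirichlet_kernel_pointwise x a_def) simp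
    qed
  qed
  also have "\<dots> = (\<Sum>i\<le>Suc m. (a / 2 ^ i) ^ (2 * d) * measure radial_distr (cball x (2 ^ (i + 2) / a)))"
    by (subst Bochner_Integration.integral_sum)
      (auto intro!: integrable_mult_right integrable_real_indicator simp: emeasure_eq_measure)
  also have "\<dots> \<le> (\<Sum>i\<le>Suc m. (a / 2 ^ i) ^ (2 * d) * (3 * 2 ^ Suc d * (2 ^ (i + 2) / a) ^ d))"
    using measure_radial_distr_cball_le[OF x] a1 d by (intro sum_mono mult_left_mono) auto
  also have "\<dots> = (\<Sum>i\<le>Suc m. (3 * 2 ^ Suc d * 4 ^ d * a ^ d) * (1 / 2 ^ d) ^ i)"
  proof (intro sum.cong refl)
    fix i
    have "(a / 2 ^ i) ^ (2 * d) * (2 ^ (i + 2) / a) ^ d = ((a / 2 ^ i)\<^sup>2 * (2 ^ (i + 2) / a)) ^ d"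
      by (simp only: power_mult power_mult_distrib)
    also have "(a / 2 ^ i)\<^sup>2 * (2 ^ (i + 2) / a) = 4 * a * (1 / 2 ^ i)"
      using a1 by (simp add: power2_eq_square power_add divide_simps)
    also have "(4 * a * (1 / 2 ^ i)) ^ d = 4 ^ d * a ^ d * (1 / 2 ^ d) ^ i"
      by (simp add: power_mult_distrib power_divide power_mult[symmetric] mult.commute)
    finally show "(a / 2 ^ i) ^ (2 * d) * (3 * 2 ^ Suc d * (2 ^ (i + 2) / a) ^ d) =
        (3 * 2 ^ Suc d * 4 ^ d * a ^ d) * (1 / 2 ^ d) ^ i" by (simp only: mult_ac)
  qed
  also have "\<dots> = (3 * 2 ^ Suc d * 4 ^ d * a ^ d) * (\<Sum>i\<le>Suc m. (1 / 2 ^ d) ^ i)"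
    by (simp only: sum_distrib_left)
  also have "\<dots> \<le> (3 * 2 ^ Suc d * 4 ^ d * a ^ d) * 2"
  proof (intro mult_left_mono)
    have "(\<Sum>i\<le>Suc m. (1 / 2 ^ d) ^ i) \<le> (\<Sum>i\<le>Suc m. (1 / 2 :: real) ^ i)"
      using d self_le_power[of "2 :: real" d] by (intro sum_mono power_mono) (auto simp: divide_simps)
    also have "\<dots> \<le> 2"
    proof -
      have "(\<Sum>i\<le>M. (1 / 2 :: real) ^ i) = 2 - (1 / 2) ^ M" for M
        by (induction M) auto
      then show ?thesis by simp
    qed
    finally show "(\<Sum>i\<le>Suc m. (1 / 2 ^ d) ^ i) \<le> (2 :: real)" .
  qed (use a1 in auto)
  finally show ?thesis by (simp add: kernel_const_def a_def)
qed

lemma sphere_integral_swap: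
  fixes F :: "real ^ 'n::finite \<Rightarrow> real ^ 'n \<Rightarrow> real"
  assumes F: "continuous_on UNIV (\<lambda>z. F (fst z) (snd z))"
  shows "sphere_integral (\<lambda>y. sphere_integral (\<lambda>x. F x y)) = sphere_integral (\<lambda>x. sphere_integral (\<lambda>y. F x y))"
proof -
  let ?D = "radial_distr :: (real ^ 'n) measure"
  interpret D: prob_space ?D by (rule prob_space_radial_distr)
  interpret P: pair_prob_space ?D ?D by standard
  have m: "(\<lambda>z. F (fst z) (snd z)) \<in> borel_measurable (borel \<Otimes>\<^sub>M borel)"
    unfolding borel_prod by (rule borel_measurable_continuous_onI[OF F])
  have [measurable]: "case_prod F \<in> borel_measurable (?D \<Otimes>\<^sub>M ?D)"
    using m by (simp add: case_prod_unfold cong: measurable_cong_sets sets_pair_measure_cong)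
  have m1: "(\<lambda>x. F x y) \<in> borel_measurable borel" for y
    using measurable_Pair1'[of y borel borel] m
    by (intro borel_measurable_continuous_onI continuous_on_compose2[OF F, of _ "\<lambda>x. (x, y)", simplified])
      (auto intro!: continuous_intros)
  have m2: "(\<lambda>y. F x y) \<in> borel_measurable borel" for x
    by (intro borel_measurable_continuous_onI continuous_on_compose2[OF F, of _ "\<lambda>y. (x, y)", simplified])
      (auto intro!: continuous_intros)
  have "bounded ((\<lambda>z. F (fst z) (snd z)) ` (sphere 0 1 \<times> sphere 0 1))"
    by (intro compact_imp_bounded compact_continuous_image continuous_on_subset[OF F] compact_Times compact_sphere) auto
  then obtain B where B: "\<And>x y. norm x = 1 \<Longrightarrow> norm y = 1 \<Longrightarrow> \<bar>F x y\<bar> \<le> B"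
    by (force simp: bounded_iff)
  have int: "integrable (?D \<Otimes>\<^sub>M ?D) (case_prod F)"
  proof (rule P.integrable_const_bound[of _ B])
    show "AE z in ?D \<Otimes>\<^sub>M ?D. norm (case_prod F z) \<le> B"
    proof (rule P.AE_pair_measure)
      show "{z \<in> space (?D \<Otimes>\<^sub>M ?D). norm (case_prod F z) \<le> B} \<in> sets (?D \<Otimes>\<^sub>M ?D)" by measurable
      show "AE x in ?D. AE y in ?D. norm (case_prod F (x, y)) \<le> B"
        using AE_radial_distr_sphere
      proof eventually_elim
        case x: (elim x)
        show ?case using AE_radial_distr_sphere
          by eventually_elim (use x B in auto)
      qed
    qed
  qed measurable
  have i1: "(\<lambda>y. LINT x|?D. F x y) \<in> borel_measurable borel"
  proof -
    have "(\<lambda>y. LINT x|?D. F x y) \<in> borel_measurable ?D" by measurable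
    then show ?thesis by simp
  qed
  have i2: "(\<lambda>x. LINT y|?D. F x y) \<in> borel_measurable borel"
  proof -
    have "(\<lambda>x. LINT y|?D. F x y) \<in> borel_measurable ?D" by measurable
    then show ?thesis by simp
  qed
  show ?thesis
    unfolding sphere_integral_eq_radial[OF m1] sphere_integral_eq_radial[OF m2]
      sphere_integral_eq_radial[OF i1] sphere_integral_eq_radial[OF i2]
    by (rule P.Fubini_integral[OF int])
qed

section \<open>The lower bound\<close>

lemma continuous_on_sphere_integral:
  fixes F :: "real ^ 'n::finite \<Rightarrow> real ^ 'n \<Rightarrow> real"
  assumes F: "continuous_on UNIV (\<lambda>z. F (fst z) (snd z))"
  shows "continuous_on (sphere 0 1) (\<lambda>y. sphere_integral (\<lambda>x. F x y))"
proof -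
  let ?S = "sphere (0 :: real ^ 'n) 1"
  have Fx: "continuous_on A (\<lambda>x. F x y)" for y A
    using continuous_on_compose2[OF F, of A "\<lambda>x. (x, y)"] by (simp add: continuous_on_Pair)
  have uc: "uniformly_continuous_on (?S \<times> ?S) (\<lambda>z. F (fst z) (snd z))"
    by (intro compact_uniformly_continuous continuous_on_subset[OF F] compact_Times compact_sphere) auto
  show ?thesis
    unfolding continuous_on_iff
  proof (intro ballI allI impI)
    fix y :: "real ^ 'n" and e :: real
    assume y: "y \<in> ?S" and e: "e > 0"
    obtain \<delta> where \<delta>: "\<delta> > 0" "\<And>z z'. z \<in> ?S \<times> ?S \<Longrightarrow> z' \<in> ?S \<times> ?S \<Longrightarrow> dist z' z < \<delta> \<Longrightarrow>
        dist (F (fst z') (snd z')) (F (fst z) (snd z)) < e / 2"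
      using uc[unfolded uniformly_continuous_on_def, rule_format, of "e / 2"] e by auto
    show "\<exists>\<delta>>0. \<forall>y'\<in>?S. dist y' y < \<delta> \<longrightarrow>
        dist (sphere_integral (\<lambda>x. F x y')) (sphere_integral (\<lambda>x. F x y)) < e"
    proof (intro exI[of _ \<delta>] conjI ballI impI \<delta>(1))
      fix y' assume y': "y' \<in> ?S" "dist y' y < \<delta>"
      have "\<bar>sphere_integral (\<lambda>x. F x y' - F x y)\<bar> \<le> e / 2"
      proof (rule sphere_integral_abs_le)
        show "continuous_on ?S (\<lambda>x. F x y' - F x y)" by (intro continuous_intros Fx)
        fix x :: "real ^ 'n" assume "norm x = 1"
        then show "\<bar>F x y' - F x y\<bar> \<le> e / 2"
          using \<delta>(2)[of "(x, y)" "(x, y')"] y y' by (simp add: dist_Pair_Pair dist_real_def)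
      qed
      then show "dist (sphere_integral (\<lambda>x. F x y')) (sphere_integral (\<lambda>x. F x y)) < e"
        using e by (simp add: sphere_integral_diff[OF Fx Fx] dist_real_def)
    qed
  qed
qed

context harmonic_basis
begin

definition rule_energy :: "(real ^ 'n) set \<Rightarrow> nat \<Rightarrow> real" where
  "rule_energy X l = (\<Sum>k = 1..Z l. (equal_weight_rule X (Y l k))\<^sup>2)"

lemma rule_energy_nonneg: "rule_energy X l \<ge> 0"
  unfolding rule_energy_def by (intro sum_nonneg) simp

text \<open>
  On polynomials of degree at most \<open>D\<close> the rule is represented by the polynomial \<open>h\<close> whose squared norm is
  the energy of the rule. As the kernel is nonnegative with row integrals at most \<open>R\<close>, its quadratic form at \<open>h\<close>
  is at most \<open>R \<integral> h\<^sup>2\<close>, while the same quadratic form at the rule is bounded below by its diagonal.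
\<close>

lemma sum_rule_energy_ge:
  assumes d: "CARD('n) = d + 1" "d \<ge> 1" and X: "finite X" "X \<subseteq> sphere 0 1" "card X > 0"
  shows "(2 * real m + 1) ^ d / (kernel_const d * real (card X)) \<le> (\<Sum>l\<le>2 * (d * m). rule_energy X l)"
proof -
  let ?S = "sphere (0 :: real ^ 'n) 1"
  define D where "D = 2 * (d * m)"
  define M where "M = (\<lambda>x y :: real ^ 'n. (dirichlet m (x \<bullet> y) ^ d)\<^sup>2)"
  define q where "q = (\<lambda>l k. equal_weight_rule X (Y l k))"
  \<comment> \<open>Built from \<open>Yext\<close> because the lemmas on iterated integrals ask for
    integrands that are continuous on the whole space.\<close>
  define h where "h = (\<lambda>x. \<Sum>l\<le>D. \<Sum>k = 1..Z l. q l k * Yext l k x)"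
  define a where "a = 2 * real m + 1"
  define R where "R = kernel_const d * a ^ d"
  define E where "E = (\<Sum>l\<le>D. rule_energy X l)"
  have a1: "a \<ge> 1" by (simp add: a_def)
  have kc: "kernel_const d > 0" by (simp add: kernel_const_def)
  have R0: "R > 0" using a1 kc by (simp add: R_def)
  have X1: "norm x = 1" if "x \<in> X" for x using X(2) that by auto
  have Msym: "M x y = M y x" for x y by (simp add: M_def inner_commute)
  have pM: "M x \<in> polys_upto D" for x
    unfolding M_def D_def by (intro polys_upto_power dirichlet_inner_polys_upto)
  have pM': "(\<lambda>x. M x y) \<in> polys_upto D" for y
    using pM[of y] by (simp add: Msym[of _ y])
  have hE: "h x = expansion D q x" if "norm x = 1" for x
    unfolding h_def expansion_def by (intro sum.cong refl) (simp add: Yext(2)[OF _ that])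
  have ch: "continuous_on A h" for A
    unfolding h_def by (intro continuous_intros continuous_on_homogeneous_polys[OF harmonic_polys_homogeneous[OF Yext(1)]])
  have chx: "continuous_on A (\<lambda>x. h (f x))" if "continuous_on A f" for A :: "'b::topological_space set" and f
    by (rule continuous_on_compose2[OF ch[of UNIV] that]) simp
  have cdir: "continuous_on UNIV (dirichlet m)"
  proof -
    have "continuous_on UNIV (chebyshev j)" for j
      by (induction j rule: induct_nat_012) (auto intro!: continuous_intros)
    then show ?thesis unfolding dirichlet_def[abs_def] by (intro continuous_intros)
  qed
  have cM: "continuous_on A (\<lambda>x. M (f x) (g x))" if "continuous_on A f" "continuous_on A g"
    for A :: "'b::topological_space set" and f g
    unfolding M_def by (intro continuous_intros continuous_on_compose2[OF cdir] that) simp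
  have repr: "equal_weight_rule X p = sphere_integral (\<lambda>x. p x * h x)" if p: "p \<in> polys_upto D" for p
  proof -
    have "equal_weight_rule X p = equal_weight_rule X (expansion D (coeff p))"
      unfolding equal_weight_rule_def by (intro arg_cong2[of _ _ _ _ "(/)"] sum.cong refl polys_upto_expansion[OF p] X1)
    also have "\<dots> = (\<Sum>l\<le>D. \<Sum>k = 1..Z l. q l k * coeff p l k)"
      unfolding equal_weight_rule_expansion q_def by (simp add: mult.commute)
    also have "\<dots> = sphere_integral (\<lambda>x. p x * expansion D q x)"
      by (rule integral_expansion_mult[symmetric, OF continuous_on_polys_upto[OF p]])
    also have "\<dots> = sphere_integral (\<lambda>x. p x * h x)"
      by (rule sphere_integral_cong) (simp add: hE)
    finally show ?thesis .
  qed
  have IE: "sphere_integral (\<lambda>x. (h x)\<^sup>2) = E"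
  proof -
    have "sphere_integral (\<lambda>x. (h x)\<^sup>2) = sphere_integral (\<lambda>x. (expansion D q x)\<^sup>2)"
      by (rule sphere_integral_cong) (simp add: hE)
    then show ?thesis by (simp add: integral_expansion_square E_def rule_energy_def q_def)
  qed
  have row: "sphere_integral (\<lambda>x. M x y) \<le> R" if "norm y = 1" for y
    using dirichlet_kernel_integral[OF that d, of m] unfolding R_def a_def M_def
    by (simp add: inner_commute[of _ y])
  have row': "sphere_integral (\<lambda>y. M x y) \<le> R" if "norm x = 1" for x
    using row[OF that] by (simp add: Msym[of x])
  define T where "T = equal_weight_rule X (\<lambda>x. equal_weight_rule X (M x))"
  have "T = equal_weight_rule X (\<lambda>x. sphere_integral (\<lambda>y. M x y * h y))"
    unfolding T_def repr[OF pM] ..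
  also have "\<dots> = sphere_integral (\<lambda>y. \<Sum>x\<in>X. M x y * h y) / real (card X)"
    unfolding equal_weight_rule_def
    by (subst sphere_integral_sum) (auto intro!: continuous_intros cM ch)
  also have "\<dots> = sphere_integral (\<lambda>y. (1 / real (card X)) * (\<Sum>x\<in>X. M x y * h y))"
    unfolding sphere_integral_cmult by simp
  also have "(\<lambda>y. (1 / real (card X)) * (\<Sum>x\<in>X. M x y * h y)) = (\<lambda>y. equal_weight_rule X (\<lambda>x. M x y) * h y)"
    by (simp add: equal_weight_rule_def sum_distrib_right[symmetric])
  also have "\<dots> = (\<lambda>y. sphere_integral (\<lambda>x. M x y * h x) * h y)"
    unfolding repr[OF pM'] ..
  finally have T: "T = sphere_integral (\<lambda>y. sphere_integral (\<lambda>x. M x y * h x) * h y)" .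
  have c1: "continuous_on ?S (\<lambda>y. sphere_integral (\<lambda>x. M x y * h x))"
    by (rule continuous_on_sphere_integral) (intro continuous_intros cM chx)
  have c2: "continuous_on ?S (\<lambda>y. sphere_integral (\<lambda>x. M x y * (h x)\<^sup>2))"
    by (rule continuous_on_sphere_integral) (intro continuous_intros cM chx)
  \<comment> \<open>Schur test: 2 h(x) h(y) <= h(x)^2 + h(y)^2. The part with h(y)^2 meets the row
    integral at once, the part with h(x)^2 after the order of integration is exchanged.\<close>
  have "T \<le> sphere_integral (\<lambda>y. 1 / 2 * sphere_integral (\<lambda>x. M x y * (h x)\<^sup>2) + (R / 2) * (h y)\<^sup>2)"
    unfolding T
  proof (rule sphere_integral_mono)
    show "continuous_on ?S (\<lambda>y. sphere_integral (\<lambda>x. M x y * h x) * h y)"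
      by (intro continuous_intros c1 ch)
    show "continuous_on ?S (\<lambda>y. 1 / 2 * sphere_integral (\<lambda>x. M x y * (h x)\<^sup>2) + (R / 2) * (h y)\<^sup>2)"
      by (intro continuous_intros c2 ch)
    fix y :: "real ^ 'n" assume y: "norm y = 1"
    have "sphere_integral (\<lambda>x. M x y * h x) * h y = sphere_integral (\<lambda>x. h y * (M x y * h x))"
      by simp
    also have "\<dots> \<le> sphere_integral (\<lambda>x. 1 / 2 * (M x y * (h x)\<^sup>2) + ((h y)\<^sup>2 / 2) * M x y)"
    proof (rule sphere_integral_mono)
      fix x :: "real ^ 'n"
      have "2 * (h x * h y) \<le> (h x)\<^sup>2 + (h y)\<^sup>2"
        using sum_squares_bound[of "h x" "h y"] by (simp add: mult.assoc)
      then have "M x y * (2 * (h x * h y)) \<le> M x y * ((h x)\<^sup>2 + (h y)\<^sup>2)"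
        by (rule mult_left_mono) (simp add: M_def)
      then show "h y * (M x y * h x) \<le> 1 / 2 * (M x y * (h x)\<^sup>2) + ((h y)\<^sup>2 / 2) * M x y"
        by (simp add: algebra_simps)
    qed (intro continuous_intros cM ch)+
    also have "\<dots> = sphere_integral (\<lambda>x. 1 / 2 * (M x y * (h x)\<^sup>2)) + sphere_integral (\<lambda>x. ((h y)\<^sup>2 / 2) * M x y)"
      by (rule sphere_integral_add) (intro continuous_intros cM ch)+
    also have "\<dots> = 1 / 2 * sphere_integral (\<lambda>x. M x y * (h x)\<^sup>2) + ((h y)\<^sup>2 / 2) * sphere_integral (\<lambda>x. M x y)"
      unfolding sphere_integral_cmult ..
    also have "\<dots> \<le> 1 / 2 * sphere_integral (\<lambda>x. M x y * (h x)\<^sup>2) + ((h y)\<^sup>2 / 2) * R"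
      by (intro add_left_mono mult_left_mono row y) simp
    finally show "sphere_integral (\<lambda>x. M x y * h x) * h y \<le>
        1 / 2 * sphere_integral (\<lambda>x. M x y * (h x)\<^sup>2) + (R / 2) * (h y)\<^sup>2"
      by (simp add: mult.commute)
  qed
  also have "\<dots> = sphere_integral (\<lambda>y. 1 / 2 * sphere_integral (\<lambda>x. M x y * (h x)\<^sup>2)) +
      sphere_integral (\<lambda>y. (R / 2) * (h y)\<^sup>2)"
    by (rule sphere_integral_add) (intro continuous_intros c2 ch)+
  also have "\<dots> = 1 / 2 * sphere_integral (\<lambda>y. sphere_integral (\<lambda>x. M x y * (h x)\<^sup>2)) + (R / 2) * E"
    unfolding sphere_integral_cmult IE ..
  also have "sphere_integral (\<lambda>y. sphere_integral (\<lambda>x. M x y * (h x)\<^sup>2)) =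
      sphere_integral (\<lambda>x. sphere_integral (\<lambda>y. M x y * (h x)\<^sup>2))"
    by (rule sphere_integral_swap) (intro continuous_intros cM chx)
  also have "\<dots> \<le> sphere_integral (\<lambda>x. R * (h x)\<^sup>2)"
  proof (rule sphere_integral_mono)
    have "continuous_on ?S (\<lambda>y. sphere_integral (\<lambda>x. M x y * (h y)\<^sup>2))"
      by (rule continuous_on_sphere_integral) (intro continuous_intros cM chx)
    then show "continuous_on ?S (\<lambda>x. sphere_integral (\<lambda>y. M x y * (h x)\<^sup>2))"
      by (simp add: Msym)
    show "continuous_on ?S (\<lambda>x. R * (h x)\<^sup>2)" by (intro continuous_intros ch)
    fix x :: "real ^ 'n" assume x: "norm x = 1"
    have "sphere_integral (\<lambda>y. M x y * (h x)\<^sup>2) = (h x)\<^sup>2 * sphere_integral (\<lambda>y. M x y)"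
      unfolding sphere_integral_cmult[symmetric] by (rule sphere_integral_cong) simp
    also have "\<dots> \<le> (h x)\<^sup>2 * R" by (intro mult_left_mono row' x) simp
    finally show "sphere_integral (\<lambda>y. M x y * (h x)\<^sup>2) \<le> R * (h x)\<^sup>2" by (simp add: mult.commute)
  qed
  finally have "T \<le> 1 / 2 * sphere_integral (\<lambda>x. R * (h x)\<^sup>2) + (R / 2) * E" by simp
  then have T_le: "T \<le> R * E" by (simp add: IE mult.commute)
  have "a ^ d * a ^ d / real (card X) \<le> T"
  proof -
    have "(\<Sum>x\<in>X. a ^ d * a ^ d / real (card X)) \<le> (\<Sum>x\<in>X. equal_weight_rule X (M x))"
    proof (rule sum_mono)
      fix x assume x: "x \<in> X"
      have "a ^ d * a ^ d = M x x"
        using X1[OF x] by (simp add: M_def dot_square_norm dirichlet_1 a_def power2_eq_square)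
      also have "\<dots> \<le> (\<Sum>y\<in>X. M x y)"
        using X x by (intro member_le_sum) (auto simp: M_def)
      finally show "a ^ d * a ^ d / real (card X) \<le> equal_weight_rule X (M x)"
        unfolding equal_weight_rule_def by (rule divide_right_mono) simp
    qed
    then have "a ^ d * a ^ d \<le> (\<Sum>x\<in>X. equal_weight_rule X (M x))" using X by (cases "X = {}") simp_all
    then show ?thesis unfolding T_def equal_weight_rule_def[of X "\<lambda>x. equal_weight_rule X (M x)"]
      by (rule divide_right_mono) simp
  qed
  \<comment> \<open>One factor a^d is the order of the row integrals; the surplus of the diagonal is
    the asserted energy.\<close>
  with T_le have "a ^ d * (a ^ d / real (card X)) \<le> a ^ d * (kernel_const d * E)"
    by (simp add: R_def mult_ac)
  then have "a ^ d / real (card X) \<le> kernel_const d * E"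
    using a1 by (subst (asm) mult_le_cancel_left_pos) auto
  then have "a ^ d / real (card X) / kernel_const d \<le> E"
    using kc by (subst pos_divide_le_eq) (simp_all add: mult.commute)
  then show ?thesis unfolding a_def E_def D_def by (simp only: divide_divide_eq_left mult.commute)
qed

text \<open>Every nonempty point set is a design of degree 0. The value is needed because degree 0
  counts in the kernel bound but contributes no integration error.\<close>

lemma rule_energy_0:
  assumes X: "finite X" "X \<subseteq> sphere 0 1" "card X > 0"
  shows "rule_energy X 0 = 1"
proof -
  have "spherical_design 0 X"
    unfolding spherical_design_def
  proof (intro conjI ballI X)
    fix p :: "real ^ 'n \<Rightarrow> real" assume "p \<in> polys_upto 0"
    then obtain g where "\<And>l. g l \<in> homogeneous_polys l" "p = (\<lambda>x. \<Sum>l\<le>0. g l x)"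
      by (rule polys_uptoE) blast
    moreover obtain c where "g 0 = (\<lambda>x. c)" using homogeneous_polys_0E[OF \<open>\<And>l. g l \<in> _\<close>] by blast
    ultimately have "p = (\<lambda>x. c)" by simp
    then show "equal_weight_rule X p = sphere_integral p"
      using X by (cases "X = {}") (simp_all add: equal_weight_rule_def)
  qed
  then have "rule_energy X 0 = (\<Sum>k = 1..Z 0. coeff (\<lambda>x. 1) 0 k * sphere_integral (Y 0 k))"
    unfolding rule_energy_def using design_Y[of 0 X 0] by (simp add: coeff_def power2_eq_square)
  also have "\<dots> = sphere_integral (\<lambda>x :: real ^ 'n. 1)"
    by (rule integral_eq_zeroth_coeffs[symmetric]) simp
  finally show ?thesis by simp
qed

text \<open>The test function makes Cauchy-Schwarz an equality: coefficients proportional to rule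
  value over weight in degrees 1 to L, and none in degree 0, so that its integral is zero. As a
  finite expansion it has norm and error in closed form.\<close>

lemma sobolev_wce_ge:
  assumes d: "d \<ge> 2" and V: "V = (\<Sum>l = 1..L. rule_energy X l / sobolev_weight d \<gamma> l)" "V > 0"
  shows "ereal (sqrt V) \<le> sobolev_wce d \<gamma> Z Y X"
proof -
  define q where "q = (\<lambda>l k. equal_weight_rule X (Y l k))"
  define w where "w = sobolev_weight d \<gamma>"
  define c where "c = (\<lambda>l k. if l = 0 then 0 else q l k / (w l * sqrt V))"
  define f where "f = expansion L c"
  have w: "w l > 0" for l unfolding w_def by (rule sobolev_weight_pos[OF d])
  have cf: "continuous_on (sphere 0 1) f" unfolding f_def by (rule continuous_on_expansion)
  have tm: "sobolev_term d \<gamma> Z Y f l = (if l \<in> {1..L} then rule_energy X l / w l / V else 0)" for l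
  proof -
    have "(\<Sum>k = 1..Z l. (coeff f l k)\<^sup>2) = (\<Sum>k = 1..Z l. if l \<le> L then (c l k)\<^sup>2 else 0)"
      by (intro sum.cong refl) (simp add: f_def coeff_expansion)
    also have "\<dots> = (if l \<in> {1..L} then rule_energy X l / (w l)\<^sup>2 / V else 0)"
      using V(2) by (auto simp: c_def rule_energy_def q_def power_divide power_mult_distrib sum_divide_distrib)
    finally have eq: "sobolev_term d \<gamma> Z Y f l = w l * (if l \<in> {1..L} then rule_energy X l / (w l)\<^sup>2 / V else 0)"
      unfolding sobolev_term_eq w_def[symmetric] by simp
    show ?thesis
    proof (cases "l \<in> {1..L}")
      case True
      then show ?thesis unfolding eq using w[of l] by (simp add: power2_eq_square)
    next
      case False
      then show ?thesis by (simp only: eq False if_False mult_zero_right)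
    qed
  qed
  have fin: "sobolev_term d \<gamma> Z Y f l = 0" if "l \<notin> {1..L}" for l using that by (simp only: tm if_False)
  have "summable (sobolev_term d \<gamma> Z Y f)"
    by (rule summable_finite[of "{1..L}"]) (use fin in auto)
  then have space: "f \<in> sobolev_space d \<gamma> Z Y"
    using cf sphere_L2_continuous[OF cf] by (simp add: sobolev_space_def)
  have "(\<Sum>l. sobolev_term d \<gamma> Z Y f l) = (\<Sum>l = 1..L. sobolev_term d \<gamma> Z Y f l)"
    by (rule suminf_finite) (use fin in auto)
  also have "\<dots> = V / V"
    unfolding V(1) sum_divide_distrib by (intro sum.cong refl) (simp add: tm w_def V(1))
  finally have norm: "sobolev_norm d \<gamma> Z Y f \<le> 1" using V(2) by (simp add: sobolev_norm_def)
  have "sphere_integral f = (\<Sum>k = 1..Z 0. coeff f 0 k * sphere_integral (Y 0 k))"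
    by (rule integral_eq_zeroth_coeffs[OF cf])
  also have "\<dots> = 0"
    by (intro sum.neutral ballI) (simp add: f_def coeff_expansion c_def)
  finally have I: "sphere_integral f = 0" .
  have "equal_weight_rule X f = (\<Sum>l\<le>L. \<Sum>k = 1..Z l. c l k * q l k)"
    unfolding f_def equal_weight_rule_expansion q_def ..
  also have "\<dots> = (\<Sum>l = 1..L. \<Sum>k = 1..Z l. c l k * q l k)"
    by (rule sum.mono_neutral_right) (auto simp: c_def)
  also have "\<dots> = (\<Sum>l = 1..L. rule_energy X l / w l / sqrt V)"
    by (intro sum.cong refl) (simp add: c_def rule_energy_def q_def sum_divide_distrib power2_eq_square)
  also have "\<dots> = V / sqrt V"
  proof -
    have Vw: "V = (\<Sum>l = 1..L. rule_energy X l / w l)" by (simp only: V(1) w_def)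
    show ?thesis unfolding sum_divide_distrib[symmetric] Vw[symmetric] ..
  qed
  also have "\<dots> = sqrt V" by (rule real_div_sqrt) (use V in simp)
  finally have Q: "equal_weight_rule X f = sqrt V" .
  have "ereal \<bar>equal_weight_rule X f - sphere_integral f\<bar> \<le> sobolev_wce d \<gamma> Z Y X"
    unfolding sobolev_wce_def worst_case_error_def by (rule SUP_upper) (use space norm in simp)
  then show ?thesis unfolding I Q using V(2) by simp
qed

end

section \<open>Dyadic summation by parts for the lower bound\<close>

lemma sobolev_weight_mono:
  assumes "d \<ge> 2" "\<gamma> > 1 / 2" "l \<le> m"
  shows "sobolev_weight d \<gamma> l \<le> sobolev_weight d \<gamma> m"
proof -
  have l0: "0 \<le> laplace_eigenvalue d l" using assms by (simp add: laplace_eigenvalue_def)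
  have "laplace_eigenvalue d l \<le> laplace_eigenvalue d m"
    unfolding laplace_eigenvalue_def using assms by (intro mult_mono) auto
  then show ?thesis
    unfolding sobolev_weight_def using assms l0
    by (intro mult_mono powr_mono2 ln_mono) (auto intro: ln_ge_zero)
qed

text \<open>Makes 1/w drop at least by half from one dyadic degree to the next, so its difference is
  comparable to its value. Doubling l doubles 1 + \<lambda>, and the exponent d / 2 is at least
  1.\<close>

lemma sobolev_weight_double:
  assumes "d \<ge> 2" "\<gamma> > 1 / 2" "l \<ge> 1"
  shows "2 * sobolev_weight d \<gamma> l \<le> sobolev_weight d \<gamma> (2 * l)"
proof -
  let ?eig = "laplace_eigenvalue d"
  have l0: "0 \<le> ?eig l" using assms by (simp add: laplace_eigenvalue_def)
  have "1 * 1 \<le> real l * real l" using assms by (intro mult_mono) auto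
  then have eig: "2 * (1 + ?eig l) \<le> 1 + ?eig (2 * l)"
    by (simp add: laplace_eigenvalue_def algebra_simps)
  have "2 * (1 + ?eig l) powr (real d / 2) \<le> 2 powr (real d / 2) * (1 + ?eig l) powr (real d / 2)"
    using assms powr_mono[of 1 "real d / 2" "2 :: real"] by (intro mult_right_mono) auto
  also have "\<dots> = (2 * (1 + ?eig l)) powr (real d / 2)"
    by (rule powr_mult[symmetric])
  also have "\<dots> \<le> (1 + ?eig (2 * l)) powr (real d / 2)"
    using eig l0 by (intro powr_mono2) auto
  finally have 1: "2 * (1 + ?eig l) powr (real d / 2) \<le> (1 + ?eig (2 * l)) powr (real d / 2)" .
  have 2: "ln (3 + ?eig l) powr (2 * \<gamma>) \<le> ln (3 + ?eig (2 * l)) powr (2 * \<gamma>)"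
    using eig l0 assms by (intro powr_mono2 ln_mono) (auto intro: ln_ge_zero)
  show ?thesis
    unfolding sobolev_weight_def mult.assoc[symmetric] by (intro mult_mono 1 2) auto
qed

text \<open>For L = 2 d 2^j one has \<lambda> <= 2 L^2 and L >= 1, hence 1 + \<lambda> <= 3 L^2 = 12
  d^2 4^j and 3 + \<lambda> <= 5 L^2 = 20 d^2 4^j.\<close>

definition growth_const :: "nat \<Rightarrow> real \<Rightarrow> real" where
  "growth_const d \<gamma> = (12 * (real d)\<^sup>2) powr (real d / 2) * (ln (20 * (real d)\<^sup>2) + ln 4) powr (2 * \<gamma>)"

lemma growth_const_pos: "d \<ge> 2 \<Longrightarrow> growth_const d \<gamma> > 0"
proof -
  assume "d \<ge> 2"
  then have "1 \<le> (real d)\<^sup>2" by (intro one_le_power) simp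
  then have "ln (20 * (real d)\<^sup>2) > 0" by (intro ln_gt_zero) linarith
  moreover have "ln (4 :: real) > 0" by simp
  ultimately have "ln (20 * (real d)\<^sup>2) + ln 4 > 0" by linarith
  then show ?thesis unfolding growth_const_def using \<open>d \<ge> 2\<close> by (intro mult_pos_pos) auto
qed

text \<open>The degree 2 d 2^j is that of the squared kernel power in
  \<open>sum_rule_energy_ge\<close> with m = 2^j.\<close>

lemma sobolev_weight_dyadic_le:
  assumes d: "d \<ge> 2" and \<gamma>: "\<gamma> > 1 / 2"
  shows "sobolev_weight d \<gamma> (2 * (d * 2 ^ j)) \<le> growth_const d \<gamma> * 2 ^ (j * d) * (real j + 1) powr (2 * \<gamma>)"
proof -
  define L where "L = 2 * (d * 2 ^ j)"
  define lam where "lam = laplace_eigenvalue d L"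
  have d2: "1 \<le> (real d)\<^sup>2" using d by (intro one_le_power) simp
  have Lr: "real L = 2 * real d * 2 ^ j" by (simp add: L_def)
  have "real d * 1 \<le> real d * 2 ^ j" by (intro mult_left_mono) auto
  moreover have "real L = 2 * (real d * 2 ^ j)" by (simp add: Lr)
  moreover have "2 \<le> real d" using d by simp
  ultimately have dL: "real d \<le> real L" "1 \<le> real L" by linarith+
  have "1 * 1 \<le> real L * real L" using dL by (intro mult_mono) auto
  then have L2: "1 \<le> (real L)\<^sup>2" by (simp add: power2_eq_square)
  have "lam \<le> real L * (2 * real L)"
    unfolding lam_def laplace_eigenvalue_def using dL by (intro mult_left_mono) auto
  then have lam_le: "lam \<le> 2 * (real L)\<^sup>2" by (simp add: power2_eq_square)
  have lam0: "lam \<ge> 0" unfolding lam_def laplace_eigenvalue_def using d by simp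
  have Lsq: "(real L)\<^sup>2 = 4 * (real d)\<^sup>2 * (2 ^ j)\<^sup>2" unfolding Lr by (simp add: power_mult_distrib)
  have 1: "(1 + lam) powr (real d / 2) \<le> (12 * (real d)\<^sup>2) powr (real d / 2) * 2 ^ (j * d)"
  proof -
    have "(1 + lam) powr (real d / 2) \<le> (12 * (real d)\<^sup>2 * (2 ^ j)\<^sup>2) powr (real d / 2)"
      using lam_le lam0 L2 Lsq by (intro powr_mono2) auto
    also have "\<dots> = (12 * (real d)\<^sup>2) powr (real d / 2) * ((2 ^ j)\<^sup>2) powr (real d / 2)"
      by (simp add: powr_mult)
    also have "((2 ^ j)\<^sup>2) powr (real d / 2) = (2 :: real) ^ (j * d)"
    proof -
      have "((2 ^ j)\<^sup>2 :: real) = 2 ^ (j * 2)" by (simp only: power_mult)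
      also have "\<dots> = 2 powr real (j * 2)" by (rule powr_realpow[symmetric]) simp
      finally have "((2 ^ j)\<^sup>2) powr (real d / 2) = 2 powr (real (j * 2) * (real d / 2))"
        by (simp only: powr_powr)
      also have "real (j * 2) * (real d / 2) = real (j * d)" by simp
      also have "2 powr real (j * d) = 2 ^ (j * d)" by (rule powr_realpow) simp
      finally show ?thesis .
    qed
    finally show ?thesis .
  qed
  have 2: "ln (3 + lam) powr (2 * \<gamma>) \<le> (ln (20 * (real d)\<^sup>2) + ln 4) powr (2 * \<gamma>) * (real j + 1) powr (2 * \<gamma>)"
  proof -
    have ln20: "ln (20 * (real d)\<^sup>2) \<ge> 0" using d2 by (intro ln_ge_zero) linarith
    have "ln (3 + lam) \<le> ln (20 * (real d)\<^sup>2 * 4 ^ j)"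
    proof (rule ln_mono)
      have "(2 ^ j)\<^sup>2 = (4 :: real) ^ j" by (simp add: power2_eq_square power_mult_distrib[symmetric])
      then have "5 * (real L)\<^sup>2 = 20 * (real d)\<^sup>2 * 4 ^ j" by (simp add: Lsq)
      then show "3 + lam \<le> 20 * (real d)\<^sup>2 * 4 ^ j" using lam_le L2 by linarith
    qed (use lam0 in auto)
    also have "\<dots> = ln (20 * (real d)\<^sup>2) + real j * ln 4"
      using d2 by (subst ln_mult) (auto simp: ln_realpow)
    also have "\<dots> \<le> (ln (20 * (real d)\<^sup>2) + ln 4) * (real j + 1)"
    proof -
      have "0 \<le> ln (20 * (real d)\<^sup>2) * real j" "(0 :: real) \<le> ln 4" using ln20 by auto
      then show ?thesis by (simp add: algebra_simps)
    qed
    finally have "ln (3 + lam) powr (2 * \<gamma>) \<le> ((ln (20 * (real d)\<^sup>2) + ln 4) * (real j + 1)) powr (2 * \<gamma>)"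
      using \<gamma> lam0 by (intro powr_mono2) (auto intro: ln_ge_zero)
    also have "\<dots> = (ln (20 * (real d)\<^sup>2) + ln 4) powr (2 * \<gamma>) * (real j + 1) powr (2 * \<gamma>)"
      using ln20 by (simp add: powr_mult)
    finally show ?thesis .
  qed
  have "sobolev_weight d \<gamma> L = (1 + lam) powr (real d / 2) * ln (3 + lam) powr (2 * \<gamma>)"
    by (simp add: sobolev_weight_def lam_def)
  also have "\<dots> \<le> ((12 * (real d)\<^sup>2) powr (real d / 2) * 2 ^ (j * d)) *
      ((ln (20 * (real d)\<^sup>2) + ln 4) powr (2 * \<gamma>) * (real j + 1) powr (2 * \<gamma>))"
    by (intro mult_mono 1 2) auto
  finally show ?thesis by (simp add: growth_const_def L_def mult_ac)
qed

text \<open>Summation by parts along the degrees L j. It turns lower bounds for partial sums into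
  one for the weighted sum without any control of single blocks; subtracting the last weight removes
  the boundary term and makes the induction close.\<close>

lemma sum_weighted_ge_subsequence:
  fixes A v :: "nat \<Rightarrow> real" and L :: "nat \<Rightarrow> nat"
  assumes A: "\<And>l. A l \<ge> 0" and v: "\<And>l m. l \<le> m \<Longrightarrow> v m \<le> v l" and L: "\<And>j. L j \<le> L (Suc j)" and "J \<le> J'"
  shows "(\<Sum>j = J..<J'. (v (L j) - v (L (Suc j))) * (\<Sum>l = 1..L j. A l)) \<le> (\<Sum>l = 1..L J'. (v l - v (L J')) * A l)"
  using \<open>J \<le> J'\<close>
proof (induction J' rule: dec_induct)
  case base
  show ?case using A v by (auto intro!: sum_nonneg mult_nonneg_nonneg)
next
  case (step n)
  have "(\<Sum>j = J..<Suc n. (v (L j) - v (L (Suc j))) * (\<Sum>l = 1..L j. A l)) =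
      (\<Sum>j = J..<n. (v (L j) - v (L (Suc j))) * (\<Sum>l = 1..L j. A l)) +
      (v (L n) - v (L (Suc n))) * (\<Sum>l = 1..L n. A l)"
    using step.hyps by simp
  also have "\<dots> \<le> (\<Sum>l = 1..L n. (v l - v (L n)) * A l) + (v (L n) - v (L (Suc n))) * (\<Sum>l = 1..L n. A l)"
    using step.IH by simp
  also have "\<dots> = (\<Sum>l = 1..L n. (v l - v (L (Suc n))) * A l)"
    by (simp add: sum_distrib_left sum.distrib[symmetric] algebra_simps)
  also have "\<dots> \<le> (\<Sum>l = 1..L (Suc n). (v l - v (L (Suc n))) * A l)"
    using A v L[of n] by (intro sum_mono2) (auto intro!: mult_nonneg_nonneg)
  finally show ?case .
qed

lemma sobolev_wce_lower:
  fixes \<gamma> :: real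
  assumes d: "d \<ge> 2" "CARD('n::finite) = d + 1" and \<gamma>: "\<gamma> > 1 / 2"
  shows "\<exists>C > 0. \<forall>Z Y (X :: (real ^ 'n) set). harmonic_bases Z Y \<and> finite X \<and> X \<subseteq> sphere 0 1 \<and> card X \<ge> 2 \<longrightarrow>
    ereal (C * real (card X) powr (- 1 / 2) * ln (real (card X)) powr (- \<gamma> + 1 / 2)) \<le> sobolev_wce d \<gamma> Z Y X"
proof -
  define kc where "kc = kernel_const d"
  define B where "B = growth_const d \<gamma>"
  \<comment> \<open>Gives J <= \<kappa> ln N; the constant ln (4 kc) is absorbed by ln N >= ln
    2.\<close>
  define \<kappa> where "\<kappa> = (ln (4 * kc) / ln 2 + 1) / ln 2"
  \<comment> \<open>The 4 combines the halved weight difference with the halved energy; the power of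
    2 comes from j + 1 <= 2 J.\<close>
  define c where "c = 2 powr (- (2 * \<gamma>)) * \<kappa> powr (1 - 2 * \<gamma>) / (4 * kc * B)"
  have kc: "kc \<ge> 1"
  proof -
    have "1 \<le> (2 :: real) ^ Suc d" "1 \<le> (4 :: real) ^ d" by (intro one_le_power; simp)+
    then have "1 * 1 \<le> (2 :: real) ^ Suc d * 4 ^ d" by (intro mult_mono) auto
    then show ?thesis by (simp add: kc_def kernel_const_def)
  qed
  have B: "B > 0" unfolding B_def by (rule growth_const_pos[OF d(1)])
  have \<kappa>: "\<kappa> > 0" unfolding \<kappa>_def using kc by (intro divide_pos_pos add_nonneg_pos) auto
  have c: "c > 0" unfolding c_def using kc B \<kappa> by (intro divide_pos_pos mult_pos_pos) auto
  show ?thesis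
  proof (intro exI[of _ "sqrt c"] conjI allI impI)
    show "sqrt c > 0" using c by simp
    fix Z :: "nat \<Rightarrow> nat" and Y :: "nat \<Rightarrow> nat \<Rightarrow> real ^ 'n \<Rightarrow> real" and X :: "(real ^ 'n) set"
    assume asm: "harmonic_bases Z Y \<and> finite X \<and> X \<subseteq> sphere 0 1 \<and> card X \<ge> 2"
    then interpret harmonic_basis Z Y by unfold_locales simp
    define N where "N = real (card X)"
    have N: "N \<ge> 2" using asm by (simp add: N_def)
    have X: "finite X" "X \<subseteq> sphere 0 1" "card X > 0" using asm by auto
    have lnN: "ln N > 0" "ln N \<ge> ln 2" using N by auto
    \<comment> \<open>From the level with 2^J >= 2 kc N on, the lower bound for the total energy is
      at least 2 and so exceeds the contribution 1 of degree 0.\<close>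
    define J where "J = nat \<lceil>log 2 (2 * kc * N)\<rceil>"
    define L where "L = (\<lambda>j. 2 * (d * 2 ^ j) :: nat)"
    define v where "v = (\<lambda>l. 1 / sobolev_weight d \<gamma> l)"
    define A where "A = rule_energy X"
    have w: "sobolev_weight d \<gamma> l > 0" for l by (rule sobolev_weight_pos[OF d(1)])
    have kN: "2 * kc * N \<ge> 4"
    proof -
      have "1 * 2 \<le> kc * N" using kc N by (intro mult_mono) auto
      then show ?thesis by (simp add: mult.commute)
    qed
    have log2: "log 2 (2 * kc * N) \<ge> 2"
    proof -
      have log4: "log 2 (2 powr 2) = (2 :: real)" by (rule log_powr_cancel) auto
      have "log 2 (2 powr 2) \<le> log 2 (2 * kc * N)" using kN by (subst log_le_cancel_iff) auto
      then show ?thesis unfolding log4 .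
    qed
    have J: "real J \<ge> log 2 (2 * kc * N)" "real J \<le> log 2 (2 * kc * N) + 1" "J \<ge> 1"
      unfolding J_def using log2 by linarith+
    have twoJ: "2 ^ J \<ge> 2 * kc * N"
    proof -
      have "2 * kc * N = 2 powr log 2 (2 * kc * N)" using kN by simp
      also have "\<dots> \<le> 2 powr real J" using J by (intro powr_mono) auto
      finally show ?thesis by (simp add: powr_realpow)
    qed
    have Jle: "real J \<le> \<kappa> * ln N"
    proof -
      have "real J \<le> log 2 (4 * kc * N)"
        using J(2) kc N log_mult[of 2 2 "2 * kc * N"] by (simp add: mult.assoc)
      also have "\<dots> = (ln (4 * kc) + ln N) / ln 2"
        using kc N by (simp add: log_def ln_mult)
      also have "\<dots> \<le> (ln (4 * kc) / ln 2 * ln N + ln N) / ln 2"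
      proof (intro divide_right_mono add_right_mono)
        have "ln (4 * kc) = ln (4 * kc) / ln 2 * ln 2" by simp
        also have "\<dots> \<le> ln (4 * kc) / ln 2 * ln N" using lnN kc by (intro mult_left_mono) auto
        finally show "ln (4 * kc) \<le> ln (4 * kc) / ln 2 * ln N" .
      qed simp
      finally show ?thesis by (simp add: \<kappa>_def field_simps)
    qed
    \<comment> \<open>Dropping degree 0 costs at most half: with y for the left side, y + y <= 1 +
      sum and y >= 1 give y <= sum.\<close>
    have energy: "2 ^ (j * d) / (2 * kc * N) \<le> (\<Sum>l = 1..L j. A l)" if j: "j \<ge> J" for j
    proof -
      have "(2 ^ J :: real) \<le> 2 ^ (j * d)"
        using j d by (intro power_increasing) (auto intro: order_trans[of _ "j * 1"])
      then have "2 * kc * N \<le> 2 ^ (j * d)" using twoJ by linarith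
      then have big: "1 \<le> 2 ^ (j * d) / (2 * kc * N)" using kN by (simp only: le_divide_eq_1) auto
      have "2 ^ (j * d) / (kc * N) \<le> (2 * real (2 ^ j) + 1) ^ d / (kc * N)"
        unfolding power_mult using kc N by (intro divide_right_mono power_mono) auto
      also have "\<dots> \<le> (\<Sum>l\<le>L j. A l)"
        using sum_rule_energy_ge[OF d(2) _ X, of "2 ^ j"] d by (simp add: kc_def N_def A_def L_def)
      also have "\<dots> = A 0 + (\<Sum>l = 1..L j. A l)"
        by (simp only: sum.atMost_shift sum.atLeast1_atMost_eq One_nat_def)
      also have "A 0 = 1" unfolding A_def by (rule rule_energy_0[OF X])
      finally have le: "2 ^ (j * d) / (kc * N) \<le> 1 + (\<Sum>l = 1..L j. A l)" .
      define y where "y = 2 ^ (j * d) / (2 * kc * N)"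
      have "2 ^ (j * d) / (kc * N) = y + y" using kc N by (simp add: y_def field_simps)
      then have "y + y \<le> 1 + (\<Sum>l = 1..L j. A l)" using le by (simp only:)
      moreover have "1 \<le> y" unfolding y_def by (rule big)
      ultimately have "y \<le> (\<Sum>l = 1..L j. A l)" by linarith
      then show ?thesis by (simp only: y_def)
    qed
    \<comment> \<open>Cutting at 2 J leaves the J levels from J to 2 J - 1, on all of which j is
      comparable to ln N; together they give J^(1 - 2\<gamma>) / N.\<close>
    define V where "V = (\<Sum>l = 1..L (2 * J). rule_energy X l / sobolev_weight d \<gamma> l)"
    have vL: "2 powr (- (2 * \<gamma>)) * real J powr (- (2 * \<gamma>)) / (4 * kc * B * N) \<le>
        (v (L j) - v (L (Suc j))) * (\<Sum>l = 1..L j. A l)" if j: "j \<in> {J..<2 * J}" for j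
    proof -
      have "L j \<ge> 1" using d by (simp add: L_def)
      moreover have "L (Suc j) = 2 * L j" by (simp add: L_def)
      ultimately have "2 * sobolev_weight d \<gamma> (L j) \<le> sobolev_weight d \<gamma> (L (Suc j))"
        using sobolev_weight_double[OF d(1) \<gamma>] by simp
      then have "v (L (Suc j)) \<le> 1 / (2 * sobolev_weight d \<gamma> (L j))"
        unfolding v_def using w[of "L j"] by (intro divide_left_mono) auto
      then have v1: "v (L j) / 2 \<le> v (L j) - v (L (Suc j))" by (simp add: v_def)
      have wle: "sobolev_weight d \<gamma> (L j) \<le> B * 2 ^ (j * d) * (2 * real J) powr (2 * \<gamma>)"
      proof -
        have "sobolev_weight d \<gamma> (L j) \<le> B * 2 ^ (j * d) * (real j + 1) powr (2 * \<gamma>)"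
          unfolding L_def B_def by (rule sobolev_weight_dyadic_le[OF d(1) \<gamma>])
        also have "\<dots> \<le> B * 2 ^ (j * d) * (2 * real J) powr (2 * \<gamma>)"
          using j B \<gamma> by (intro mult_left_mono powr_mono2) auto
        finally show ?thesis .
      qed
      have pos: "(2 * real J) powr (2 * \<gamma>) > 0" using J by simp
      have "1 / (B * 2 ^ (j * d) * (2 * real J) powr (2 * \<gamma>)) \<le> v (L j)"
        unfolding v_def using wle w[of "L j"] B pos by (intro divide_left_mono) auto
      then have "1 / (B * 2 ^ (j * d) * (2 * real J) powr (2 * \<gamma>)) / 2 \<le> v (L j) / 2"
        by (rule divide_right_mono) simp
      from order_trans[OF this v1]
      have "1 / (B * 2 ^ (j * d) * (2 * real J) powr (2 * \<gamma>)) / 2 \<le> v (L j) - v (L (Suc j))" .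
      then have "1 / (B * 2 ^ (j * d) * (2 * real J) powr (2 * \<gamma>)) / 2 * (2 ^ (j * d) / (2 * kc * N)) \<le>
          (v (L j) - v (L (Suc j))) * (\<Sum>l = 1..L j. A l)"
      proof (rule mult_mono)
        have "0 \<le> v (L j) / 2" using w[of "L j"] by (simp add: v_def)
        then show "0 \<le> v (L j) - v (L (Suc j))" using v1 by (rule order_trans)
        show "2 ^ (j * d) / (2 * kc * N) \<le> (\<Sum>l = 1..L j. A l)" using j by (intro energy) simp
      qed (use kc N in auto)
      also have "1 / (B * 2 ^ (j * d) * (2 * real J) powr (2 * \<gamma>)) / 2 * (2 ^ (j * d) / (2 * kc * N)) =
          2 powr (- (2 * \<gamma>)) * real J powr (- (2 * \<gamma>)) / (4 * kc * B * N)"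
        using B by (simp add: powr_mult powr_minus divide_simps)
      finally show ?thesis .
    qed
    have "c * (1 / N) * ln N powr (1 - 2 * \<gamma>) =
        2 powr (- (2 * \<gamma>)) * (\<kappa> * ln N) powr (1 - 2 * \<gamma>) / (4 * kc * B * N)"
      using \<kappa> lnN by (simp add: c_def powr_mult)
    also have "\<dots> \<le> 2 powr (- (2 * \<gamma>)) * real J powr (1 - 2 * \<gamma>) / (4 * kc * B * N)"
      using Jle J \<gamma> kc B N by (intro divide_right_mono mult_left_mono powr_mono2') auto
    also have "\<dots> = (\<Sum>j = J..<2 * J. 2 powr (- (2 * \<gamma>)) * real J powr (- (2 * \<gamma>)) / (4 * kc * B * N))"
    proof -
      have "real J powr (1 - 2 * \<gamma>) = real J * real J powr (- (2 * \<gamma>))"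
        using J by (simp add: powr_diff powr_minus divide_simps)
      then show ?thesis by simp
    qed
    also have "\<dots> \<le> (\<Sum>j = J..<2 * J. (v (L j) - v (L (Suc j))) * (\<Sum>l = 1..L j. A l))"
      by (intro sum_mono vL)
    also have "\<dots> \<le> (\<Sum>l = 1..L (2 * J). (v l - v (L (2 * J))) * A l)"
    proof (rule sum_weighted_ge_subsequence)
      show "v m \<le> v l" if "l \<le> m" for l m
        unfolding v_def using sobolev_weight_mono[OF d(1) \<gamma> that] w by (intro divide_left_mono) auto
    qed (auto simp: A_def rule_energy_nonneg L_def)
    also have "\<dots> \<le> (\<Sum>l = 1..L (2 * J). v l * A l)"
      using w by (intro sum_mono mult_right_mono) (auto simp: A_def rule_energy_nonneg v_def less_imp_le)
    also have "\<dots> = V" by (simp add: V_def v_def A_def)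
    finally have V: "c * (1 / N) * ln N powr (1 - 2 * \<gamma>) \<le> V" .
    have "0 < c * (1 / N) * ln N powr (1 - 2 * \<gamma>)" using c N lnN by (intro mult_pos_pos) auto
    with V have Vpos: "V > 0" by linarith
    have "sqrt c * N powr (- 1 / 2) * ln N powr (- \<gamma> + 1 / 2) = sqrt (c * (1 / N) * ln N powr (1 - 2 * \<gamma>))"
    proof -
      have "sqrt (1 / N) = N powr (- 1 / 2)"
        using N by (simp add: powr_minus_divide powr_half_sqrt real_sqrt_divide)
      moreover have "sqrt (ln N powr (1 - 2 * \<gamma>)) = ln N powr (- \<gamma> + 1 / 2)"
        using lnN by (simp add: powr_half_sqrt[symmetric] powr_powr field_simps)
      ultimately show ?thesis by (simp only: real_sqrt_mult)
    qed
    also have "\<dots> \<le> sqrt V" using V by (rule real_sqrt_le_mono)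
    finally have "ereal (sqrt c * N powr (- 1 / 2) * ln N powr (- \<gamma> + 1 / 2)) \<le> ereal (sqrt V)" by simp
    also have "\<dots> \<le> sobolev_wce d \<gamma> Z Y X"
      by (rule sobolev_wce_ge[OF d(1) V_def Vpos])
    finally show "ereal (sqrt c * real (card X) powr (- 1 / 2) * ln (real (card X)) powr (- \<gamma> + 1 / 2)) \<le>
        sobolev_wce d \<gamma> Z Y X" by (simp only: N_def)
  qed
qed

text \<open>The lower constant is taken from \<open>sobolev_wce_lower\<close> before any sequence is
  fixed and serves both conjuncts; the upper one is chosen after c3 and the comparison
  constants.\<close>

theorem theorem1:
  fixes d :: nat and \<gamma> :: real
  assumes "d \<ge> 2" and "CARD('n :: finite) = d + 1" and "\<gamma> > 1 / 2"
  shows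
    "(\<forall>Z Y (X :: nat \<Rightarrow> (real ^ 'n) set).
        harmonic_bases Z Y \<and> design_sequence X \<and> (\<exists>c3. well_separated d c3 X) \<and>
        (\<exists>b1 b2. same_order b1 b2 (\<lambda>t. real (card (X t))) (\<lambda>t. real t ^ d)) \<longrightarrow>
        (\<exists>C1 > 0. \<exists>C2 > 0. two_sided_wce_bound d \<gamma> Z Y X C1 C2)) \<and>
     (\<forall>c1 c2 c3. \<exists>C1 > 0. \<forall>b1 b2. \<exists>C2 > 0. \<forall>Z Y (X :: nat \<Rightarrow> (real ^ 'n) set).
        harmonic_bases Z Y \<and> design_sequence X \<and> well_separated d c3 X \<and> property_R c1 c2 X \<and>
        same_order b1 b2 (\<lambda>t. real (card (X t))) (\<lambda>t. real t ^ d) \<longrightarrow>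
        two_sided_wce_bound d \<gamma> Z Y X C1 C2)"
proof -
  obtain C1 where C1: "C1 > 0" and lower: "\<And>Z Y (X :: (real ^ 'n) set). harmonic_bases Z Y \<and> finite X \<and>
      X \<subseteq> sphere 0 1 \<and> card X \<ge> 2 \<Longrightarrow>
    ereal (C1 * real (card X) powr (- 1 / 2) * ln (real (card X)) powr (- \<gamma> + 1 / 2)) \<le> sobolev_wce d \<gamma> Z Y X"
    using sobolev_wce_lower[OF assms] by blast
  have upper: "\<exists>C2 > 0. \<forall>Z Y (X :: nat \<Rightarrow> (real ^ 'n) set).
      harmonic_bases Z Y \<and> design_sequence X \<and> well_separated d c3 X \<and>
      same_order b1 b2 (\<lambda>t. real (card (X t))) (\<lambda>t. real t ^ d) \<longrightarrow>
      two_sided_wce_bound d \<gamma> Z Y X C1 C2" for c3 b1 b2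
  \<comment> \<open>The constants are quantified without sign conditions; if one of these is not
    positive, no sequence satisfies the premises and any C2 serves.\<close>
  proof (cases "b1 > 0 \<and> c3 > 0")
    case False
    then show ?thesis by (intro exI[of _ 1]) (auto simp: same_order_def well_separated_def)
  next
    case True
    then have b1: "1 / b1 > 0" and c3: "c3 > 0" by auto
    obtain C2 where C2: "C2 > 0" and C2_upper: "\<And>Z Y t (X :: (real ^ 'n) set). harmonic_bases Z Y \<and> t \<ge> 1 \<and>
        spherical_design t X \<and> real (card X) \<le> 1 / b1 * real t ^ d \<and>
        (\<forall>x\<in>X. \<forall>y\<in>X. x \<noteq> y \<longrightarrow> dist x y > c3 * real (card X) powr (- 1 / real d)) \<Longrightarrow>
        sobolev_wce d \<gamma> Z Y X \<le> ereal (C2 * real (card X) powr (- 1 / 2) * ln (real (card X)) powr (- \<gamma> + 1 / 2))"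
      using sobolev_wce_upper[OF assms b1 c3] by blast
    show ?thesis
    proof (intro exI[of _ C2] conjI allI impI C2)
      fix Z :: "nat \<Rightarrow> nat" and Y :: "nat \<Rightarrow> nat \<Rightarrow> real ^ 'n \<Rightarrow> real" and X :: "nat \<Rightarrow> (real ^ 'n) set"
      assume asm: "harmonic_bases Z Y \<and> design_sequence X \<and> well_separated d c3 X \<and>
        same_order b1 b2 (\<lambda>t. real (card (X t))) (\<lambda>t. real t ^ d)"
      show "two_sided_wce_bound d \<gamma> Z Y X C1 C2"
        unfolding two_sided_wce_bound_def Let_def
      proof (intro allI impI conjI)
        fix t :: nat assume t: "t \<ge> 1"
        have D: "spherical_design t (X t)" using asm t by (simp add: design_sequence_def)
        have "finite (X t)" "X t \<subseteq> sphere 0 1" using D by (auto simp: spherical_design_def)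
        then show "ereal (C1 * real (card (X t)) powr (- 1 / 2) * ln (real (card (X t))) powr (- \<gamma> + 1 / 2)) \<le>
            sobolev_wce d \<gamma> Z Y (X t)"
          using asm design_card_ge_2[OF D t] by (intro lower) simp
        \<comment> \<open>\<open>same_order\<close> bounds t^d in terms of N, so the constant
          bounding N by t^d is 1 / b1.\<close>
        have "b1 * real (card (X t)) \<le> real t ^ d" using asm t by (simp add: same_order_def)
        then have "real (card (X t)) \<le> 1 / b1 * real t ^ d" using True by (simp add: field_simps)
        then show "sobolev_wce d \<gamma> Z Y (X t) \<le>
            ereal (C2 * real (card (X t)) powr (- 1 / 2) * ln (real (card (X t))) powr (- \<gamma> + 1 / 2))"
          using asm t D by (intro C2_upper) (simp add: well_separated_def)
      qed
    qed
  qed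
  show ?thesis
  proof (intro conjI allI impI)
    fix Z :: "nat \<Rightarrow> nat" and Y :: "nat \<Rightarrow> nat \<Rightarrow> real ^ 'n \<Rightarrow> real" and X :: "nat \<Rightarrow> (real ^ 'n) set"
    assume asm: "harmonic_bases Z Y \<and> design_sequence X \<and> (\<exists>c3. well_separated d c3 X) \<and>
      (\<exists>b1 b2. same_order b1 b2 (\<lambda>t. real (card (X t))) (\<lambda>t. real t ^ d))"
    then obtain c3 b1 b2 where "well_separated d c3 X" "same_order b1 b2 (\<lambda>t. real (card (X t))) (\<lambda>t. real t ^ d)"
      by blast
    with asm upper[of c3 b1 b2] C1 show "\<exists>C1>0. \<exists>C2>0. two_sided_wce_bound d \<gamma> Z Y X C1 C2" by blast
  next
    fix c1 c2 c3 :: real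
    show "\<exists>C1>0. \<forall>b1 b2. \<exists>C2>0. \<forall>Z Y (X :: nat \<Rightarrow> (real ^ 'n) set).
        harmonic_bases Z Y \<and> design_sequence X \<and> well_separated d c3 X \<and> property_R c1 c2 X \<and>
        same_order b1 b2 (\<lambda>t. real (card (X t))) (\<lambda>t. real t ^ d) \<longrightarrow>
        two_sided_wce_bound d \<gamma> Z Y X C1 C2"
    proof (rule exI[of _ C1], intro conjI allI C1)
      fix b1 b2
      from upper[of c3 b1 b2] show "\<exists>C2>0. \<forall>Z Y (X :: nat \<Rightarrow> (real ^ 'n) set).
        harmonic_bases Z Y \<and> design_sequence X \<and> well_separated d c3 X \<and> property_R c1 c2 X \<and>
        same_order b1 b2 (\<lambda>t. real (card (X t))) (\<lambda>t. real t ^ d) \<longrightarrow>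
        two_sided_wce_bound d \<gamma> Z Y X C1 C2" by blast
    qed
  qed
qed

end
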